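(* For real coefficients $a_{ij},b_{ij}$ ($i,j\ge 0$, $0\le i+j\le 3$) and a real parameter $\varepsilon$, consider the polynomial planar differential system $$(\dot x,\dot y)=\bigl(-y(x^2+1)+\varepsilon P(x,y),\; x(x^2+1)+\varepsilon Q(x,y)\bigr),$$ where $P(x,y)=\sum_{i+j=0}^{3}a_{ij}x^iy^j$ and $Q(x,y)=\sum_{i+j=0}^{3}b_{ij}x^iy^j$. Let $f:(0,\infty)\to\mathbb{R}$ be its average function of first order, $$f(r)=\int_0^{2\pi}\frac{\cos\theta\,P(r\cos\theta,r\sin\theta)+\sin\theta\,Q(r\cos\theta,r\sin\theta)}{r^2\cos^2\theta+1}\,d\theta .$$ Suppose $f$ is not identically zero. Then, for $|\varepsilon|>0$ sufficiently small, the sharp upper bound for the number of limit cycles of the system bifurcating from the period annulus of the unperturbed system ($\varepsilon=0$) is $3$. That is: (1) For every choice of coefficients such that $f\not\equiv 0$ and every $0<r_1<r_2<\infty$, there is $\varepsilon_0>0$ such that for all $0<|\varepsilon|<\varepsilon_0$ the system has at most $3$ limit cycles contained in the annulus $\{r_1\le\sqrt{x^2+y^2}\le r_2\}$. (2) There exist coefficients with $f\not\equiv 0$, numbers $0<r_1<r_2<\infty$ and $\varepsilon_0>0$ such that for all $0<|\varepsilon|<\varepsilon_0$ the system has exactly $3$ limit cycles contained in the annulus $\{r_1\le\sqrt{x^2+y^2}\le r_2\}$.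
   Context: The unperturbed system $(\dot x,\dot y)=(-y(x^2+1),x(x^2+1))$ has a global center at the origin; its period annulus is $\mathbb{R}^2\setminus\{(0,0)\}$, foliated by the circles $x^2+y^2=r^2$, $r>0$. A limit cycle is an isolated periodic orbit. A limit cycle bifurcating from the period annulus is one that tends to some circle $x^2+y^2=r^2$ with $0<r<\infty$ as $\varepsilon\to0$. *)

theory Defs
  imports "HOL-Analysis.Analysis"
begin

definition global_solution :: "(real \<times> real \<Rightarrow> real \<times> real) \<Rightarrow> (real \<Rightarrow> real \<times> real) \<Rightarrow> bool" where
  "global_solution F u \<longleftrightarrow> (\<forall>t. (u has_vector_derivative F (u t)) (at t))"

(* A periodic orbit is the image of a nonconstant periodic solution: equilibria do not count, and
   solutions that differ by a time shift give the same orbit. *)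
definition periodic_orbit :: "(real \<times> real \<Rightarrow> real \<times> real) \<Rightarrow> (real \<times> real) set \<Rightarrow> bool" where
  "periodic_orbit F C \<longleftrightarrow>
     (\<exists>u T. global_solution F u \<and> T > 0 \<and> (\<forall>t. u (t + T) = u t) \<and>
            \<not> u constant_on UNIV \<and> C = range u)"

(* Isolated: some neighbourhood of the orbit contains no other periodic orbit. *)
definition limit_cycle :: "(real \<times> real \<Rightarrow> real \<times> real) \<Rightarrow> (real \<times> real) set \<Rightarrow> bool" where
  "limit_cycle F C \<longleftrightarrow> periodic_orbit F C \<and>
     (\<exists>U. open U \<and> C \<subseteq> U \<and> (\<forall>C'. periodic_orbit F C' \<and> C' \<subseteq> U \<longrightarrow> C' = C))"

definition annulus :: "real \<Rightarrow> real \<Rightarrow> (real \<times> real) set" where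
  "annulus r1 r2 = {(x, y). r1 \<le> sqrt (x\<^sup>2 + y\<^sup>2) \<and> sqrt (x\<^sup>2 + y\<^sup>2) \<le> r2}"

definition cubic :: "(nat \<Rightarrow> nat \<Rightarrow> real) \<Rightarrow> real \<Rightarrow> real \<Rightarrow> real" where
  "cubic c x y = (\<Sum>i\<le>3. \<Sum>j\<le>3 - i. c i j * x ^ i * y ^ j)"

definition perturbed_field ::
    "(nat \<Rightarrow> nat \<Rightarrow> real) \<Rightarrow> (nat \<Rightarrow> nat \<Rightarrow> real) \<Rightarrow> real \<Rightarrow> real \<times> real \<Rightarrow> real \<times> real" where
  "perturbed_field a b \<epsilon> = (\<lambda>(x, y).
     (- y * (x\<^sup>2 + 1) + \<epsilon> * cubic a x y, x * (x\<^sup>2 + 1) + \<epsilon> * cubic b x y))"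

definition average_function ::
    "(nat \<Rightarrow> nat \<Rightarrow> real) \<Rightarrow> (nat \<Rightarrow> nat \<Rightarrow> real) \<Rightarrow> real \<Rightarrow> real" where
  "average_function a b r = integral {0..2 * pi} (\<lambda>\<theta>.
     (cos \<theta> * cubic a (r * cos \<theta>) (r * sin \<theta>) + sin \<theta> * cubic b (r * cos \<theta>) (r * sin \<theta>))
       / (r\<^sup>2 * (cos \<theta>)\<^sup>2 + 1))"

definition limit_cycles_in ::
    "(real \<times> real \<Rightarrow> real \<times> real) \<Rightarrow> (real \<times> real) set \<Rightarrow> (real \<times> real) set set" where
  "limit_cycles_in F A = {C. limit_cycle F C \<and> C \<subseteq> A}"

end

theory Submission
  imports Defs "HOL-Library.Landau_Symbols"
begin

text \<open>
  In the variable \<open>w = sqrt (1 + r\<^sup>2)\<close> and with the polar angle as time the system is a scalar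
  equation \<open>dw/d\<theta> = \<epsilon> F(\<theta>, w, \<epsilon>)\<close>, and the mean of \<open>F(\<theta>, w, 0)\<close> over a period is a positive factor
  times an arbitrary cubic \<open>p(w)\<close>. If \<open>w\<^sub>0 < w\<^sub>1 < w\<^sub>2 < w\<^sub>3\<close> are \<open>2\<pi>\<close>-periodic solutions, then, since
  \<open>w\<^sub>i\<close> and \<open>ln (w\<^sub>i - w\<^sub>j)\<close> return to their initial values, the divided differences of \<open>F\<close> of order
  \<open>0, 1, 2, 3\<close> along the solutions have means that vanish up to \<open>O(\<epsilon>)\<close>; hence so do the divided
  differences of \<open>p\<close> at the four initial values, and Newton's interpolation formula yields
  \<open>p = O(\<epsilon>)\<close>, i.e. \<open>p = 0\<close>. Divided differences replace the smoothness of the Poincare map and take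
  care of multiple zeros of \<open>p\<close>. Conversely, every sign change of \<open>p\<close> gives a periodic solution by
  Lyapunov-Schmidt reduction, and \<open>p = (w - 2) (w - 3) (w - 4)\<close> has three of them.
\<close>

text \<open>The variable \<open>w\<close> is chosen because the mean of
  \<open>1 / (r^2 * (cos \<theta>)^2 + 1)\<close> over the circle is \<open>1 / w\<close>: written
  in \<open>r\<close> the average contains a square root, written in \<open>w\<close> it is a
  polynomial times an explicit positive factor. The obstacle to the upper bound is that the four
  solutions may lie arbitrarily close together, while every error bound must hold with one constant
  for all of them. Nothing is therefore estimated first and divided by a gap afterwards. Each gap
  between two solutions is compared with its own initial value; the logarithm of a gap has
  derivative O(\<epsilon>), so this quotient is \<open>1 + O(\<epsilon>)\<close> however small the
  gap is. At order three one more division by a gap occurs, and there two such quotients must be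
  shown to differ by O(\<epsilon>) times that gap. The lower bound depends on the upper one: only
  the bound by three shows that the three solutions found are all solutions in the closed annulus,
  so that their orbits are finitely many and each is isolated.\<close>

section \<open>Divided differences\<close>

text \<open>\<open>ddiff f x n i\<close> is the divided difference \<open>f[x\<^sub>i, \<dots>, x\<^sub>i\<^sub>+\<^sub>n]\<close>.\<close>

fun ddiff :: "(real \<Rightarrow> real) \<Rightarrow> (nat \<Rightarrow> real) \<Rightarrow> nat \<Rightarrow> nat \<Rightarrow> real" where
  "ddiff f x 0 i = f (x i)"
| "ddiff f x (Suc n) i = (ddiff f x n (Suc i) - ddiff f x n i) / (x (i + Suc n) - x i)"

lemma ddiff_step:
  assumes "x (i + Suc n) \<noteq> x i"
  shows "(x (i + Suc n) - x i) * ddiff f x (Suc n) i = ddiff f x n (Suc i) - ddiff f x n i"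
  using assms by simp

lemma ddiff_cong:
  assumes "\<And>k. k \<in> {i..i+n} \<Longrightarrow> f (x k) = g (x k)"
  shows "ddiff f x n i = ddiff g x n i"
  using assms
proof (induction n arbitrary: i)
  case (Suc n)
  have "ddiff f x n (Suc i) = ddiff g x n (Suc i)" "ddiff f x n i = ddiff g x n i"
    by (rule Suc.IH, rule Suc.prems, simp)+
  then show ?case by simp
qed simp

lemma ddiff_const: "ddiff (\<lambda>_. c) x n i = (if n = 0 then c else 0)"
  by (induction n arbitrary: i) auto

lemma ddiff_id:
  assumes "inj_on x {i..i+n}"
  shows "ddiff (\<lambda>t. t) x n i = (if n = 0 then x i else if n = 1 then 1 else 0)"
  using assms
proof (induction n arbitrary: i)
  case (Suc n)
  have "ddiff (\<lambda>t. t) x n (Suc i) = (if n = 0 then x (Suc i) else if n = 1 then 1 else 0)"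
    by (rule Suc.IH, rule inj_on_subset[OF Suc.prems]) auto
  moreover have "ddiff (\<lambda>t. t) x n i = (if n = 0 then x i else if n = 1 then 1 else 0)"
    by (rule Suc.IH, rule inj_on_subset[OF Suc.prems]) auto
  moreover have "x (Suc i) \<noteq> x i" using Suc.prems by (auto dest: inj_onD)
  ultimately show ?case by auto
qed simp

lemma ddiff_add: "ddiff (\<lambda>t. f t + g t) x n i = ddiff f x n i + ddiff g x n i"
  by (induction n arbitrary: i) (auto simp: add_divide_distrib diff_divide_distrib)

text \<open>Leibniz rule. The factor \<open>x (i + Suc n) - x i\<close> is split at the node
  \<open>i + k\<close>: one part lowers the order of the divided difference of \<open>g\<close>, the
  other that of \<open>f\<close>. After an index shift the mixed terms cancel and the rules of order
  \<open>n\<close> at \<open>Suc i\<close> and at \<open>i\<close> remain.\<close>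

lemma ddiff_mult:
  assumes "inj_on x {i..i+n}"
  shows "ddiff (\<lambda>t. f t * g t) x n i = (\<Sum>k\<le>n. ddiff f x k i * ddiff g x (n - k) (i + k))"
  using assms
proof (induction n arbitrary: i)
  case (Suc n)
  define fa where "fa k = ddiff f x k i" for k
  define gb where "gb k = ddiff g x (Suc n - k) (i + k)" for k
  define fm where "fm k = ddiff f x k (Suc i)" for k
  define gm where "gm k = ddiff g x (n - k) (i + k)" for k
  have ne: "x j \<noteq> x k" if "j \<in> {i..i+Suc n}" "k \<in> {i..i+Suc n}" "j \<noteq> k" for j k
    using Suc.prems that by (auto dest: inj_onD)
  have IH1: "ddiff (\<lambda>t. f t * g t) x n (Suc i) = (\<Sum>k\<le>n. fm k * gb (Suc k))"
    unfolding fm_def gb_def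
    by (subst Suc.IH, rule inj_on_subset[OF Suc.prems]) auto
  have IH2: "ddiff (\<lambda>t. f t * g t) x n i = (\<Sum>k\<le>n. fa k * gm k)"
    unfolding fa_def gm_def
    by (rule Suc.IH, rule inj_on_subset[OF Suc.prems]) auto
  have stepf: "(x (i + Suc k) - x i) * fa (Suc k) = fm k - fa k" if "k \<le> n" for k
    unfolding fa_def fm_def by (rule ddiff_step, rule ne) (use that in auto)
  have stepg: "(x (i + Suc n) - x (i + k)) * gb k = gb (Suc k) - gm k" if "k \<le> n" for k
  proof -
    have "Suc n - k = Suc (n - k)" "i + k + Suc (n - k) = i + Suc n" using that by auto
    then show ?thesis
      using ddiff_step[of x "i + k" "n - k" g] ne[of "i + Suc n" "i + k"] that
      unfolding gb_def gm_def by simp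
  qed
  have "(x (i + Suc n) - x i) * (\<Sum>k\<le>Suc n. fa k * gb k)
      = (\<Sum>k\<le>Suc n. fa k * ((x (i + Suc n) - x (i + k)) * gb k)) + (\<Sum>k\<le>Suc n. ((x (i + k) - x i) * fa k) * gb k)"
    by (simp add: sum_distrib_left sum.distrib[symmetric] algebra_simps del: sum.atMost_Suc)
  also have "(\<Sum>k\<le>Suc n. fa k * ((x (i + Suc n) - x (i + k)) * gb k))
      = (\<Sum>k\<le>n. fa k * ((x (i + Suc n) - x (i + k)) * gb k))" by simp
  also have "\<dots> = (\<Sum>k\<le>n. fa k * (gb (Suc k) - gm k))"
    by (rule sum.cong) (simp_all only: stepg atMost_iff)
  also have "(\<Sum>k\<le>Suc n. ((x (i + k) - x i) * fa k) * gb k)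
      = (\<Sum>k\<le>n. ((x (i + Suc k) - x i) * fa (Suc k)) * gb (Suc k))"
    by (subst sum.atMost_Suc_shift) simp
  also have "\<dots> = (\<Sum>k\<le>n. (fm k - fa k) * gb (Suc k))"
    by (rule sum.cong) (simp_all only: stepf atMost_iff)
  finally have "(x (i + Suc n) - x i) * (\<Sum>k\<le>Suc n. fa k * gb k)
      = (\<Sum>k\<le>n. fm k * gb (Suc k)) - (\<Sum>k\<le>n. fa k * gm k)"
    by (simp add: sum.distrib[symmetric] sum_subtractf[symmetric] algebra_simps)
  then have "(\<Sum>k\<le>Suc n. fa k * gb k) = ddiff (\<lambda>t. f t * g t) x (Suc n) i"
    using ne[of "i + Suc n" i] by (simp add: IH1 IH2 field_simps del: sum.atMost_Suc)
  then show ?case unfolding fa_def gb_def by simp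
qed simp

text \<open>The nodes do not depend on \<open>t\<close>, so the divided difference is a fixed linear
  combination of values and commutes with the integral.\<close>

lemma ddiff_has_integral:
  assumes "\<And>k. k \<in> {i..i+n} \<Longrightarrow> ((\<lambda>t. f t (x k)) has_integral g (x k)) A"
  shows "((\<lambda>t. ddiff (f t) x n i) has_integral ddiff g x n i) A"
  using assms
proof (induction n arbitrary: i)
  case (Suc n)
  have "((\<lambda>t. ddiff (f t) x n (Suc i)) has_integral ddiff g x n (Suc i)) A"
    "((\<lambda>t. ddiff (f t) x n i) has_integral ddiff g x n i) A"
    by (rule Suc.IH, rule Suc.prems, simp)+
  then show ?case by (auto intro!: has_integral_divide has_integral_diff)
qed simp

section \<open>Bounds on divided differences that are uniform over families of nodes\<close>

locale node_family =
  fixes S :: "'p set" and X Y :: "'p \<Rightarrow> nat \<Rightarrow> real" and \<delta> :: "'p \<Rightarrow> real" and m :: nat and R :: real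
  assumes inj: "p \<in> S \<Longrightarrow> inj_on (X p) {..m}" "p \<in> S \<Longrightarrow> inj_on (Y p) {..m}"
    and bounded: "p \<in> S \<Longrightarrow> i \<le> m \<Longrightarrow> \<bar>X p i\<bar> \<le> R" "p \<in> S \<Longrightarrow> i \<le> m \<Longrightarrow> \<bar>Y p i\<bar> \<le> R"
    and near: "p \<in> S \<Longrightarrow> i \<le> m \<Longrightarrow> \<bar>X p i - Y p i\<bar> \<le> \<delta> p"
begin

text \<open>For the filter \<open>principal S\<close>, eventually means everywhere on
  \<open>S\<close>, so the O-notation stands for one constant valid for the whole family.
  Boundedness is included to make the relation stable under products. The nodes of each member are
  distinct but their gaps have no lower bound, so all constants survive when nodes coalesce.\<close>

definition good :: "('p \<Rightarrow> real) \<Rightarrow> ('p \<Rightarrow> real) \<Rightarrow> bool" where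
  "good \<phi> \<psi> \<longleftrightarrow> \<phi> \<in> O[principal S](\<lambda>_. 1) \<and> \<psi> \<in> O[principal S](\<lambda>_. 1)
     \<and> (\<lambda>p. \<phi> p - \<psi> p) \<in> O[principal S](\<delta>)"

lemma bigo_princI:
  fixes \<phi> \<eta> :: "'p \<Rightarrow> real"
  assumes "\<And>p. p \<in> S \<Longrightarrow> \<bar>\<phi> p\<bar> \<le> c * \<bar>\<eta> p\<bar>"
  shows "\<phi> \<in> O[principal S](\<eta>)"
  by (rule bigoI[of _ c]) (use assms in \<open>auto simp: eventually_principal\<close>)

lemma goodI:
  assumes "\<And>p. p \<in> S \<Longrightarrow> \<bar>\<phi> p\<bar> \<le> A" "\<And>p. p \<in> S \<Longrightarrow> \<bar>\<psi> p\<bar> \<le> B"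
    "\<And>p. p \<in> S \<Longrightarrow> \<bar>\<phi> p - \<psi> p\<bar> \<le> C * \<bar>\<delta> p\<bar>"
  shows "good \<phi> \<psi>"
  unfolding good_def
proof (intro conjI)
  show "\<phi> \<in> O[principal S](\<lambda>_. 1)" by (rule bigo_princI[where c = A]) (use assms(1) in simp)
  show "\<psi> \<in> O[principal S](\<lambda>_. 1)" by (rule bigo_princI[where c = B]) (use assms(2) in simp)
  show "(\<lambda>p. \<phi> p - \<psi> p) \<in> O[principal S](\<delta>)" by (rule bigo_princI[where c = C]) (rule assms(3))
qed

lemma good_const: "(\<And>p. p \<in> S \<Longrightarrow> \<bar>c p\<bar> \<le> A) \<Longrightarrow> good c c"
  by (rule goodI[where C = 0]) auto

lemma good_zero: "good (\<lambda>_. 0) (\<lambda>_. 0)"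
  and good_one: "good (\<lambda>_. 1) (\<lambda>_. 1)"
  and good_minus_one: "good (\<lambda>_. - 1) (\<lambda>_. - 1)"
  by (rule good_const[where A = 1]; simp)+

lemma good_cong:
  assumes "good \<phi> \<psi>" "\<And>p. p \<in> S \<Longrightarrow> \<phi> p = \<phi>' p" "\<And>p. p \<in> S \<Longrightarrow> \<psi> p = \<psi>' p"
  shows "good \<phi>' \<psi>'"
proof -
  have "\<phi>' \<in> O[principal S](\<lambda>_. 1) \<longleftrightarrow> \<phi> \<in> O[principal S](\<lambda>_. 1)"
    "\<psi>' \<in> O[principal S](\<lambda>_. 1) \<longleftrightarrow> \<psi> \<in> O[principal S](\<lambda>_. 1)"
    "(\<lambda>p. \<phi>' p - \<psi>' p) \<in> O[principal S](\<delta>) \<longleftrightarrow> (\<lambda>p. \<phi> p - \<psi> p) \<in> O[principal S](\<delta>)"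
    by (rule landau_o.big.in_cong; use assms in \<open>simp add: eventually_principal\<close>)+
  then show ?thesis using assms(1) by (simp add: good_def)
qed

lemma good_add:
  assumes "good \<phi> \<psi>" "good \<phi>' \<psi>'"
  shows "good (\<lambda>p. \<phi> p + \<phi>' p) (\<lambda>p. \<psi> p + \<psi>' p)"
proof -
  have "(\<lambda>p. (\<phi> p - \<psi> p) + (\<phi>' p - \<psi>' p)) \<in> O[principal S](\<delta>)"
    using assms by (intro sum_in_bigo(1)) (auto simp: good_def)
  then have "(\<lambda>p. (\<phi> p + \<phi>' p) - (\<psi> p + \<psi>' p)) \<in> O[principal S](\<delta>)" by (simp add: algebra_simps)
  moreover have "(\<lambda>p. \<phi> p + \<phi>' p) \<in> O[principal S](\<lambda>_. 1)" "(\<lambda>p. \<psi> p + \<psi>' p) \<in> O[principal S](\<lambda>_. 1)"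
    using assms by (intro sum_in_bigo(1); simp add: good_def)+
  ultimately show ?thesis unfolding good_def by blast
qed

lemma good_mult:
  assumes "good \<phi> \<psi>" "good \<phi>' \<psi>'"
  shows "good (\<lambda>p. \<phi> p * \<phi>' p) (\<lambda>p. \<psi> p * \<psi>' p)"
proof -
  have "(\<lambda>p. (\<phi> p - \<psi> p) * \<phi>' p) \<in> O[principal S](\<lambda>p. \<delta> p * 1)"
    using assms by (intro landau_o.big_mult) (auto simp: good_def)
  moreover have "(\<lambda>p. \<psi> p * (\<phi>' p - \<psi>' p)) \<in> O[principal S](\<lambda>p. 1 * \<delta> p)"
    using assms by (intro landau_o.big_mult) (auto simp: good_def)
  ultimately have "(\<lambda>p. (\<phi> p - \<psi> p) * \<phi>' p + \<psi> p * (\<phi>' p - \<psi>' p)) \<in> O[principal S](\<delta>)"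
    by (intro sum_in_bigo) auto
  moreover have "(\<lambda>p. \<phi> p * \<phi>' p) \<in> O[principal S](\<lambda>p. 1 * 1)" "(\<lambda>p. \<psi> p * \<psi>' p) \<in> O[principal S](\<lambda>p. 1 * 1)"
    using assms by (intro landau_o.big_mult; simp add: good_def)+
  ultimately show ?thesis unfolding good_def by (auto simp: algebra_simps)
qed

lemma good_uminus: "good \<phi> \<psi> \<Longrightarrow> good (\<lambda>p. - \<phi> p) (\<lambda>p. - \<psi> p)"
  using good_mult[OF good_minus_one, of \<phi> \<psi>] by simp

lemma good_sum:
  assumes "finite I" "\<And>k. k \<in> I \<Longrightarrow> good (\<phi> k) (\<psi> k)"
  shows "good (\<lambda>p. \<Sum>k\<in>I. \<phi> k p) (\<lambda>p. \<Sum>k\<in>I. \<psi> k p)"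
  using assms by (induction I rule: finite_induct) (simp_all add: good_zero good_add)

lemma good_bound:
  assumes "good \<phi> \<psi>"
  obtains M where "0 < M" "\<And>p. p \<in> S \<Longrightarrow> \<bar>\<phi> p\<bar> \<le> M" "\<And>p. p \<in> S \<Longrightarrow> \<bar>\<psi> p\<bar> \<le> M"
    "\<And>p. p \<in> S \<Longrightarrow> \<bar>\<phi> p - \<psi> p\<bar> \<le> M * \<bar>\<delta> p\<bar>"
proof -
  obtain A B C where *: "A > 0" "B > 0" "C > 0"
    "\<And>p. p \<in> S \<Longrightarrow> \<bar>\<phi> p\<bar> \<le> A" "\<And>p. p \<in> S \<Longrightarrow> \<bar>\<psi> p\<bar> \<le> B"
    "\<And>p. p \<in> S \<Longrightarrow> \<bar>\<phi> p - \<psi> p\<bar> \<le> C * \<bar>\<delta> p\<bar>"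
    using assms unfolding good_def
    by (elim conjE landau_o.bigE) (auto simp: eventually_principal)
  show ?thesis
  proof (rule that[of "A + B + C"])
    fix p assume "p \<in> S"
    note h = *(4-6)[OF this]
    show "\<bar>\<phi> p\<bar> \<le> A + B + C" "\<bar>\<psi> p\<bar> \<le> A + B + C" using h * by auto
    have "C * \<bar>\<delta> p\<bar> \<le> (A + B + C) * \<bar>\<delta> p\<bar>" using * by (intro mult_right_mono) auto
    then show "\<bar>\<phi> p - \<psi> p\<bar> \<le> (A + B + C) * \<bar>\<delta> p\<bar>" using h by simp
  qed (use * in simp)
qed

lemma good_inverse:
  assumes "good \<phi> \<psi>" "0 < c" "\<And>p. p \<in> S \<Longrightarrow> c \<le> \<bar>\<phi> p\<bar>" "\<And>p. p \<in> S \<Longrightarrow> c \<le> \<bar>\<psi> p\<bar>"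
  shows "good (\<lambda>p. inverse (\<phi> p)) (\<lambda>p. inverse (\<psi> p))"
proof -
  obtain M where M: "0 < M" "\<And>p. p \<in> S \<Longrightarrow> \<bar>\<phi> p - \<psi> p\<bar> \<le> M * \<bar>\<delta> p\<bar>"
    using good_bound[OF assms(1)] by metis
  show ?thesis
  proof (rule goodI[where A = "inverse c" and B = "inverse c" and C = "M * inverse c * inverse c"])
    fix p assume p: "p \<in> S"
    show *: "\<bar>inverse (\<phi> p)\<bar> \<le> inverse c" "\<bar>inverse (\<psi> p)\<bar> \<le> inverse c"
      using assms(2) assms(3,4)[OF p] by (simp_all add: le_imp_inverse_le)
    have "\<phi> p \<noteq> 0" "\<psi> p \<noteq> 0" using assms(2) assms(3,4)[OF p] by auto
    then have "inverse (\<phi> p) - inverse (\<psi> p) = - ((\<phi> p - \<psi> p) * inverse (\<phi> p) * inverse (\<psi> p))"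
      by (simp add: field_simps)
    then have "\<bar>inverse (\<phi> p) - inverse (\<psi> p)\<bar> = \<bar>\<phi> p - \<psi> p\<bar> * \<bar>inverse (\<phi> p)\<bar> * \<bar>inverse (\<psi> p)\<bar>"
      by (simp add: abs_mult)
    also have "\<dots> \<le> (M * \<bar>\<delta> p\<bar>) * inverse c * inverse c"
      using * M assms(2) p by (intro mult_mono) auto
    finally show "\<bar>inverse (\<phi> p) - inverse (\<psi> p)\<bar> \<le> M * inverse c * inverse c * \<bar>\<delta> p\<bar>"
      by (simp add: mult_ac)
  qed
qed

lemma good_sqrt:
  assumes "good \<phi> \<psi>" "0 < c" "\<And>p. p \<in> S \<Longrightarrow> c\<^sup>2 \<le> \<phi> p" "\<And>p. p \<in> S \<Longrightarrow> c\<^sup>2 \<le> \<psi> p"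
  shows "good (\<lambda>p. sqrt (\<phi> p)) (\<lambda>p. sqrt (\<psi> p))"
proof -
  obtain M where M: "0 < M" "\<And>p. p \<in> S \<Longrightarrow> \<bar>\<phi> p - \<psi> p\<bar> \<le> M * \<bar>\<delta> p\<bar>"
     "\<And>p. p \<in> S \<Longrightarrow> \<bar>\<phi> p\<bar> \<le> M" "\<And>p. p \<in> S \<Longrightarrow> \<bar>\<psi> p\<bar> \<le> M"
    using good_bound[OF assms(1)] by metis
  show ?thesis
  proof (rule goodI[where A = "sqrt M" and B = "sqrt M" and C = "M / c"])
    fix p assume p: "p \<in> S"
    have nn: "0 \<le> \<phi> p" "0 \<le> \<psi> p"
      by (rule order_trans[OF zero_le_power2[of c]], rule assms(3,4)[OF p])+
    show "\<bar>sqrt (\<phi> p)\<bar> \<le> sqrt M" "\<bar>sqrt (\<psi> p)\<bar> \<le> sqrt M"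
      using M(3,4)[OF p] nn by auto
    have ge: "c \<le> sqrt (\<phi> p)" "c \<le> sqrt (\<psi> p)" by (rule real_le_rsqrt, rule assms(3,4)[OF p])+
    have "(sqrt (\<phi> p) - sqrt (\<psi> p)) * (sqrt (\<phi> p) + sqrt (\<psi> p)) = \<phi> p - \<psi> p"
      using nn by (simp add: algebra_simps)
    then have "\<bar>sqrt (\<phi> p) - sqrt (\<psi> p)\<bar> * \<bar>sqrt (\<phi> p) + sqrt (\<psi> p)\<bar> = \<bar>\<phi> p - \<psi> p\<bar>"
      by (metis abs_mult)
    moreover have "\<bar>sqrt (\<phi> p) - sqrt (\<psi> p)\<bar> * c \<le> \<bar>sqrt (\<phi> p) - sqrt (\<psi> p)\<bar> * \<bar>sqrt (\<phi> p) + sqrt (\<psi> p)\<bar>"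
      using ge assms(2) by (intro mult_left_mono) auto
    ultimately have "\<bar>sqrt (\<phi> p) - sqrt (\<psi> p)\<bar> * c \<le> M * \<bar>\<delta> p\<bar>" using M(2)[OF p] by simp
    then show "\<bar>sqrt (\<phi> p) - sqrt (\<psi> p)\<bar> \<le> M / c * \<bar>\<delta> p\<bar>"
      using assms(2) by (simp add: field_simps)
  qed
qed

text \<open>Bounds on the divided differences up to order \<open>m\<close>, and their Lipschitz dependence on the nodes,
  are derived algebraically from the Leibniz rule, so that no derivatives in \<open>w\<close> are ever needed.\<close>

definition tame :: "('p \<Rightarrow> real \<Rightarrow> real) \<Rightarrow> ('p \<Rightarrow> real \<Rightarrow> real) \<Rightarrow> bool" where
  "tame g h \<longleftrightarrow> (\<forall>n i. n + i \<le> m \<longrightarrow> good (\<lambda>p. ddiff (g p) (X p) n i) (\<lambda>p. ddiff (h p) (Y p) n i))"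

lemma tameD: "tame g h \<Longrightarrow> n + i \<le> m \<Longrightarrow> good (\<lambda>p. ddiff (g p) (X p) n i) (\<lambda>p. ddiff (h p) (Y p) n i)"
  by (simp add: tame_def)

lemma inj_nodes:
  assumes "p \<in> S" "n + i \<le> m"
  shows "inj_on (X p) {i..i+n}" "inj_on (Y p) {i..i+n}"
  using assms by (auto intro!: inj_on_subset[OF inj(1)] inj_on_subset[OF inj(2)])

lemma tame_const:
  assumes "good c d"
  shows "tame (\<lambda>p _. c p) (\<lambda>p _. d p)"
  unfolding tame_def ddiff_const
proof (intro allI impI)
  fix n i :: nat
  show "good (\<lambda>p. if n = 0 then c p else 0) (\<lambda>p. if n = 0 then d p else 0)"
    by (cases "n = 0") (simp_all add: assms good_zero)
qed

lemma tame_id: "tame (\<lambda>_ t. t) (\<lambda>_ t. t)"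
  unfolding tame_def
proof (intro allI impI)
  fix n i assume ni: "n + i \<le> m"
  have "good (\<lambda>p. X p i) (\<lambda>p. Y p i)"
  proof (rule goodI[where A = R and B = R and C = 1])
    fix p assume p: "p \<in> S"
    show "\<bar>X p i\<bar> \<le> R" "\<bar>Y p i\<bar> \<le> R" using bounded[OF p, of i] ni by simp_all
    show "\<bar>X p i - Y p i\<bar> \<le> 1 * \<bar>\<delta> p\<bar>" using near[OF p, of i] ni by simp
  qed
  then have "good (\<lambda>p. if n = 0 then X p i else if n = 1 then 1 else 0) (\<lambda>p. if n = 0 then Y p i else if n = 1 then 1 else 0)"
    by (cases "n = 0"; cases "n = 1") (simp_all add: good_zero good_one)
  then show "good (\<lambda>p. ddiff (\<lambda>t. t) (X p) n i) (\<lambda>p. ddiff (\<lambda>t. t) (Y p) n i)"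
    by (rule good_cong) (simp_all add: ddiff_id[OF inj_nodes(1)] ddiff_id[OF inj_nodes(2)] ni)
qed

lemma tame_add: "tame g h \<Longrightarrow> tame g' h' \<Longrightarrow> tame (\<lambda>p t. g p t + g' p t) (\<lambda>p t. h p t + h' p t)"
  unfolding tame_def ddiff_add by (auto intro: good_add)

lemma tame_mult:
  assumes "tame g h" "tame g' h'"
  shows "tame (\<lambda>p t. g p t * g' p t) (\<lambda>p t. h p t * h' p t)"
  unfolding tame_def
proof (intro allI impI)
  fix n i assume ni: "n + i \<le> m"
  have "good (\<lambda>p. \<Sum>k\<le>n. ddiff (g p) (X p) k i * ddiff (g' p) (X p) (n - k) (i + k))
    (\<lambda>p. \<Sum>k\<le>n. ddiff (h p) (Y p) k i * ddiff (h' p) (Y p) (n - k) (i + k))"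
    using ni by (intro good_sum good_mult tameD[OF assms(1)] tameD[OF assms(2)]) auto
  then show "good (\<lambda>p. ddiff (\<lambda>t. g p t * g' p t) (X p) n i) (\<lambda>p. ddiff (\<lambda>t. h p t * h' p t) (Y p) n i)"
    by (rule good_cong) (simp_all add: ddiff_mult[OF inj_nodes(1)] ddiff_mult[OF inj_nodes(2)] ni)
qed

lemma tame_uminus: "tame g h \<Longrightarrow> tame (\<lambda>p t. - g p t) (\<lambda>p t. - h p t)"
  using tame_mult[OF tame_const[OF good_minus_one], of g h] by simp

lemma tame_diff: "tame g h \<Longrightarrow> tame g' h' \<Longrightarrow> tame (\<lambda>p t. g p t - g' p t) (\<lambda>p t. h p t - h' p t)"
  unfolding diff_conv_add_uminus by (rule tame_add[OF _ tame_uminus])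

lemma tame_power: "tame g h \<Longrightarrow> tame (\<lambda>p t. g p t ^ k) (\<lambda>p t. h p t ^ k)"
  proof (induction k)
  case 0
  show ?case unfolding power_0 by (rule tame_const[OF good_one])
next
  case (Suc k)
  show ?case unfolding power_Suc by (rule tame_mult[OF Suc.prems Suc.IH[OF Suc.prems]])
qed

lemma tame_sum:
  assumes "finite I" "\<And>k. k \<in> I \<Longrightarrow> tame (g k) (h k)"
  shows "tame (\<lambda>p t. \<Sum>k\<in>I. g k p t) (\<lambda>p t. \<Sum>k\<in>I. h k p t)"
  using assms by (induction I rule: finite_induct) (simp_all add: tame_add tame_const[OF good_zero])

text \<open>The Leibniz rule for \<open>g * (1 / g) = 1\<close>, whose divided differences of
  positive order vanish, is solved for the term \<open>k = 0\<close>. The remaining terms contain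
  only lower orders of \<open>1 / g\<close>, which makes this a recursion for
  \<open>tame_inverse\<close>.\<close>

lemma ddiff_inverse:
  assumes "inj_on x {i..i + n}" "\<And>k. k \<in> {i..i+n} \<Longrightarrow> g (x k) \<noteq> 0" "0 < n"
  shows "ddiff (\<lambda>t. inverse (g t)) x n i
       = - (inverse (g (x i)) * (\<Sum>k\<in>{1..n}. ddiff g x k i * ddiff (\<lambda>t. inverse (g t)) x (n - k) (i + k)))"
proof -
  have "0 = ddiff (\<lambda>_. 1) x n i" using assms(3) by (simp add: ddiff_const)
  also have "\<dots> = ddiff (\<lambda>t. g t * inverse (g t)) x n i"
    by (rule ddiff_cong) (use assms in auto)
  also have "\<dots> = (\<Sum>k\<le>n. ddiff g x k i * ddiff (\<lambda>t. inverse (g t)) x (n - k) (i + k))"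
    by (rule ddiff_mult[OF assms(1)])
  also have "{..n} = insert 0 {1..n}" by auto
  also have "(\<Sum>k\<in>insert 0 {1..n}. ddiff g x k i * ddiff (\<lambda>t. inverse (g t)) x (n - k) (i + k))
     = g (x i) * ddiff (\<lambda>t. inverse (g t)) x n i
        + (\<Sum>k\<in>{1..n}. ddiff g x k i * ddiff (\<lambda>t. inverse (g t)) x (n - k) (i + k))"
    by (subst sum.insert) auto
  finally show ?thesis using assms(2)[of i] by (simp add: field_simps)
qed

text \<open>In the Leibniz rule for \<open>sqrt g * sqrt g = g\<close> the top order occurs twice,
  for \<open>k = 0\<close> and \<open>k = n\<close>, multiplied by the roots at the two end nodes.
  Solving for it divides by the sum of these roots, which is bounded below, and not by a gap between
  nodes.\<close>

lemma ddiff_sqrt: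
  assumes "inj_on x {i..i + n}" "\<And>k. k \<in> {i..i+n} \<Longrightarrow> g (x k) > 0" "0 < n"
  shows "ddiff (\<lambda>t. sqrt (g t)) x n i
       = (ddiff g x n i + - (\<Sum>k\<in>{1..<n}. ddiff (\<lambda>t. sqrt (g t)) x k i * ddiff (\<lambda>t. sqrt (g t)) x (n - k) (i + k)))
          * inverse (sqrt (g (x i)) + sqrt (g (x (i + n))))"
proof -
  have "ddiff g x n i = ddiff (\<lambda>t. sqrt (g t) * sqrt (g t)) x n i"
    by (rule ddiff_cong) (use assms(2) in \<open>simp add: abs_of_pos\<close>)
  also have "\<dots> = (\<Sum>k\<le>n. ddiff (\<lambda>t. sqrt (g t)) x k i * ddiff (\<lambda>t. sqrt (g t)) x (n - k) (i + k))"
    by (rule ddiff_mult[OF assms(1)])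
  also have "{..n} = insert 0 (insert n {1..<n})" using assms(3) by auto
  also have "(\<Sum>k\<in>insert 0 (insert n {1..<n}). ddiff (\<lambda>t. sqrt (g t)) x k i * ddiff (\<lambda>t. sqrt (g t)) x (n - k) (i + k))
     = (sqrt (g (x i)) + sqrt (g (x (i + n)))) * ddiff (\<lambda>t. sqrt (g t)) x n i
        + (\<Sum>k\<in>{1..<n}. ddiff (\<lambda>t. sqrt (g t)) x k i * ddiff (\<lambda>t. sqrt (g t)) x (n - k) (i + k))"
    using assms(3) by (subst sum.insert) (auto simp: algebra_simps)
  moreover have "sqrt (g (x i)) + sqrt (g (x (i + n))) > 0"
    using assms(2)[of i] assms(2)[of "i + n"] by (intro add_pos_pos) auto
  ultimately show ?thesis by (simp add: field_simps)
qed

lemma tame_inverse: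
  assumes "tame g h" "0 < c" "\<And>p i. p \<in> S \<Longrightarrow> i \<le> m \<Longrightarrow> c \<le> \<bar>g p (X p i)\<bar>" "\<And>p i. p \<in> S \<Longrightarrow> i \<le> m \<Longrightarrow> c \<le> \<bar>h p (Y p i)\<bar>"
  shows "tame (\<lambda>p t. inverse (g p t)) (\<lambda>p t. inverse (h p t))"
  unfolding tame_def
proof (intro allI)
  have base: "good (\<lambda>p. inverse (g p (X p i))) (\<lambda>p. inverse (h p (Y p i)))" if "i \<le> m" for i
    by (rule good_inverse[of _ _ c]) (use tameD[OF assms(1), of 0 i] that assms(2-4) in simp_all)
  have nz: "g p (X p i) \<noteq> 0" "h p (Y p i) \<noteq> 0" if "p \<in> S" "i \<le> m" for p i
    using assms(2) assms(3,4)[OF that] by auto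
  fix n i
  show "n + i \<le> m \<longrightarrow> good (\<lambda>p. ddiff (\<lambda>t. inverse (g p t)) (X p) n i) (\<lambda>p. ddiff (\<lambda>t. inverse (h p t)) (Y p) n i)"
  proof (induction n arbitrary: i rule: less_induct)
    case (less n)
    show ?case
    proof (cases "n = 0")
      case False
      show ?thesis
      proof
        assume ni: "n + i \<le> m"
        have "good (\<lambda>p. - (inverse (g p (X p i)) * (\<Sum>k\<in>{1..n}. ddiff (g p) (X p) k i * ddiff (\<lambda>t. inverse (g p t)) (X p) (n - k) (i + k))))
              (\<lambda>p. - (inverse (h p (Y p i)) * (\<Sum>k\<in>{1..n}. ddiff (h p) (Y p) k i * ddiff (\<lambda>t. inverse (h p t)) (Y p) (n - k) (i + k))))" (is "good ?l ?r")
          using ni by (intro good_uminus good_mult good_sum base tameD[OF assms(1)] less.IH[rule_format]) auto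
        then show "good (\<lambda>p. ddiff (\<lambda>t. inverse (g p t)) (X p) n i) (\<lambda>p. ddiff (\<lambda>t. inverse (h p t)) (Y p) n i)"
        proof (rule good_cong)
          fix p assume p: "p \<in> S"
          show "?l p = ddiff (\<lambda>t. inverse (g p t)) (X p) n i"
            by (rule ddiff_inverse[symmetric, OF inj_nodes(1)[OF p ni]]) (use ni False p nz in simp_all)
          show "?r p = ddiff (\<lambda>t. inverse (h p t)) (Y p) n i"
            by (rule ddiff_inverse[symmetric, OF inj_nodes(2)[OF p ni]]) (use ni False p nz in simp_all)
        qed
      qed
    qed (use base in simp)
  qed
qed

lemma tame_divide:
  assumes "tame g' h'" "tame g h" "0 < c" "\<And>p i. p \<in> S \<Longrightarrow> i \<le> m \<Longrightarrow> c \<le> \<bar>g p (X p i)\<bar>" "\<And>p i. p \<in> S \<Longrightarrow> i \<le> m \<Longrightarrow> c \<le> \<bar>h p (Y p i)\<bar>"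
  shows "tame (\<lambda>p t. g' p t / g p t) (\<lambda>p t. h' p t / h p t)"
  using tame_mult[OF assms(1) tame_inverse[OF assms(2-5)]] by (simp add: divide_inverse)

lemma tame_sqrt:
  assumes "tame g h" "0 < c" "\<And>p i. p \<in> S \<Longrightarrow> i \<le> m \<Longrightarrow> c\<^sup>2 \<le> g p (X p i)" "\<And>p i. p \<in> S \<Longrightarrow> i \<le> m \<Longrightarrow> c\<^sup>2 \<le> h p (Y p i)"
  shows "tame (\<lambda>p t. sqrt (g p t)) (\<lambda>p t. sqrt (h p t))"
  unfolding tame_def
proof (intro allI)
  have base: "good (\<lambda>p. sqrt (g p (X p i))) (\<lambda>p. sqrt (h p (Y p i)))" if "i \<le> m" for i
    by (rule good_sqrt[of _ _ c]) (use tameD[OF assms(1), of 0 i] that assms(2-4) in simp_all)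
  have cpos: "c\<^sup>2 > 0" using assms(2) by simp
  have pos: "g p (X p i) > 0" "h p (Y p i) > 0" if "p \<in> S" "i \<le> m" for p i
    by (rule less_le_trans[OF cpos], rule assms(3,4)[OF that])+
  have ge: "c \<le> sqrt (g p (X p i))" "c \<le> sqrt (h p (Y p i))" if "p \<in> S" "i \<le> m" for p i
    by (rule real_le_rsqrt, rule assms(3,4)[OF that])+
  have inv: "good (\<lambda>p. inverse (sqrt (g p (X p i)) + sqrt (g p (X p j)))) (\<lambda>p. inverse (sqrt (h p (Y p i)) + sqrt (h p (Y p j))))"
    if "i \<le> m" "j \<le> m" for i j
  proof (rule good_inverse[where c = c, OF good_add[OF base base] assms(2)])
    show "i \<le> m" "j \<le> m" by fact+
    fix p assume p: "p \<in> S"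
    show "c \<le> \<bar>sqrt (g p (X p i)) + sqrt (g p (X p j))\<bar>" "c \<le> \<bar>sqrt (h p (Y p i)) + sqrt (h p (Y p j))\<bar>"
      using ge[OF p that(1)] ge[OF p that(2)] assms(2) by auto
  qed
  fix n i
  show "n + i \<le> m \<longrightarrow> good (\<lambda>p. ddiff (\<lambda>t. sqrt (g p t)) (X p) n i) (\<lambda>p. ddiff (\<lambda>t. sqrt (h p t)) (Y p) n i)"
  proof (induction n arbitrary: i rule: less_induct)
    case (less n)
    show ?case
    proof (cases "n = 0")
      case False
      show ?thesis
      proof
        assume ni: "n + i \<le> m"
        have "good (\<lambda>p. (ddiff (g p) (X p) n i + - (\<Sum>k\<in>{1..<n}. ddiff (\<lambda>t. sqrt (g p t)) (X p) k i * ddiff (\<lambda>t. sqrt (g p t)) (X p) (n - k) (i + k)))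
                * inverse (sqrt (g p (X p i)) + sqrt (g p (X p (i + n)))))
              (\<lambda>p. (ddiff (h p) (Y p) n i + - (\<Sum>k\<in>{1..<n}. ddiff (\<lambda>t. sqrt (h p t)) (Y p) k i * ddiff (\<lambda>t. sqrt (h p t)) (Y p) (n - k) (i + k)))
                * inverse (sqrt (h p (Y p i)) + sqrt (h p (Y p (i + n)))))" (is "good ?l ?r")
          using ni by (intro good_uminus good_mult good_add good_sum inv tameD[OF assms(1)] less.IH[rule_format]) auto
        then show "good (\<lambda>p. ddiff (\<lambda>t. sqrt (g p t)) (X p) n i) (\<lambda>p. ddiff (\<lambda>t. sqrt (h p t)) (Y p) n i)"
        proof (rule good_cong)
          fix p assume p: "p \<in> S"
          show "?l p = ddiff (\<lambda>t. sqrt (g p t)) (X p) n i"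
            by (rule ddiff_sqrt[symmetric, OF inj_nodes(1)[OF p ni]]) (use ni False p pos in simp_all)
          show "?r p = ddiff (\<lambda>t. sqrt (h p t)) (Y p) n i"
            by (rule ddiff_sqrt[symmetric, OF inj_nodes(2)[OF p ni]]) (use ni False p pos in simp_all)
        qed
      qed
    qed (use base in simp)
  qed
qed

end

section \<open>Polar coordinates and the averaged function\<close>

definition rad :: "real \<Rightarrow> real" where
  "rad w = sqrt (w\<^sup>2 - 1)"

definition radial :: "(nat \<Rightarrow> nat \<Rightarrow> real) \<Rightarrow> (nat \<Rightarrow> nat \<Rightarrow> real) \<Rightarrow> real \<Rightarrow> real \<Rightarrow> real" where
  "radial a b \<theta> r = cos \<theta> * cubic a (r * cos \<theta>) (r * sin \<theta>) + sin \<theta> * cubic b (r * cos \<theta>) (r * sin \<theta>)"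

definition angular :: "(nat \<Rightarrow> nat \<Rightarrow> real) \<Rightarrow> (nat \<Rightarrow> nat \<Rightarrow> real) \<Rightarrow> real \<Rightarrow> real \<Rightarrow> real" where
  "angular a b \<theta> r = cos \<theta> * cubic b (r * cos \<theta>) (r * sin \<theta>) - sin \<theta> * cubic a (r * cos \<theta>) (r * sin \<theta>)"

text \<open>Angular velocity of the perturbed field at polar angle \<theta> and radius
  \<open>rad w\<close>.\<close>

definition omega :: "(nat \<Rightarrow> nat \<Rightarrow> real) \<Rightarrow> (nat \<Rightarrow> nat \<Rightarrow> real) \<Rightarrow> real \<Rightarrow> real \<Rightarrow> real \<Rightarrow> real" where
  "omega a b e \<theta> w = (rad w)\<^sup>2 * (cos \<theta>)\<^sup>2 + 1 + e * (angular a b \<theta> (rad w) / rad w)"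

text \<open>This is dw/d\<theta> divided by \<epsilon>: the radius has velocity
  \<open>\<epsilon> * radial\<close>, and \<open>w * dw = r * dr\<close> because
  \<open>w^2 = 1 + r^2\<close>.\<close>

definition rhs :: "(nat \<Rightarrow> nat \<Rightarrow> real) \<Rightarrow> (nat \<Rightarrow> nat \<Rightarrow> real) \<Rightarrow> real \<Rightarrow> real \<Rightarrow> real \<Rightarrow> real" where
  "rhs a b e \<theta> w = rad w * radial a b \<theta> (rad w) / (w * omega a b e \<theta> w)"

text \<open>The numerator of the average over \<open>w * (w + 1)\<close>. The polynomials
  multiplying the coefficients span all cubics; the coefficients of P and Q that do not occur
  contribute only terms odd in the sine or in the cosine.\<close>

definition avgpoly :: "(nat \<Rightarrow> nat \<Rightarrow> real) \<Rightarrow> (nat \<Rightarrow> nat \<Rightarrow> real) \<Rightarrow> real \<Rightarrow> real" where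
  "avgpoly a b w = a 1 0 + b 0 1 * w + a 3 0 * ((w - 1) * (w + 2) / 2)
     + (a 1 2 + b 2 1) * (w * (w - 1) / 2) + b 0 3 * (w * (w - 1) * (2 * w + 1) / 2)"

lemma rad_pos: "1 < w \<Longrightarrow> 0 < rad w"
  by (simp add: rad_def one_less_power)

lemma rad_sq: "1 \<le> w \<Longrightarrow> (rad w)\<^sup>2 = w\<^sup>2 - 1"
  by (simp add: rad_def one_le_power)

section \<open>Trigonometric integrals and the mean of the polar equation\<close>

lemma cubic_expand:
  "cubic c x y = c 0 0 + c 0 1 * y + c 0 2 * y^2 + c 0 3 * y^3 + c 1 0 * x + c 1 1 * x * y + c 1 2 * x * y^2
     + c 2 0 * x^2 + c 2 1 * x^2 * y + c 3 0 * x^3"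
  by (simp add: cubic_def numeral_eq_Suc)

text \<open>Substituting the sine leads from 0 back to 0. With the companion for the cosine this
  removes every part of the average that is odd in one of the two functions.\<close>

lemma integral_sin_substitution:
  assumes "continuous_on {-1..1} k"
  shows "((\<lambda>\<theta>. cos \<theta> * k (sin \<theta>)) has_integral (0::real)) {0..2*pi}"
proof -
  have "((\<lambda>\<theta>. cos \<theta> *\<^sub>R k (sin \<theta>)) has_integral integral {sin 0..sin (2*pi)} k) {0..2*pi}"
    by (rule has_integral_substitution[where c = "-1" and d = 1])
       (use assms in \<open>auto intro!: derivative_eq_intros simp: sin_ge_minus_one\<close>)
  then show ?thesis by simp
qed

lemma integral_cos_substitution:
  assumes "continuous_on {-1..1} k"
  shows "((\<lambda>\<theta>. sin \<theta> * k (cos \<theta>)) has_integral (0::real)) {0..2*pi}"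
proof -
  have "((\<lambda>\<theta>. (- sin \<theta>) *\<^sub>R k (cos \<theta>)) has_integral integral {cos 0..cos (2*pi)} k) {0..2*pi}"
    by (rule has_integral_substitution[where c = "-1" and d = 1])
       (use assms in \<open>auto intro!: derivative_eq_intros\<close>)
  from has_integral_neg[OF this] show ?thesis by simp
qed

lemma integral_cos_squared: "((\<lambda>\<theta>. (cos \<theta>)\<^sup>2) has_integral pi) {0..2*pi}"
proof -
  have "((\<lambda>\<theta>. (cos \<theta>)\<^sup>2) has_integral ((2*pi + sin (2*pi) * cos (2*pi)) / 2 - (0 + sin 0 * cos 0) / 2)) {0..2*pi}"
  proof (rule fundamental_theorem_of_calculus)
    fix x :: real
    have "((\<lambda>\<theta>. (\<theta> + sin \<theta> * cos \<theta>) / 2) has_real_derivative (1 + (cos x * cos x - sin x * sin x)) / 2) (at x within {0..2*pi})"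
      by (auto intro!: derivative_eq_intros)
    moreover have "(1 + (cos x * cos x - sin x * sin x)) / 2 = (cos x)\<^sup>2"
      using sin_cos_squared_add[of x] by (simp add: power2_eq_square field_simps)
    ultimately show "((\<lambda>\<theta>. (\<theta> + sin \<theta> * cos \<theta>) / 2) has_vector_derivative (cos x)\<^sup>2) (at x within {0..2*pi})"
      by (simp add: has_real_derivative_iff_has_vector_derivative)
  qed simp
  then show ?thesis by simp
qed

text \<open>The antiderivative is \<open>arctan (tan \<theta> / w) / w\<close>, rewritten so that it has no jumps.\<close>

lemma integral_inverse_cos_squared:
  assumes "1 < w"
  shows "((\<lambda>\<theta>. inverse ((w\<^sup>2 - 1) * (cos \<theta>)\<^sup>2 + 1)) has_integral 2 * pi / w) {0..2*pi}"
proof -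
  \<comment> \<open>By the subtraction formula for the tangent, the inner \<open>arctan\<close> is
    the difference between \<theta> and the continuous branch of
    \<open>arctan (tan \<theta> / w)\<close>. Its denominator never vanishes and it takes the value
    0 at both ends, so the growth of \<open>A\<close> comes from \<open>\<theta> / w\<close>
    alone.\<close>
  define A where "A \<theta> = (\<theta> - arctan ((w - 1) * sin \<theta> * cos \<theta> / (w * (cos \<theta>)\<^sup>2 + (sin \<theta>)\<^sup>2))) / w" for \<theta>
  have "((\<lambda>\<theta>. inverse ((w\<^sup>2 - 1) * (cos \<theta>)\<^sup>2 + 1)) has_integral (A (2*pi) - A 0)) {0..2*pi}"
  proof (rule fundamental_theorem_of_calculus)
    fix x :: real
    define c s where "c = cos x" and "s = sin x"
    have cs: "s\<^sup>2 = 1 - c\<^sup>2" by (simp add: c_def s_def sin_squared_eq)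
    define Y where "Y = w * c\<^sup>2 + s\<^sup>2"
    define D where "D = (w\<^sup>2 - 1) * c\<^sup>2 + 1"
    have Y: "Y > 0"
    proof -
      have "Y = (w - 1) * c\<^sup>2 + 1" by (simp add: Y_def cs algebra_simps)
      moreover have "0 \<le> (w - 1) * c\<^sup>2" using assms by simp
      ultimately show ?thesis by simp
    qed
    have w2: "1 < w\<^sup>2" using assms by (simp add: one_less_power)
    have D: "D > 0" using w2 by (simp add: D_def add_nonneg_pos)
    \<comment> \<open>This identity turns the derivative of \<open>arctan\<close> into
      \<open>Y^2 / D\<close>, so that all powers of \<open>Y\<close> cancel in the end.\<close>
    have XY: "((w - 1) * s * c)\<^sup>2 + Y\<^sup>2 = D"
    proof -
      have "((w - 1) * s * c)\<^sup>2 + Y\<^sup>2 = (w - 1)\<^sup>2 * s\<^sup>2 * c\<^sup>2 + (w * c\<^sup>2 + s\<^sup>2)\<^sup>2"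
        by (simp add: Y_def power_mult_distrib)
      also have "\<dots> = D" unfolding cs D_def by (simp add: power2_eq_square algebra_simps)
      finally show ?thesis .
    qed
    have dN: "((\<lambda>\<theta>. (w - 1) * sin \<theta> * cos \<theta>) has_real_derivative (w - 1) * c * c + (w - 1) * s * (- s)) (at x within {0..2*pi})"
      unfolding c_def s_def by (auto intro!: derivative_eq_intros simp: algebra_simps)
    have dY: "((\<lambda>\<theta>. w * (cos \<theta>)\<^sup>2 + (sin \<theta>)\<^sup>2) has_real_derivative w * (2 * c * (- s)) + 2 * s * c) (at x within {0..2*pi})"
      unfolding c_def s_def by (auto intro!: derivative_eq_intros simp: algebra_simps)
    have dQ: "((\<lambda>\<theta>. (w - 1) * sin \<theta> * cos \<theta> / (w * (cos \<theta>)\<^sup>2 + (sin \<theta>)\<^sup>2)) has_real_derivative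
        (((w - 1) * c * c + (w - 1) * s * (- s)) * Y - (w - 1) * s * c * (w * (2 * c * (- s)) + 2 * s * c)) / (Y * Y)) (at x within {0..2*pi})"
      using DERIV_divide[OF dN dY] Y by (simp add: Y_def c_def s_def)
    have dT: "((\<lambda>\<theta>. arctan ((w - 1) * sin \<theta> * cos \<theta> / (w * (cos \<theta>)\<^sup>2 + (sin \<theta>)\<^sup>2))) has_real_derivative
        inverse (1 + ((w - 1) * s * c / Y)\<^sup>2) * ((((w - 1) * c * c + (w - 1) * s * (- s)) * Y - (w - 1) * s * c * (w * (2 * c * (- s)) + 2 * s * c)) / (Y * Y))) (at x within {0..2*pi})"
      using DERIV_chain2[OF DERIV_arctan dQ] unfolding Y_def c_def s_def .
    have "(A has_real_derivative
        (1 - inverse (1 + ((w - 1) * s * c / Y)\<^sup>2) * ((((w - 1) * c * c + (w - 1) * s * (- s)) * Y - (w - 1) * s * c * (w * (2 * c * (- s)) + 2 * s * c)) / (Y * Y))) / w) (at x within {0..2*pi})"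
      unfolding A_def using DERIV_cdivide[OF DERIV_diff[OF DERIV_ident dT], of w] .
    also have "inverse (1 + ((w - 1) * s * c / Y)\<^sup>2) = Y\<^sup>2 / D"
      using Y D by (simp add: XY[symmetric] field_simps)
    also have "((w - 1) * c * c + (w - 1) * s * (- s)) * Y - (w - 1) * s * c * (w * (2 * c * (- s)) + 2 * s * c)
       = (w - 1) * ((c\<^sup>2 - s\<^sup>2) * (w * c\<^sup>2 + s\<^sup>2) + 2 * (w - 1) * s\<^sup>2 * c\<^sup>2)"
      by (simp add: Y_def power2_eq_square algebra_simps)
    also have "\<dots> = D - w" unfolding cs D_def by (simp add: power2_eq_square algebra_simps)
    also have "(1 - Y\<^sup>2 / D * ((D - w) / (Y * Y))) / w = inverse D"
      using Y D assms by (simp add: field_simps power2_eq_square)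
    finally show "(A has_vector_derivative inverse ((w\<^sup>2 - 1) * (cos x)\<^sup>2 + 1)) (at x within {0..2*pi})"
      by (simp add: D_def c_def has_real_derivative_iff_has_vector_derivative)
  qed simp
  then show ?thesis by (simp add: A_def)
qed

text \<open>The integrand is separated by parity. The parts odd in the sine or in the cosine
  integrate to zero; the part even in both is a polynomial in the squared cosine over
  \<open>r^2 * (cos \<theta>)^2 + 1\<close>, and polynomial division leaves integrals already
  known.\<close>

lemma average_integral:
  assumes "1 < w"
  shows "((\<lambda>\<theta>. radial a b \<theta> (rad w) / ((rad w)\<^sup>2 * (cos \<theta>)\<^sup>2 + 1)) has_integral
           2 * pi * rad w * avgpoly a b w / (w * (w + 1))) {0..2*pi}"
proof -
  define r where "r = rad w"
  have r0: "r > 0" using assms by (simp add: r_def rad_pos)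
  have r2: "r\<^sup>2 = w\<^sup>2 - 1" using assms by (simp add: r_def rad_sq)
  define m where "m = a 1 2 + b 2 1"
  \<comment> \<open>\<open>r * q2 * c^2 + q0\<close> is the quotient and \<open>C\<close> the
    remainder when the even part of the numerator, as a polynomial in \<open>c^2\<close>, is divided
    by \<open>r^2 * c^2 + 1\<close>.\<close>
  define q2 where "q2 = a 3 0 - m + b 0 3"
  define q0 where "q0 = (a 1 0 - b 0 1 - q2) / r + r * (m - 2 * b 0 3)"
  define C where "C = r * b 0 1 + r^3 * b 0 3 - q0"
  \<comment> \<open>\<open>K\<close> collects the terms with an odd power of the sine,
    \<open>L\<close> those with an odd power of the cosine and an even power of the sine.\<close>
  define K where "K z = (b 0 0 + (a 0 1 + b 1 0) * r * z + (a 1 1 + b 2 0) * r\<^sup>2 * z\<^sup>2 + b 0 2 * r\<^sup>2 * (1 - z\<^sup>2)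
      + (a 2 1 + b 3 0) * r^3 * z^3 + (a 0 3 + b 1 2) * r^3 * z * (1 - z\<^sup>2)) / (r\<^sup>2 * z\<^sup>2 + 1)" for z
  define L where "L z = (a 0 0 + a 2 0 * r\<^sup>2 * (1 - z\<^sup>2) + (a 0 2 + b 1 1) * r\<^sup>2 * z\<^sup>2) / (r\<^sup>2 * (1 - z\<^sup>2) + 1)" for z
  have contK: "continuous_on {-1..1} K"
    unfolding K_def by (intro continuous_intros) (auto simp: add_nonneg_eq_0_iff)
  have "r\<^sup>2 * (1 - z\<^sup>2) + 1 \<noteq> 0" if "z \<in> {-1..1}" for z
  proof -
    have "z\<^sup>2 \<le> 1" using that by (simp add: abs_square_le_1 abs_le_iff)
    then have "0 \<le> r\<^sup>2 * (1 - z\<^sup>2)" by simp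
    then show ?thesis by linarith
  qed
  then have contL: "continuous_on {-1..1} L"
    unfolding L_def by (intro continuous_intros) auto
  have "((\<lambda>\<theta>. (sin \<theta> * K (cos \<theta>) + cos \<theta> * L (sin \<theta>)) + ((r * q2 * (cos \<theta>)\<^sup>2 + q0) + C * inverse ((w\<^sup>2 - 1) * (cos \<theta>)\<^sup>2 + 1)))
       has_integral ((0 + 0) + ((r * q2 * pi + (2 * pi - 0) * q0) + C * (2 * pi / w)))) {0..2*pi}"
    by (intro has_integral_add has_integral_mult_right integral_sin_substitution integral_cos_substitution
        contK contL integral_cos_squared integral_inverse_cos_squared assms)
       (use has_integral_const_real[of q0 0 "2*pi"] in simp)
  moreover have "(sin \<theta> * K (cos \<theta>) + cos \<theta> * L (sin \<theta>)) + ((r * q2 * (cos \<theta>)\<^sup>2 + q0) + C * inverse ((w\<^sup>2 - 1) * (cos \<theta>)\<^sup>2 + 1))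
      = radial a b \<theta> r / (r\<^sup>2 * (cos \<theta>)\<^sup>2 + 1)" for \<theta>
  proof -
    define c s where "c = cos \<theta>" and "s = sin \<theta>"
    have cs: "s\<^sup>2 = 1 - c\<^sup>2" by (simp add: c_def s_def sin_squared_eq)
    have s3: "s^3 = s * (1 - c\<^sup>2)" unfolding cs[symmetric] by (simp add: power2_eq_square power3_eq_cube)
    have s4: "s^4 = (1 - c\<^sup>2) * (1 - c\<^sup>2)" unfolding cs[symmetric] by (simp add: power2_eq_square power4_eq_xxxx)
    define D where "D = r\<^sup>2 * c\<^sup>2 + 1"
    have D: "D > 0" unfolding D_def by (simp add: add_nonneg_pos)
    have q0D: "q0 * D = q0 + (r * (a 1 0 - b 0 1) - r * q2 + r^3 * (m - 2 * b 0 3)) * c\<^sup>2"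
      using r0 unfolding D_def q0_def by (simp add: field_simps power2_eq_square power3_eq_cube)
    define KN where "KN = b 0 0 + (a 0 1 + b 1 0) * r * c + (a 1 1 + b 2 0) * r\<^sup>2 * c\<^sup>2 + b 0 2 * r\<^sup>2 * (1 - c\<^sup>2)
          + (a 2 1 + b 3 0) * r^3 * c^3 + (a 0 3 + b 1 2) * r^3 * c * (1 - c\<^sup>2)"
    define LN where "LN = a 0 0 + a 2 0 * r\<^sup>2 * (1 - s\<^sup>2) + (a 0 2 + b 1 1) * r\<^sup>2 * s\<^sup>2"
    have K: "K c = KN / D" unfolding K_def KN_def D_def by simp
    have "L s = (a 0 0 + a 2 0 * r\<^sup>2 * (1 - s\<^sup>2) + (a 0 2 + b 1 1) * r\<^sup>2 * s\<^sup>2) / D"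
      unfolding L_def D_def cs by simp
    then have L: "L s = LN / D" unfolding LN_def .
    have I: "inverse ((w\<^sup>2 - 1) * c\<^sup>2 + 1) = 1 / D" by (simp add: D_def r2 divide_inverse)
    have "(s * K c + c * L s) + ((r * q2 * c\<^sup>2 + q0) + C * inverse ((w\<^sup>2 - 1) * c\<^sup>2 + 1))
      = (s * KN + c * LN + (r * q2 * c\<^sup>2 * D + q0 * D + C)) / D"
      unfolding K L I using D by (simp add: field_simps)
    also have "r * q2 * c\<^sup>2 * D + q0 * D + C = a 1 0 * r * c\<^sup>2 + b 0 1 * r * (1 - c\<^sup>2)
       + r^3 * (a 3 0 * c^4 + m * c\<^sup>2 * (1 - c\<^sup>2) + b 0 3 * s^4)"
      unfolding q0D unfolding D_def C_def q2_def s4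
      by (simp add: field_simps power2_eq_square power3_eq_cube power4_eq_xxxx)
    also have "s * KN + c * LN + (a 1 0 * r * c\<^sup>2 + b 0 1 * r * (1 - c\<^sup>2)
       + r^3 * (a 3 0 * c^4 + m * c\<^sup>2 * (1 - c\<^sup>2) + b 0 3 * s^4))
       = c * cubic a (r * c) (r * s) + s * cubic b (r * c) (r * s)"
    proof -
      have c2: "1 - c\<^sup>2 = s * s" "1 - s\<^sup>2 = c * c" using cs by (simp_all add: power2_eq_square)
      show ?thesis unfolding KN_def LN_def c2 m_def cubic_expand
        by (simp add: field_simps power2_eq_square power3_eq_cube power4_eq_xxxx)
    qed
    finally show ?thesis unfolding radial_def c_def s_def D_def .
  qed
  moreover have "(0 + 0) + ((r * q2 * pi + (2 * pi - 0) * q0) + C * (2 * pi / w)) = 2 * pi * r * avgpoly a b w / (w * (w + 1))"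
  proof -
    have w: "w > 0" "w + 1 > 0" "w - 1 > 0" using assms by auto
    \<comment> \<open>Writing \<open>1 / r\<close> as \<open>r / ((w - 1) * (w + 1))\<close> makes
      the whole integral \<open>r\<close> times a rational function of \<open>w\<close>.\<close>
    have q0: "q0 = r * ((a 1 0 - b 0 1 - q2) / ((w - 1) * (w + 1)) + (m - 2 * b 0 3))"
    proof -
      have "1 / r = r / ((w - 1) * (w + 1))"
      proof -
        have "(w - 1) * (w + 1) = r * r" using r2 by (simp add: power2_eq_square algebra_simps)
        then show ?thesis using r0 by simp
      qed
      then have "(a 1 0 - b 0 1 - q2) / r = r * ((a 1 0 - b 0 1 - q2) / ((w - 1) * (w + 1)))"
        by (metis mult.commute mult.right_neutral times_divide_eq_left times_divide_eq_right)
      then show ?thesis by (simp add: q0_def algebra_simps)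
    qed
    have C: "C = r * (b 0 1 + (w\<^sup>2 - 1) * b 0 3) - q0"
      unfolding C_def r2[symmetric] by (simp add: power2_eq_square power3_eq_cube algebra_simps)
    have "q2 / 2 + q + (b 0 1 + (w\<^sup>2 - 1) * b 0 3 - q) / w = avgpoly a b w / (w * (w + 1))"
      if "q = (a 1 0 - b 0 1 - q2) / ((w - 1) * (w + 1)) + (m - 2 * b 0 3)" for q
    proof -
      \<comment> \<open>The terms \<open>q\<close> and \<open>- q / w\<close> combine to
        \<open>q * (w - 1) / w\<close>, which cancels the pole of \<open>q\<close> at
        \<open>w = 1\<close>; this is why only \<open>w * (w + 1)\<close> remains below.\<close>
      have "q2 / 2 + q + (b 0 1 + (w\<^sup>2 - 1) * b 0 3 - q) / w
        = q2 / 2 + (b 0 1 + (w\<^sup>2 - 1) * b 0 3) / w + q * (w - 1) / w"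
        using w by (simp add: field_simps)
      also have "q * (w - 1) = (a 1 0 - b 0 1 - q2) / (w + 1) + (m - 2 * b 0 3) * (w - 1)"
        unfolding that distrib_right using w by simp
      also have "q2 / 2 + (b 0 1 + (w\<^sup>2 - 1) * b 0 3) / w + ((a 1 0 - b 0 1 - q2) / (w + 1) + (m - 2 * b 0 3) * (w - 1)) / w
         = (w * (w + 1) * q2 / 2 + (b 0 1 + (w\<^sup>2 - 1) * b 0 3) * (w + 1) + (a 1 0 - b 0 1 - q2) + (m - 2 * b 0 3) * (w - 1) * (w + 1)) / (w * (w + 1))"
        using w by (simp add: divide_simps) (simp add: algebra_simps)
      also have "w * (w + 1) * q2 / 2 + (b 0 1 + (w\<^sup>2 - 1) * b 0 3) * (w + 1) + (a 1 0 - b 0 1 - q2) + (m - 2 * b 0 3) * (w - 1) * (w + 1)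
         = avgpoly a b w"
        unfolding avgpoly_def q2_def m_def by (simp add: field_simps power2_eq_square)
      finally show ?thesis .
    qed
    from this[OF refl] have "q2 / 2 + q0 / r + (b 0 1 + (w\<^sup>2 - 1) * b 0 3 - q0 / r) / w = avgpoly a b w / (w * (w + 1))"
      using r0 by (simp add: q0)
    then have "2 * pi * r * (q2 / 2 + q0 / r + (b 0 1 + (w\<^sup>2 - 1) * b 0 3 - q0 / r) / w) = 2 * pi * r * avgpoly a b w / (w * (w + 1))"
      by simp
    moreover have "2 * pi * r * (q2 / 2 + q0 / r + (b 0 1 + (w\<^sup>2 - 1) * b 0 3 - q0 / r) / w) = (0 + 0) + ((r * q2 * pi + (2 * pi - 0) * q0) + C * (2 * pi / w))"
      unfolding C using r0 w by (simp add: field_simps)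
    ultimately show ?thesis by simp
  qed
  ultimately show ?thesis unfolding r_def by (simp only:)
qed

lemma average_function_eq:
  assumes "0 < r"
  shows "average_function a b r = 2 * pi * r * avgpoly a b (sqrt (1 + r\<^sup>2)) / (sqrt (1 + r\<^sup>2) * (sqrt (1 + r\<^sup>2) + 1))"
proof -
  have w: "1 < sqrt (1 + r\<^sup>2)" using assms by simp
  have "rad (sqrt (1 + r\<^sup>2)) = r" using assms by (simp add: rad_def)
  then show ?thesis
    using integral_unique[OF average_integral[OF w, of a b]] by (simp add: average_function_def radial_def)
qed

lemma rhs_integral:
  assumes "1 < w"
  shows "((\<lambda>\<theta>. rhs a b 0 \<theta> w) has_integral 2 * pi * ((w - 1) / w\<^sup>2) * avgpoly a b w) {0..2*pi}"
proof -
  have "rhs a b 0 \<theta> w = rad w / w * (radial a b \<theta> (rad w) / ((rad w)\<^sup>2 * (cos \<theta>)\<^sup>2 + 1))" for \<theta>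
    by (simp add: rhs_def omega_def)
  moreover have "rad w / w * (2 * pi * rad w * avgpoly a b w / (w * (w + 1))) = 2 * pi * ((w - 1) / w\<^sup>2) * avgpoly a b w"
  proof -
    have "rad w / w * (2 * pi * rad w * avgpoly a b w / (w * (w + 1))) = 2 * pi * (rad w)\<^sup>2 * avgpoly a b w / (w * w * (w + 1))"
      by (simp add: power2_eq_square mult_ac)
    also have "(rad w)\<^sup>2 = (w - 1) * (w + 1)" using rad_sq[of w] assms by (simp add: power2_eq_square algebra_simps)
    finally show ?thesis using assms by (simp add: power2_eq_square)
  qed
  ultimately show ?thesis
    using has_integral_mult_right[OF average_integral[OF assms, of a b], of "rad w / w"] by simp
qed

section \<open>Uniform estimates for the polar equation on a closed annulus\<close>

lemma abs_cubic_le: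
  assumes "\<bar>x\<bar> \<le> R" "\<bar>y\<bar> \<le> R"
  shows "\<bar>cubic c x y\<bar> \<le> (\<Sum>i\<le>3. \<Sum>j\<le>3 - i. \<bar>c i j\<bar> * R ^ i * R ^ j)"
  unfolding cubic_def using assms
  by (intro order_trans[OF sum_abs] sum_mono)
     (auto simp: abs_mult power_abs intro!: mult_mono power_mono)

lemma rad_mono: "1 \<le> v \<Longrightarrow> v \<le> w \<Longrightarrow> rad v \<le> rad w"
  by (simp add: rad_def power_mono)

lemma polar_bound: "0 \<le> r \<Longrightarrow> r \<le> R \<Longrightarrow> \<bar>r * cos \<theta>\<bar> \<le> R" "0 \<le> r \<Longrightarrow> r \<le> R \<Longrightarrow> \<bar>r * sin \<theta>\<bar> \<le> R"
  for r R \<theta> :: real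
  using mult_mono[of "\<bar>r\<bar>" R "\<bar>cos \<theta>\<bar>" 1] mult_mono[of "\<bar>r\<bar>" R "\<bar>sin \<theta>\<bar>" 1] by (auto simp: abs_mult)

text \<open>Without perturbation the angular velocity is at least 1, and away from the origin and
  infinity the perturbing term is at most \<open>K * |\<epsilon>|\<close>. The choice
  \<open>1 / (2 * K)\<close> gives away one half; the summand 1 in \<open>K\<close> keeps it below
  1. This bound is what lets the angle serve as time.\<close>

lemma omega_bounded_below:
  assumes "1 < \<alpha>" "\<alpha> < \<beta>"
  obtains e1 where "0 < e1" "e1 \<le> 1"
    "\<And>\<epsilon> \<theta> w. \<bar>\<epsilon>\<bar> \<le> e1 \<Longrightarrow> \<alpha> \<le> w \<Longrightarrow> w \<le> \<beta> \<Longrightarrow> 1 / 2 \<le> omega a b \<epsilon> \<theta> w"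
proof -
  define B where "B c = (\<Sum>i\<le>3. \<Sum>j\<le>3 - i. \<bar>c i j\<bar> * rad \<beta> ^ i * rad \<beta> ^ j)" for c :: "nat \<Rightarrow> nat \<Rightarrow> real"
  have r\<alpha>: "rad \<alpha> > 0" "rad \<beta> > 0" using assms by (auto intro: rad_pos)
  have Bpos: "B c \<ge> 0" for c using r\<alpha> by (auto simp: B_def intro!: sum_nonneg)
  define K where "K = (B a + B b) / rad \<alpha> + 1"
  have Kpos: "K \<ge> 1" using Bpos[of a] Bpos[of b] r\<alpha> by (simp add: K_def)
  have *: "\<bar>angular a b \<theta> (rad w) / rad w\<bar> \<le> K" if "\<alpha> \<le> w" "w \<le> \<beta>" for \<theta> w
  proof -
    have rw: "rad \<alpha> \<le> rad w" "rad w \<le> rad \<beta>" using that assms by (auto intro: rad_mono)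
    have cub: "\<bar>cubic c (rad w * cos \<theta>) (rad w * sin \<theta>)\<bar> \<le> B c" for c
      unfolding B_def by (rule abs_cubic_le; rule polar_bound) (use rw r\<alpha> in auto)
    have "\<bar>angular a b \<theta> (rad w)\<bar> \<le> 1 * B b + 1 * B a"
      unfolding angular_def
      by (rule order_trans[OF abs_triangle_ineq4], unfold abs_mult, intro add_mono mult_mono cub) auto
    moreover have "(B b + B a) / rad w \<le> (B b + B a) / rad \<alpha>"
      using rw r\<alpha> Bpos[of a] Bpos[of b] by (intro divide_left_mono) auto
    moreover have "\<bar>angular a b \<theta> (rad w)\<bar> / rad w \<le> (B b + B a) / rad w"
      using calculation(1) rw r\<alpha> by (intro divide_right_mono) auto
    ultimately show ?thesis using rw r\<alpha> unfolding K_def by (simp add: abs_divide add.commute)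
  qed
  show ?thesis
  proof (rule that[of "1 / (2 * K)"])
    show "0 < 1 / (2 * K)" "1 / (2 * K) \<le> 1" using Kpos by (auto simp: field_simps)
    fix \<epsilon> \<theta> w :: real assume h: "\<bar>\<epsilon>\<bar> \<le> 1 / (2 * K)" "\<alpha> \<le> w" "w \<le> \<beta>"
    have "\<bar>\<epsilon> * (angular a b \<theta> (rad w) / rad w)\<bar> \<le> 1 / (2 * K) * K"
      unfolding abs_mult using h(1) *[OF h(2,3)] Kpos by (intro mult_mono) auto
    then have "\<bar>\<epsilon> * (angular a b \<theta> (rad w) / rad w)\<bar> \<le> 1 / 2" using Kpos by simp
    then have "- (1 / 2) \<le> \<epsilon> * (angular a b \<theta> (rad w) / rad w)" by linarith
    moreover have "0 \<le> (rad w)\<^sup>2 * (cos \<theta>)\<^sup>2" by simp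
    ultimately show "1 / 2 \<le> omega a b \<epsilon> \<theta> w" unfolding omega_def by linarith
  qed
qed

context node_family
begin

lemma tame_cubic:
  assumes "tame x x'" "tame y y'"
  shows "tame (\<lambda>p t. cubic c (x p t) (y p t)) (\<lambda>p t. cubic c (x' p t) (y' p t))"
  unfolding cubic_def
  by (intro tame_sum tame_mult tame_power assms finite_atMost tame_const[OF good_const]) (rule order_refl)

end

text \<open>\<alpha> and \<beta> are the values of \<open>w\<close> on the two boundary circles. The
  condition \<open>1 < \<alpha>\<close> excludes the origin, where polar coordinates
  degenerate.\<close>

locale cubic_perturbation =
  fixes a b :: "nat \<Rightarrow> nat \<Rightarrow> real" and \<alpha> \<beta> e1 :: real
  assumes \<alpha>: "1 < \<alpha>" and \<alpha>\<beta>: "\<alpha> < \<beta>" and e1: "0 < e1" "e1 \<le> 1"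
    and omega_ge: "\<And>\<epsilon> \<theta> w. \<bar>\<epsilon>\<bar> \<le> e1 \<Longrightarrow> \<alpha> \<le> w \<Longrightarrow> w \<le> \<beta> \<Longrightarrow> 1 / 2 \<le> omega a b \<epsilon> \<theta> w"
begin

text \<open>In \<open>(\<epsilon>, \<theta>, d, X, Y)\<close> the nodes \<open>X\<close> carry the perturbed field and the nodes \<open>Y\<close> the field with \<open>\<epsilon> = 0\<close>.\<close>

type_synonym config = "real \<times> real \<times> real \<times> (nat \<Rightarrow> real) \<times> (nat \<Rightarrow> real)"

text \<open>The number \<open>d\<close> bounds both the distance of the two node sets and
  |\<epsilon>|, because passing from the perturbed to the unperturbed field is to count as an error
  of the same order as moving the nodes.\<close>

definition configs :: "nat \<Rightarrow> config set" where
  "configs m = {(\<epsilon>, \<theta>, d, X, Y). \<bar>\<epsilon>\<bar> \<le> e1 \<and> \<bar>\<epsilon>\<bar> \<le> d \<and> (\<forall>i\<le>m. X i \<in> {\<alpha>..\<beta>} \<and> Y i \<in> {\<alpha>..\<beta>} \<and> \<bar>X i - Y i\<bar> \<le> d)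
     \<and> inj_on X {..m} \<and> inj_on Y {..m}}"

abbreviation nX :: "config \<Rightarrow> nat \<Rightarrow> real" where "nX p \<equiv> fst (snd (snd (snd p)))"
abbreviation nY :: "config \<Rightarrow> nat \<Rightarrow> real" where "nY p \<equiv> snd (snd (snd (snd p)))"
abbreviation gap :: "config \<Rightarrow> real" where "gap p \<equiv> fst (snd (snd p))"
abbreviation eps :: "config \<Rightarrow> real" where "eps p \<equiv> fst p"
abbreviation ang :: "config \<Rightarrow> real" where "ang p \<equiv> fst (snd p)"

lemma configs_nodes:
  assumes "p \<in> configs m" "i \<le> m"
  shows "\<alpha> \<le> nX p i" "nX p i \<le> \<beta>" "\<alpha> \<le> nY p i" "nY p i \<le> \<beta>"
  using assms by (auto simp: configs_def)

lemma configs_eps: "p \<in> configs m \<Longrightarrow> \<bar>eps p\<bar> \<le> e1"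
  by (auto simp: configs_def)

lemma node_family_configs: "node_family (configs m) nX nY gap m \<beta>"
proof
  fix p i assume "p \<in> configs m" "i \<le> m"
  from configs_nodes[OF this] show "\<bar>nX p i\<bar> \<le> \<beta>" "\<bar>nY p i\<bar> \<le> \<beta>"
    using \<alpha> by auto
qed (auto simp: configs_def)

text \<open>The function is assembled from \<open>w\<close> by arithmetic, one square root and
  divisions with denominators bounded below. Only the constant \<open>eps p\<close> is compared with
  a different one, namely 0; all other ingredients are paired with themselves.\<close>

lemma rhs_tame:
  "node_family.tame (configs m) nX nY gap m (\<lambda>p. rhs a b (eps p) (ang p)) (\<lambda>p. rhs a b 0 (ang p))"
proof -
  interpret node_family "configs m" nX nY gap m \<beta> by (rule node_family_configs)
  have tcos: "tame (\<lambda>p _. cos (ang p)) (\<lambda>p _. cos (ang p))"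
    and tsin: "tame (\<lambda>p _. sin (ang p)) (\<lambda>p _. sin (ang p))"
    by (rule tame_const, rule good_const[where A = 1], simp)+
  have teps: "tame (\<lambda>p _. eps p) (\<lambda>p _. 0)"
    by (rule tame_const, rule goodI[where A = 1 and B = 0 and C = 1]) (use e1 in \<open>auto simp: configs_def\<close>)
  have t1: "tame (\<lambda>_ _. 1) (\<lambda>_ _. 1)" by (rule tame_const[OF good_one])
  have trad: "tame (\<lambda>_ t. rad t) (\<lambda>_ t. rad t)"
    unfolding rad_def
  proof (rule tame_sqrt[where c = "rad \<alpha>"])
    show "tame (\<lambda>_ t. t\<^sup>2 - 1) (\<lambda>_ t. t\<^sup>2 - 1)" by (intro tame_diff tame_power tame_id t1)
    show "0 < rad \<alpha>" using \<alpha> by (rule rad_pos)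
    fix p i assume "p \<in> configs m" "i \<le> m"
    from configs_nodes[OF this] show "(rad \<alpha>)\<^sup>2 \<le> (nX p i)\<^sup>2 - 1" "(rad \<alpha>)\<^sup>2 \<le> (nY p i)\<^sup>2 - 1"
      using \<alpha> by (auto simp: rad_sq intro!: power_mono)
  qed
  have tcub: "tame (\<lambda>p t. cubic c (rad t * cos (ang p)) (rad t * sin (ang p))) (\<lambda>p t. cubic c (rad t * cos (ang p)) (rad t * sin (ang p)))" for c
    by (intro tame_cubic tame_mult trad tcos tsin)
  have tradial: "tame (\<lambda>p t. radial a b (ang p) (rad t)) (\<lambda>p t. radial a b (ang p) (rad t))"
    unfolding radial_def by (intro tame_add tame_mult tcos tsin tcub)
  have tquot: "tame (\<lambda>p t. angular a b (ang p) (rad t) / rad t) (\<lambda>p t. angular a b (ang p) (rad t) / rad t)"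
  proof (rule tame_divide[where c = "rad \<alpha>"])
    show "tame (\<lambda>p t. angular a b (ang p) (rad t)) (\<lambda>p t. angular a b (ang p) (rad t))"
      unfolding angular_def by (intro tame_diff tame_mult tcos tsin tcub)
    fix p i assume pi: "p \<in> configs m" "i \<le> m"
    show "rad \<alpha> \<le> \<bar>rad (nX p i)\<bar>" "rad \<alpha> \<le> \<bar>rad (nY p i)\<bar>"
      by (rule order_trans[OF rad_mono abs_ge_self]; use configs_nodes[OF pi] \<alpha> in simp)+
  qed (use \<alpha> trad rad_pos in auto)
  have tomega: "tame (\<lambda>p t. omega a b (eps p) (ang p) t) (\<lambda>p t. omega a b 0 (ang p) t)"
    unfolding omega_def by (intro tame_add tame_mult tame_power trad tcos t1 tquot teps)
  show ?thesis
    unfolding rhs_def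
  proof (rule tame_divide[where c = "1/2"])
    show "tame (\<lambda>p t. rad t * radial a b (ang p) (rad t)) (\<lambda>p t. rad t * radial a b (ang p) (rad t))"
      by (intro tame_mult trad tradial)
    show "tame (\<lambda>p t. t * omega a b (eps p) (ang p) t) (\<lambda>p t. t * omega a b 0 (ang p) t)"
      by (intro tame_mult tame_id tomega)
    fix p i assume pi: "p \<in> configs m" "i \<le> m"
    have *: "1 / 2 \<le> \<bar>w * omega a b \<epsilon> \<theta> w\<bar>" if "\<bar>\<epsilon>\<bar> \<le> e1" "\<alpha> \<le> w" "w \<le> \<beta>" for w \<epsilon> \<theta>
    proof -
      have "1 * (1/2) \<le> w * omega a b \<epsilon> \<theta> w"
        using omega_ge[OF that, of \<theta>] that \<alpha> by (intro mult_mono) auto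
      then show ?thesis by linarith
    qed
    show "1 / 2 \<le> \<bar>nX p i * omega a b (eps p) (ang p) (nX p i)\<bar>" "1 / 2 \<le> \<bar>nY p i * omega a b 0 (ang p) (nY p i)\<bar>"
      by (rule *; use configs_nodes[OF pi] configs_eps[OF pi(1)] e1 in simp)+
  qed simp
qed

text \<open>Reciprocal of the factor between the integral of \<open>rhs a b 0\<close> over a period
  and \<open>avgpoly\<close>; it serves to pass from divided differences of the integral to those of
  the cubic.\<close>

definition weight :: "real \<Rightarrow> real" where
  "weight w = w\<^sup>2 / (2 * pi * (w - 1))"

lemma weight_tame:
  "node_family.tame (configs m) nX nY gap m (\<lambda>_. weight) (\<lambda>_. weight)"
proof -
  interpret node_family "configs m" nX nY gap m \<beta> by (rule node_family_configs)
  have tc: "tame (\<lambda>_ _. c) (\<lambda>_ _. c)" for c by (rule tame_const, rule good_const) (rule order_refl)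
  show ?thesis
    unfolding weight_def
  proof (rule tame_divide[where c = "2 * pi * (\<alpha> - 1)"])
    fix p i assume pi: "p \<in> configs m" "i \<le> m"
    show "2 * pi * (\<alpha> - 1) \<le> \<bar>2 * pi * (nX p i - 1)\<bar>" "2 * pi * (\<alpha> - 1) \<le> \<bar>2 * pi * (nY p i - 1)\<bar>"
      by (rule order_trans[OF mult_left_mono abs_ge_self]; use configs_nodes[OF pi] in simp)+
  qed (use \<alpha> in \<open>simp_all add: tame_mult tame_diff tame_power tame_id tc\<close>)
qed

lemma tame_uniform_bound:
  assumes "node_family.tame (configs m) nX nY gap m g h"
  shows "\<exists>M>0. \<forall>p\<in>configs m. \<forall>n i. n + i \<le> m \<longrightarrow> \<bar>ddiff (g p) (nX p) n i\<bar> \<le> M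
     \<and> \<bar>ddiff (h p) (nY p) n i\<bar> \<le> M \<and> \<bar>ddiff (g p) (nX p) n i - ddiff (h p) (nY p) n i\<bar> \<le> M * gap p"
proof -
  interpret node_family "configs m" nX nY gap m \<beta> by (rule node_family_configs)
  have "\<exists>M>0. \<forall>p\<in>configs m. n + i \<le> m \<longrightarrow> \<bar>ddiff (g p) (nX p) n i\<bar> \<le> M
     \<and> \<bar>ddiff (h p) (nY p) n i\<bar> \<le> M \<and> \<bar>ddiff (g p) (nX p) n i - ddiff (h p) (nY p) n i\<bar> \<le> M * \<bar>gap p\<bar>" for n i
  proof (cases "n + i \<le> m")
    case True
    then show ?thesis using good_bound[OF tameD[OF assms True]] by metis
  qed (auto intro: exI[of _ 1])
  then obtain M where M: "\<And>n i. M n i > 0"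
    "\<And>n i p. p \<in> configs m \<Longrightarrow> n + i \<le> m \<Longrightarrow> \<bar>ddiff (g p) (nX p) n i\<bar> \<le> M n i
     \<and> \<bar>ddiff (h p) (nY p) n i\<bar> \<le> M n i \<and> \<bar>ddiff (g p) (nX p) n i - ddiff (h p) (nY p) n i\<bar> \<le> M n i * \<bar>gap p\<bar>"
    by metis
  \<comment> \<open>Only finitely many pairs of order and position occur, so the sum of their
    constants serves all of them.\<close>
  define N where "N = (\<Sum>n\<le>m. \<Sum>i\<le>m. M n i)"
  have le: "M n i \<le> N" if "n + i \<le> m" for n i
  proof -
    have "M n i \<le> (\<Sum>i\<le>m. M n i)" using that by (intro member_le_sum less_imp_le M) auto
    also have "\<dots> \<le> N" unfolding N_def using that
      by (intro member_le_sum[of n "{..m}" "\<lambda>n. \<Sum>i\<le>m. M n i"] sum_nonneg less_imp_le M) auto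
    finally show ?thesis .
  qed
  have "0 < N" using le[of 0 0] M(1)[of 0 0] by simp
  moreover have gap: "0 \<le> gap p" if "p \<in> configs m" for p using that by (auto simp: configs_def)
  moreover have "M n i * \<bar>gap p\<bar> \<le> N * gap p" if "p \<in> configs m" "n + i \<le> m" for p n i
    using le[OF that(2)] gap[OF that(1)] by (simp add: mult_right_mono)
  ultimately show ?thesis using M(2) le by (intro exI[of _ N]) (meson order_trans)
qed

text \<open>A Lipschitz constant is a bound on divided differences of order one, obtained from
  configurations with two nodes and equal node sets.\<close>

lemma rhs_lipschitz:
  obtains L where "0 < L" "\<And>\<epsilon> \<theta> w v. \<bar>\<epsilon>\<bar> \<le> e1 \<Longrightarrow> w \<in> {\<alpha>..\<beta>} \<Longrightarrow> v \<in> {\<alpha>..\<beta>} \<Longrightarrow>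
     \<bar>rhs a b \<epsilon> \<theta> w - rhs a b \<epsilon> \<theta> v\<bar> \<le> L * \<bar>w - v\<bar>"
proof -
  obtain M where M: "M > 0" and MM: "\<And>p n i. p \<in> configs 1 \<Longrightarrow> n + i \<le> 1 \<Longrightarrow> \<bar>ddiff (rhs a b (eps p) (ang p)) (nX p) n i\<bar> \<le> M"
    using tame_uniform_bound[OF rhs_tame[of 1]] by blast
  show ?thesis
  proof (rule that[OF M])
    fix \<epsilon> \<theta> w v assume h: "\<bar>\<epsilon>\<bar> \<le> e1" "w \<in> {\<alpha>..\<beta>}" "v \<in> {\<alpha>..\<beta>}"
    show "\<bar>rhs a b \<epsilon> \<theta> w - rhs a b \<epsilon> \<theta> v\<bar> \<le> M * \<bar>w - v\<bar>"
    proof (cases "w = v")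
      case False
      define X where "X i = (if i = 0 then v else w)" for i :: nat
      have "(\<epsilon>, \<theta>, \<bar>\<epsilon>\<bar>, X, X) \<in> configs 1"
        using h False by (auto simp: configs_def X_def inj_on_def)
      from MM[OF this, of 1 0] have "\<bar>(rhs a b \<epsilon> \<theta> w - rhs a b \<epsilon> \<theta> v) / (w - v)\<bar> \<le> M"
        by (simp add: X_def)
      then show ?thesis using False by (simp add: abs_divide field_simps)
    qed simp
  qed
qed

lemma rhs_close:
  obtains M where "0 < M" "\<And>\<epsilon> \<theta> w. \<bar>\<epsilon>\<bar> \<le> e1 \<Longrightarrow> w \<in> {\<alpha>..\<beta>} \<Longrightarrow> \<bar>rhs a b \<epsilon> \<theta> w\<bar> \<le> M"
    "\<And>\<epsilon> \<theta> w v. \<bar>\<epsilon>\<bar> \<le> e1 \<Longrightarrow> w \<in> {\<alpha>..\<beta>} \<Longrightarrow> v \<in> {\<alpha>..\<beta>} \<Longrightarrow>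
     \<bar>rhs a b \<epsilon> \<theta> w - rhs a b 0 \<theta> v\<bar> \<le> M * (\<bar>\<epsilon>\<bar> + \<bar>w - v\<bar>)"
proof -
  obtain M where M: "M > 0" and MM: "\<And>p n i. p \<in> configs 0 \<Longrightarrow> n + i \<le> 0 \<Longrightarrow> \<bar>ddiff (rhs a b (eps p) (ang p)) (nX p) n i\<bar> \<le> M
      \<and> \<bar>ddiff (rhs a b (eps p) (ang p)) (nX p) n i - ddiff (rhs a b 0 (ang p)) (nY p) n i\<bar> \<le> M * gap p"
    using tame_uniform_bound[OF rhs_tame[of 0]] by blast
  have *: "\<bar>rhs a b \<epsilon> \<theta> w\<bar> \<le> M" "\<bar>rhs a b \<epsilon> \<theta> w - rhs a b 0 \<theta> v\<bar> \<le> M * (\<bar>\<epsilon>\<bar> + \<bar>w - v\<bar>)"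
    if h: "\<bar>\<epsilon>\<bar> \<le> e1" "w \<in> {\<alpha>..\<beta>}" "v \<in> {\<alpha>..\<beta>}" for \<epsilon> \<theta> w v
  proof -
    have "(\<epsilon>, \<theta>, \<bar>\<epsilon>\<bar> + \<bar>w - v\<bar>, (\<lambda>_. w), (\<lambda>_. v)) \<in> configs 0"
      using h by (auto simp: configs_def)
    from MM[OF this, of 0 0]
    show "\<bar>rhs a b \<epsilon> \<theta> w\<bar> \<le> M" "\<bar>rhs a b \<epsilon> \<theta> w - rhs a b 0 \<theta> v\<bar> \<le> M * (\<bar>\<epsilon>\<bar> + \<bar>w - v\<bar>)" by auto
  qed
  show ?thesis by (rule that[OF M]) (use * in blast)+
qed

lemma continuous_on_rad: "continuous_on A g \<Longrightarrow> continuous_on A (\<lambda>s. rad (g s))"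
  unfolding rad_def by (intro continuous_intros)

lemma continuous_on_omega:
  fixes g t :: "real \<Rightarrow> real"
  assumes "continuous_on A g" "continuous_on A t" "\<And>s. s \<in> A \<Longrightarrow> g s \<in> {\<alpha>..\<beta>}"
  shows "continuous_on A (\<lambda>s. omega a b \<epsilon> (t s) (g s))"
proof -
  have nz: "rad (g s) \<noteq> 0" if "s \<in> A" for s using rad_pos[of "g s"] assms(3)[OF that] \<alpha> by auto
  show ?thesis unfolding omega_def angular_def cubic_def
    by (intro continuous_intros ballI continuous_on_rad continuous_on_cos continuous_on_sin assms(1,2) nz)
qed

lemma continuous_on_rhs:
  assumes "continuous_on A g" "\<And>s. s \<in> A \<Longrightarrow> g s \<in> {\<alpha>..\<beta>}" "\<bar>\<epsilon>\<bar> \<le> e1"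
  shows "continuous_on A (\<lambda>s. rhs a b \<epsilon> s (g s))"
proof -
  have nz: "g s * omega a b \<epsilon> s (g s) \<noteq> 0" if "s \<in> A" for s
    using omega_ge[OF assms(3), of "g s" s] assms(2)[OF that] \<alpha> by auto
  have om: "continuous_on A (\<lambda>s. omega a b \<epsilon> s (g s))"
    by (rule continuous_on_omega[OF assms(1) continuous_on_id assms(2)])
  show ?thesis unfolding rhs_def radial_def cubic_def
    by (intro continuous_intros ballI continuous_on_rad continuous_on_cos continuous_on_sin om assms(1) nz)
qed

lemma rhs_periodic: "rhs a b \<epsilon> (\<theta> + 2 * pi) w = rhs a b \<epsilon> \<theta> w"
  by (simp add: rhs_def radial_def omega_def angular_def)

lemma omega_periodic: "omega a b \<epsilon> (\<theta> + 2 * pi) w = omega a b \<epsilon> \<theta> w"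
  by (simp add: omega_def angular_def)

end

section \<open>At most three periodic solutions\<close>

lemma abs_exp_minus_one_le: "\<bar>exp x - 1\<bar> \<le> \<bar>x\<bar> * exp \<bar>x\<bar>" for x :: real
proof (cases "0 \<le> x")
  case True
  have "exp x * (1 - exp (- x)) \<le> exp x * x"
    using exp_ge_add_one_self[of "- x"] by (intro mult_left_mono) auto
  then show ?thesis using True by (simp add: algebra_simps exp_minus)
next
  case False
  then have "exp x \<le> 1" "1 + x \<le> exp x" by auto
  then have "\<bar>exp x - 1\<bar> \<le> \<bar>x\<bar> * 1" by linarith
  also have "\<dots> \<le> \<bar>x\<bar> * exp \<bar>x\<bar>" by (intro mult_left_mono) auto
  finally show ?thesis .
qed

lemma derivative_bound_period:
  fixes f f' :: "real \<Rightarrow> real"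
  assumes "\<And>t. (f has_real_derivative f' t) (at t)" "\<And>t. t \<in> {0..2*pi} \<Longrightarrow> \<bar>f' t\<bar> \<le> B" "\<theta> \<in> {0..2*pi}"
  shows "\<bar>f \<theta> - f 0\<bar> \<le> 2 * pi * B"
proof -
  have B: "0 \<le> B" using assms(2)[OF assms(3)] by simp
  have "norm (f \<theta> - f 0) \<le> B * norm (\<theta> - 0)"
    by (rule field_differentiable_bound[of "{0..2*pi}" f f'])
       (use assms in \<open>auto intro: has_field_derivative_at_within\<close>)
  also have "\<dots> \<le> B * (2 * pi)" using assms(3) B by (intro mult_left_mono) auto
  finally show ?thesis by (simp add: mult_ac)
qed

lemma integral_near_zero_mean:
  fixes h Z :: "real \<Rightarrow> real"
  assumes "(h has_integral 0) {0..2*pi}" "(Z has_integral I) {0..2*pi}"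
    "\<And>\<theta>. \<theta> \<in> {0..2*pi} \<Longrightarrow> \<bar>Z \<theta> - h \<theta>\<bar> \<le> B"
  shows "\<bar>I\<bar> \<le> 2 * pi * B"
proof -
  have "((\<lambda>\<theta>. Z \<theta> - h \<theta>) has_integral I - 0) {0..2*pi}" by (rule has_integral_diff[OF assms(2,1)])
  moreover have "0 \<le> B" using assms(3)[of 0] by simp
  ultimately have "norm (I - 0) \<le> B * measure lborel {0..2*pi}"
    using assms(3) by (intro has_integral_bound_real[of B "{}"]) auto
  then show ?thesis by (simp add: mult_ac)
qed

text \<open>\<open>(g t)^2 * exp (c * t)\<close> is nonnegative and vanishes at \<open>t0\<close>.
  With \<open>c = - 2 * K\<close> it cannot increase to the right of \<open>t0\<close>, and with
  \<open>c = 2 * K\<close> it cannot decrease on the way up to \<open>t0\<close> from the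
  left.\<close>

lemma gronwall_zero:
  fixes g g' :: "real \<Rightarrow> real"
  assumes der: "\<And>t. (g has_real_derivative g' t) (at t)" and bd: "\<And>t. \<bar>g' t\<bar> \<le> K * \<bar>g t\<bar>" and "g t0 = 0"
  shows "g t = 0"
proof -
  have prod: "\<bar>g s * g' s\<bar> \<le> K * (g s)\<^sup>2" for s
    using mult_left_mono[OF bd[of s], of "\<bar>g s\<bar>"] by (simp add: abs_mult power2_eq_square mult_ac)
  have dh: "((\<lambda>t. (g t)\<^sup>2 * exp (c * t)) has_real_derivative (2 * (g s * g' s) + c * (g s)\<^sup>2) * exp (c * s)) (at s)" for s c
    by (auto intro!: derivative_eq_intros der simp: algebra_simps)
  have "(g t)\<^sup>2 * exp (c * t) \<le> (g t0)\<^sup>2 * exp (c * t0)" if c: "c = (if t0 \<le> t then - 2 * K else 2 * K)" for c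
  proof (cases "t0 \<le> t")
    case True
    show ?thesis
    proof (rule DERIV_nonpos_imp_nonincreasing[OF True])
      fix s
      have "2 * (g s * g' s) + c * (g s)\<^sup>2 \<le> 0" using prod[of s] c True by simp
      then show "\<exists>y. ((\<lambda>t. (g t)\<^sup>2 * exp (c * t)) has_real_derivative y) (at s) \<and> y \<le> 0"
        by (intro exI[of _ "(2 * (g s * g' s) + c * (g s)\<^sup>2) * exp (c * s)"] conjI dh mult_nonpos_nonneg) auto
    qed
  next
    case False
    then have "t \<le> t0" by simp
    show ?thesis
    proof (rule DERIV_nonneg_imp_nondecreasing[OF \<open>t \<le> t0\<close>])
      fix s
      have "2 * (g s * g' s) + c * (g s)\<^sup>2 \<ge> 0" using prod[of s] c False by simp
      then show "\<exists>y. ((\<lambda>t. (g t)\<^sup>2 * exp (c * t)) has_real_derivative y) (at s) \<and> 0 \<le> y"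
        by (intro exI[of _ "(2 * (g s * g' s) + c * (g s)\<^sup>2) * exp (c * s)"] conjI dh mult_nonneg_nonneg) auto
    qed
  qed
  from this[OF refl] show ?thesis using assms(3)
    by (simp add: mult_le_0_iff)
qed

lemma continuous_nonzero_pos:
  fixes f :: "real \<Rightarrow> real"
  assumes "continuous_on UNIV f" "\<And>t. f t \<noteq> 0" "0 < f t0"
  shows "0 < f t"
proof (rule ccontr)
  assume "\<not> 0 < f t"
  then have "f t \<le> 0" by simp
  have "connected (range f)" by (rule connected_continuous_image[OF assms(1) connected_UNIV])
  then have "0 \<in> range f" using connectedD_interval[of "range f" "f t" "f t0" 0] \<open>f t \<le> 0\<close> assms(3) by simp
  then show False using assms(2) by (metis imageE)
qed

text \<open>Newton's formula has no remainder in degree at most three. Hence four divided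
  differences at nodes in a bounded interval control \<open>p\<close> at every \<open>z\<close>,
  also outside that interval.\<close>

lemma newton_cubic:
  fixes y :: "nat \<Rightarrow> real"
  assumes p: "\<And>t. p t = c0 + c1 * t + c2 * t^2 + c3 * t^3" and inj: "inj_on y {..3}"
  shows "p z = ddiff p y 0 0 + ddiff p y 1 0 * (z - y 0) + ddiff p y 2 0 * ((z - y 0) * (z - y 1))
     + ddiff p y 3 0 * ((z - y 0) * (z - y 1) * (z - y 2))"
proof -
  have ne: "y i \<noteq> y j" if "i \<le> 3" "j \<le> 3" "i \<noteq> j" for i j using inj that by (auto dest: inj_onD)
  have d1: "ddiff p y (Suc 0) i = c1 + c2 * (y i + y (Suc i)) + c3 * ((y i)\<^sup>2 + y i * y (Suc i) + (y (Suc i))\<^sup>2)"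
    if "i \<le> 2" for i
  proof -
    have "y (Suc i) - y i \<noteq> 0" using ne[of "Suc i" i] that by simp
    then show ?thesis by (simp add: p divide_eq_eq) (simp add: algebra_simps power2_eq_square power3_eq_cube)
  qed
  have d2: "ddiff p y (Suc (Suc 0)) i = c2 + c3 * (y i + y (Suc i) + y (Suc (Suc i)))" if "i \<le> 1" for i
  proof -
    have nz: "y (i + Suc (Suc 0)) \<noteq> y i" using ne[of "Suc (Suc i)" i] that by simp
    have "(y (i + Suc (Suc 0)) - y i) * ddiff p y (Suc (Suc 0)) i = ddiff p y (Suc 0) (Suc i) - ddiff p y (Suc 0) i"
      by (rule ddiff_step[OF nz])
    also have "\<dots> = (y (i + Suc (Suc 0)) - y i) * (c2 + c3 * (y i + y (Suc i) + y (Suc (Suc i))))"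
      using that by (simp only: d1) (simp add: d1 algebra_simps power2_eq_square)
    finally show ?thesis using nz by (simp only: mult_cancel_left) simp
  qed
  have d3: "ddiff p y (Suc (Suc (Suc 0))) 0 = c3"
  proof -
    have nz: "y (0 + Suc (Suc (Suc 0))) \<noteq> y 0" using ne[of 3 0] by (simp add: numeral_3_eq_3)
    have "(y (0 + Suc (Suc (Suc 0))) - y 0) * ddiff p y (Suc (Suc (Suc 0))) 0 = ddiff p y (Suc (Suc 0)) (Suc 0) - ddiff p y (Suc (Suc 0)) 0"
      by (rule ddiff_step[OF nz])
    also have "\<dots> = (y (0 + Suc (Suc (Suc 0))) - y 0) * c3"
      using d2[of 0] d2[of "Suc 0"] by (simp only:) (simp add: algebra_simps)
    finally show ?thesis using nz by (simp only: mult_cancel_left) simp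
  qed
  have "ddiff p y 1 0 = c1 + c2 * (y 0 + y 1) + c3 * ((y 0)\<^sup>2 + y 0 * y 1 + (y 1)\<^sup>2)"
    "ddiff p y 2 0 = c2 + c3 * (y 0 + y 1 + y 2)" "ddiff p y 3 0 = c3" "ddiff p y 0 0 = p (y 0)"
    using d1[of 0] d2[of 0] d3 by (simp_all add: numeral_2_eq_2 numeral_3_eq_3)
  then show ?thesis unfolding p by (simp add: algebra_simps power2_eq_square power3_eq_cube)
qed

lemma avgpoly_cubic:
  obtains c0 c1 c2 c3 where "\<And>t. avgpoly a b t = c0 + c1 * t + c2 * t^2 + c3 * t^3"
proof
  fix t
  show "avgpoly a b t = (a 1 0 - a 3 0) + (b 0 1 + a 3 0 / 2 - (a 1 2 + b 2 1) / 2 - b 0 3 / 2) * t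
     + (a 3 0 / 2 + (a 1 2 + b 2 1) / 2 - b 0 3 / 2) * t^2 + b 0 3 * t^3"
    unfolding avgpoly_def by (simp add: field_simps power2_eq_square power3_eq_cube)
qed

section \<open>Ordered solutions of the polar equation and the estimate for four cycles\<close>

context cubic_perturbation
begin

text \<open>Confinement to the closed interval belongs to the notion because the estimates for
  \<open>rhs\<close> are stated on that interval.\<close>

definition solution :: "real \<Rightarrow> (real \<Rightarrow> real) \<Rightarrow> bool" where
  "solution \<epsilon> W \<longleftrightarrow> (\<forall>\<phi>. (W has_real_derivative \<epsilon> * rhs a b \<epsilon> \<phi> (W \<phi>)) (at \<phi>)) \<and> (\<forall>\<phi>. W \<phi> \<in> {\<alpha>..\<beta>})"

definition cycle :: "real \<Rightarrow> (real \<Rightarrow> real) \<Rightarrow> bool" where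
  "cycle \<epsilon> W \<longleftrightarrow> solution \<epsilon> W \<and> (\<forall>\<phi>. W (\<phi> + 2 * pi) = W \<phi>)"

lemma solutionD:
  assumes "solution \<epsilon> W"
  shows "(W has_real_derivative \<epsilon> * rhs a b \<epsilon> \<phi> (W \<phi>)) (at \<phi>)" "W \<phi> \<in> {\<alpha>..\<beta>}" "continuous_on UNIV W"
proof -
  show der: "(W has_real_derivative \<epsilon> * rhs a b \<epsilon> \<phi> (W \<phi>)) (at \<phi>)" for \<phi>
    using assms by (simp add: solution_def)
  show "W \<phi> \<in> {\<alpha>..\<beta>}" using assms by (simp add: solution_def)
  show "continuous_on UNIV W"
    by (rule continuous_at_imp_continuous_on) (use DERIV_isCont[OF der] in simp)
qed

lemma solution_diff_bound:
  obtains L where "0 < L" "\<And>\<epsilon> W V \<phi>. \<bar>\<epsilon>\<bar> \<le> e1 \<Longrightarrow> solution \<epsilon> W \<Longrightarrow> solution \<epsilon> V \<Longrightarrow>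
     \<bar>\<epsilon> * rhs a b \<epsilon> \<phi> (W \<phi>) - \<epsilon> * rhs a b \<epsilon> \<phi> (V \<phi>)\<bar> \<le> \<bar>\<epsilon>\<bar> * L * \<bar>W \<phi> - V \<phi>\<bar>"
proof -
  obtain L where L: "0 < L" "\<And>\<epsilon> \<theta> w v. \<bar>\<epsilon>\<bar> \<le> e1 \<Longrightarrow> w \<in> {\<alpha>..\<beta>} \<Longrightarrow> v \<in> {\<alpha>..\<beta>} \<Longrightarrow>
     \<bar>rhs a b \<epsilon> \<theta> w - rhs a b \<epsilon> \<theta> v\<bar> \<le> L * \<bar>w - v\<bar>"
    using that by (rule rhs_lipschitz)
  show ?thesis
  proof (rule that[OF L(1)])
    fix \<epsilon> W V \<phi> assume h: "\<bar>\<epsilon>\<bar> \<le> e1" "solution \<epsilon> W" "solution \<epsilon> V"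
    have "\<bar>\<epsilon>\<bar> * \<bar>rhs a b \<epsilon> \<phi> (W \<phi>) - rhs a b \<epsilon> \<phi> (V \<phi>)\<bar> \<le> \<bar>\<epsilon>\<bar> * (L * \<bar>W \<phi> - V \<phi>\<bar>)"
      using h by (intro mult_left_mono L(2) solutionD(2)) auto
    then show "\<bar>\<epsilon> * rhs a b \<epsilon> \<phi> (W \<phi>) - \<epsilon> * rhs a b \<epsilon> \<phi> (V \<phi>)\<bar> \<le> \<bar>\<epsilon>\<bar> * L * \<bar>W \<phi> - V \<phi>\<bar>"
      by (simp add: right_diff_distrib[symmetric] abs_mult mult_ac)
  qed
qed

lemma solution_unique:
  assumes "\<bar>\<epsilon>\<bar> \<le> e1" "solution \<epsilon> W" "solution \<epsilon> V" "W t0 = V t0"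
  shows "W = V"
proof
  fix t
  obtain L where "0 < L" and L: "\<And>\<epsilon> W V \<phi>. \<bar>\<epsilon>\<bar> \<le> e1 \<Longrightarrow> solution \<epsilon> W \<Longrightarrow> solution \<epsilon> V \<Longrightarrow>
     \<bar>\<epsilon> * rhs a b \<epsilon> \<phi> (W \<phi>) - \<epsilon> * rhs a b \<epsilon> \<phi> (V \<phi>)\<bar> \<le> \<bar>\<epsilon>\<bar> * L * \<bar>W \<phi> - V \<phi>\<bar>"
    using that by (rule solution_diff_bound)
  have "W t - V t = 0"
  proof (rule gronwall_zero[where g = "\<lambda>t. W t - V t" and K = "\<bar>\<epsilon>\<bar> * L" and ?t0.0 = t0])
    show "((\<lambda>t. W t - V t) has_real_derivative \<epsilon> * rhs a b \<epsilon> s (W s) - \<epsilon> * rhs a b \<epsilon> s (V s)) (at s)" for s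
      by (intro DERIV_diff solutionD(1) assms)
    show "\<bar>\<epsilon> * rhs a b \<epsilon> s (W s) - \<epsilon> * rhs a b \<epsilon> s (V s)\<bar> \<le> \<bar>\<epsilon>\<bar> * L * \<bar>W s - V s\<bar>" for s
      by (intro L assms)
  qed (use assms(4) in simp)
  then show "W t = V t" by simp
qed

lemma solution_less:
  assumes "\<bar>\<epsilon>\<bar> \<le> e1" "solution \<epsilon> W" "solution \<epsilon> V" "W t0 < V t0"
  shows "W t < V t"
proof -
  have "0 < V t - W t"
  proof (rule continuous_nonzero_pos[where f = "\<lambda>t. V t - W t" and ?t0.0 = t0])
    show "continuous_on UNIV (\<lambda>t. V t - W t)" using assms by (intro continuous_intros solutionD(3))
    show "V s - W s \<noteq> 0" for s
      using solution_unique[OF assms(1-3), of s] assms(4) by auto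
    show "0 < V t0 - W t0" using assms(4) by simp
  qed
  then show ?thesis by simp
qed

text \<open>By \<open>rhs_integral\<close> this is the integral of \<open>rhs a b 0\<close> at fixed
  \<open>w\<close> over a period.\<close>

definition avg :: "real \<Rightarrow> real" where
  "avg w = 2 * pi * ((w - 1) / w\<^sup>2) * avgpoly a b w"

definition four_cycles :: "real \<Rightarrow> (nat \<Rightarrow> real \<Rightarrow> real) \<Rightarrow> bool" where
  "four_cycles \<epsilon> W \<longleftrightarrow> (\<forall>k\<le>3. cycle \<epsilon> (W k)) \<and> (\<forall>j k. j < k \<longrightarrow> k \<le> 3 \<longrightarrow> W j 0 < W k 0)"

text \<open>For each order periodicity yields a function \<open>h\<close> with integral zero that is
  O(\<epsilon>)-close to the divided difference of the unperturbed field at the initial values.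
  Integrating the difference bounds the divided difference of \<open>avg\<close>. The constant is
  fixed before the solutions, so it does not see how close they are.\<close>

lemma four_cycles_ddiff_bound:
  obtains C where "0 < C" "\<And>\<epsilon> W n. 0 < \<bar>\<epsilon>\<bar> \<Longrightarrow> \<bar>\<epsilon>\<bar> \<le> e1 \<Longrightarrow> four_cycles \<epsilon> W \<Longrightarrow> n \<le> 3 \<Longrightarrow> \<bar>ddiff avg (\<lambda>k. W k 0) n 0\<bar> \<le> C * \<bar>\<epsilon>\<bar>"
proof -
  obtain M where M: "M > 0" and MM: "\<And>p n i. p \<in> configs 3 \<Longrightarrow> n + i \<le> 3 \<Longrightarrow>
      \<bar>ddiff (rhs a b (eps p) (ang p)) (nX p) n i\<bar> \<le> M
      \<and> \<bar>ddiff (rhs a b (eps p) (ang p)) (nX p) n i - ddiff (rhs a b 0 (ang p)) (nY p) n i\<bar> \<le> M * gap p"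
    using tame_uniform_bound[OF rhs_tame[of 3]] by blast
  obtain L where L: "0 < L" "\<And>\<epsilon> W V \<phi>. \<bar>\<epsilon>\<bar> \<le> e1 \<Longrightarrow> solution \<epsilon> W \<Longrightarrow> solution \<epsilon> V \<Longrightarrow>
     \<bar>\<epsilon> * rhs a b \<epsilon> \<phi> (W \<phi>) - \<epsilon> * rhs a b \<epsilon> \<phi> (V \<phi>)\<bar> \<le> \<bar>\<epsilon>\<bar> * L * \<bar>W \<phi> - V \<phi>\<bar>"
    using that by (rule solution_diff_bound)
  obtain M0 where M0: "M0 > 0" "\<And>\<epsilon> \<theta> w. \<bar>\<epsilon>\<bar> \<le> e1 \<Longrightarrow> w \<in> {\<alpha>..\<beta>} \<Longrightarrow> \<bar>rhs a b \<epsilon> \<theta> w\<bar> \<le> M0"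
    using rhs_close by metis
  \<comment> \<open>Over one period a solution moves by at most
    \<open>2 * pi * M0 * |\<epsilon>|\<close>. The summand 1 makes \<open>D * |\<epsilon>|\<close>
    dominate |\<epsilon>| as well, as \<open>configs\<close> demands.\<close>
  define D where "D = 1 + 2 * pi * M0"
  \<comment> \<open>For the relative gaps \<open>q\<close> introduced below, \<open>C2\<close>
    bounds \<open>q\<close>, \<open>C1 * |\<epsilon>|\<close> bounds \<open>q - 1\<close>, and
    \<open>C3 * |\<epsilon>|\<close> times the outer initial gap bounds
    \<open>q 1 3 - q 0 2\<close>.\<close>
  define C2 where "C2 = exp (2 * pi * L)"
  define C1 where "C1 = 2 * pi * L * C2"
  define C3 where "C3 = C2 * (4 * pi * M * C2) * exp (4 * pi * M * C2 * (\<beta> - \<alpha>))"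
  define C where "C = 2 * pi * (M * D + M * C1 + M * (C1 * C2 + C1) + M * C3)"
  have C2: "C2 \<ge> 1" using L by (simp add: C2_def)
  have Dpos: "D > 0" using M0 by (simp add: D_def add_pos_nonneg)
  have C1: "C1 > 0" using L C2 by (simp add: C1_def)
  have C3: "C3 > 0" using M C2 by (simp add: C3_def)
  have parts: "0 < M * D" "0 < M * C1" "0 < M * (C1 * C2 + C1)" "0 < M * C3"
    using M C1 C2 C3 Dpos by (auto intro!: mult_pos_pos add_pos_pos)
  have "0 < C" unfolding C_def using parts by simp
  then show ?thesis
  proof (rule that)
    fix \<epsilon> :: real and W :: "nat \<Rightarrow> real \<Rightarrow> real" and n :: nat
    assume \<epsilon>: "0 < \<bar>\<epsilon>\<bar>" "\<bar>\<epsilon>\<bar> \<le> e1" and four: "four_cycles \<epsilon> W" and n: "n \<le> 3"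
    have cyc: "cycle \<epsilon> (W k)" if "k \<le> 3" for k using four that by (simp add: four_cycles_def)
    have less0: "W j 0 < W k 0" if "j < k" "k \<le> 3" for j k using four that by (simp add: four_cycles_def)
    have \<epsilon>1: "\<bar>\<epsilon>\<bar> \<le> 1" "\<epsilon> \<noteq> 0" using \<epsilon> e1 by auto
    have sol: "solution \<epsilon> (W k)" if "k \<le> 3" for k using cyc[OF that] by (simp add: cycle_def)
    have per: "W k (2 * pi) = W k 0" if "k \<le> 3" for k using cyc[OF that] unfolding cycle_def by (metis add_0)
    have der: "(W k has_real_derivative \<epsilon> * rhs a b \<epsilon> \<phi> (W k \<phi>)) (at \<phi>)" if "k \<le> 3" for k \<phi>
      using solutionD(1)[OF sol[OF that]] .
    have less: "W j t < W k t" if "j < k" "k \<le> 3" for j k t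
      using solution_less[OF \<epsilon>(2) sol sol less0, of j k t] that by simp
    \<comment> \<open>\<open>A\<close> follows the moving solutions in the perturbed field,
      \<open>Z\<close> keeps the initial values as nodes in the unperturbed field. The identities
      given by periodicity concern \<open>A\<close>; only \<open>Z\<close>, with its fixed nodes,
      integrates to a divided difference of \<open>avg\<close>.\<close>
    define A where "A n i \<theta> = ddiff (rhs a b \<epsilon> \<theta>) (\<lambda>k. W k \<theta>) n i" for n i \<theta>
    define Z where "Z n \<theta> = ddiff (rhs a b 0 \<theta>) (\<lambda>k. W k 0) n 0" for n \<theta>
    have inj: "inj_on (\<lambda>k. W k t) {..3}" for t
    proof (rule inj_onI)
      fix j k :: nat assume "j \<in> {..3}" "k \<in> {..3}" "W j t = W k t"
      then show "j = k" using less[of j k t] less[of k j t] by (metis atMost_iff less_irrefl linorder_neqE_nat)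
    qed
    have cfg: "(\<epsilon>, \<theta>, D * \<bar>\<epsilon>\<bar>, (\<lambda>k. W k \<theta>), (\<lambda>k. W k 0)) \<in> configs 3" if "\<theta> \<in> {0..2*pi}" for \<theta>
    proof -
      have "\<bar>W k \<theta> - W k 0\<bar> \<le> D * \<bar>\<epsilon>\<bar>" if k: "k \<le> 3" for k
      proof -
        have "\<bar>W k \<theta> - W k 0\<bar> \<le> 2 * pi * (\<bar>\<epsilon>\<bar> * M0)"
          using \<open>\<theta> \<in> {0..2*pi}\<close>
          by (rule derivative_bound_period[OF der[OF k], rotated])
             (auto simp: abs_mult intro!: mult_left_mono M0(2)[OF \<epsilon>(2) solutionD(2)[OF sol[OF k]]])
        also have "\<dots> \<le> D * \<bar>\<epsilon>\<bar>" by (simp add: D_def algebra_simps)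
        finally show ?thesis .
      qed
      moreover have "\<bar>\<epsilon>\<bar> \<le> D * \<bar>\<epsilon>\<bar>" using M0 by (simp add: D_def algebra_simps)
      ultimately show ?thesis using inj \<epsilon> solutionD(2)[OF sol] unfolding configs_def by blast
    qed
    have A_le: "\<bar>A n i \<theta>\<bar> \<le> M" if "n + i \<le> 3" "\<theta> \<in> {0..2*pi}" for n i \<theta>
      using MM[OF cfg[OF that(2)] that(1)] by (simp add: A_def)
    have AZ: "\<bar>Z n \<theta> - A n 0 \<theta>\<bar> \<le> M * D * \<bar>\<epsilon>\<bar>" if "n \<le> 3" "\<theta> \<in> {0..2*pi}" for n \<theta>
      using MM[OF cfg[OF that(2)], of n 0] that(1) by (simp add: A_def Z_def mult_ac abs_minus_commute)
    have stepA: "A n (Suc i) \<theta> - A n i \<theta> = A (Suc n) i \<theta> * (W (i + Suc n) \<theta> - W i \<theta>)" if "i + Suc n \<le> 3" for n i \<theta>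
      using less[of i "i + Suc n" \<theta>] that unfolding A_def by simp
    have Z_int: "(Z n has_integral ddiff avg (\<lambda>k. W k 0) n 0) {0..2*pi}" if "n \<le> 3" for n
      unfolding Z_def
    proof (rule ddiff_has_integral)
      fix k assume "k \<in> {0..0 + n}"
      then have "1 < W k 0" using solutionD(2)[OF sol, of k 0] \<alpha> that by auto
      then show "((\<lambda>\<theta>. rhs a b 0 \<theta> (W k 0)) has_integral avg (W k 0)) {0..2*pi}"
        unfolding avg_def by (rule rhs_integral)
    qed
    have key: "\<bar>ddiff avg (\<lambda>k. W k 0) n 0\<bar> \<le> 2 * pi * (B * \<bar>\<epsilon>\<bar>)"
      if "n \<le> 3" "(h has_integral 0) {0..2*pi}" "\<And>\<theta>. \<theta> \<in> {0..2*pi} \<Longrightarrow> \<bar>Z n \<theta> - h \<theta>\<bar> \<le> B * \<bar>\<epsilon>\<bar>" for n h B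
      by (rule integral_near_zero_mean[OF that(2) Z_int[OF that(1)] that(3)])
    define G where "G j k \<theta> = W k \<theta> - W j \<theta>" for j k \<theta>
    have Gpos: "G j k \<theta> > 0" if "j < k" "k \<le> 3" for j k \<theta> using less[OF that] by (simp add: G_def)
    \<comment> \<open>\<open>\<epsilon> * Q j k\<close> is the logarithmic growth rate of the gap
      between solutions \<open>j\<close> and \<open>k\<close>. The Lipschitz bound for it is
      independent of the size of the gap.\<close>
    define Q where "Q j k \<theta> = (rhs a b \<epsilon> \<theta> (W k \<theta>) - rhs a b \<epsilon> \<theta> (W j \<theta>)) / G j k \<theta>" for j k \<theta>
    have lnG: "((\<lambda>\<theta>. ln (G j k \<theta>)) has_real_derivative \<epsilon> * Q j k \<theta>) (at \<theta>)" if "j < k" "k \<le> 3" for j k \<theta>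
    proof -
      have "(G j k has_real_derivative \<epsilon> * rhs a b \<epsilon> \<theta> (W k \<theta>) - \<epsilon> * rhs a b \<epsilon> \<theta> (W j \<theta>)) (at \<theta>)"
        unfolding G_def using that by (intro DERIV_diff der) auto
      from DERIV_chain2[OF DERIV_ln_divide[OF Gpos[OF that]] this]
      show ?thesis by (simp add: Q_def right_diff_distrib diff_divide_distrib)
    qed
    have Q_le: "\<bar>\<epsilon> * Q j k \<theta>\<bar> \<le> \<bar>\<epsilon>\<bar> * L" if "j < k" "k \<le> 3" for j k \<theta>
    proof -
      have "\<bar>\<epsilon> * rhs a b \<epsilon> \<theta> (W k \<theta>) - \<epsilon> * rhs a b \<epsilon> \<theta> (W j \<theta>)\<bar> \<le> \<bar>\<epsilon>\<bar> * L * G j k \<theta>"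
        using L(2)[OF \<epsilon>(2) sol sol, of k j \<theta>] that Gpos[OF that, of \<theta>] by (simp add: G_def)
      then have "\<bar>\<epsilon> * (rhs a b \<epsilon> \<theta> (W k \<theta>) - rhs a b \<epsilon> \<theta> (W j \<theta>))\<bar> / G j k \<theta> \<le> \<bar>\<epsilon>\<bar> * L"
        using Gpos[OF that, of \<theta>] by (simp add: right_diff_distrib divide_le_eq)
      moreover have "\<bar>\<epsilon> * Q j k \<theta>\<bar> = \<bar>\<epsilon> * (rhs a b \<epsilon> \<theta> (W k \<theta>) - rhs a b \<epsilon> \<theta> (W j \<theta>))\<bar> / G j k \<theta>"
        using Gpos[OF that, of \<theta>] by (simp add: Q_def abs_mult abs_divide)
      ultimately show ?thesis by simp
    qed
    define q where "q j k \<theta> = G j k \<theta> / G j k 0" for j k \<theta>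
    have q_exp: "q j k \<theta> = exp (ln (G j k \<theta>) - ln (G j k 0))" if "j < k" "k \<le> 3" for j k \<theta>
      using Gpos[OF that] by (simp add: q_def exp_diff)
    have ln_le: "\<bar>ln (G j k \<theta>) - ln (G j k 0)\<bar> \<le> 2 * pi * L * \<bar>\<epsilon>\<bar>" if "j < k" "k \<le> 3" "\<theta> \<in> {0..2*pi}" for j k \<theta>
      using derivative_bound_period[OF lnG[OF that(1,2)] Q_le[OF that(1,2)] that(3)] by (simp add: mult_ac)
    have expC2: "exp x \<le> C2" if "x \<le> 2 * pi * L * \<bar>\<epsilon>\<bar>" for x
    proof -
      have "2 * pi * L * \<bar>\<epsilon>\<bar> \<le> 2 * pi * L" using \<epsilon>1 L by (simp add: mult_left_le)
      from order_trans[OF that this] show ?thesis unfolding C2_def exp_le_cancel_iff .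
    qed
    have q_le: "\<bar>q j k \<theta>\<bar> \<le> C2" "\<bar>q j k \<theta> - 1\<bar> \<le> C1 * \<bar>\<epsilon>\<bar>" if "j < k" "k \<le> 3" "\<theta> \<in> {0..2*pi}" for j k \<theta>
    proof -
      note b = ln_le[OF that]
      show "\<bar>q j k \<theta>\<bar> \<le> C2" unfolding q_exp[OF that(1,2)] using b expC2 by simp
      have "\<bar>q j k \<theta> - 1\<bar> \<le> (2 * pi * L * \<bar>\<epsilon>\<bar>) * C2"
        unfolding q_exp[OF that(1,2)]
        by (rule order_trans[OF abs_exp_minus_one_le]) (use b L in \<open>intro mult_mono expC2; simp\<close>)
      then show "\<bar>q j k \<theta> - 1\<bar> \<le> C1 * \<bar>\<epsilon>\<bar>" by (simp add: C1_def mult_ac)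
    qed
    \<comment> \<open>The logarithm of the gap between neighbours is periodic, so its derivative has
      integral zero.\<close>
    have int1: "(A 1 i has_integral 0) {0..2*pi}" if "i \<le> 2" for i
    proof -
      have "((\<lambda>\<theta>. \<epsilon> * Q i (Suc i) \<theta>) has_integral ln (G i (Suc i) (2*pi)) - ln (G i (Suc i) 0)) {0..2*pi}"
        by (rule fundamental_theorem_of_calculus)
           (use lnG[of i "Suc i"] that in \<open>auto simp: has_real_derivative_iff_has_vector_derivative[symmetric] intro: has_field_derivative_at_within\<close>)
      moreover have "G i (Suc i) (2*pi) = G i (Suc i) 0" using that by (simp add: G_def per)
      ultimately have "((\<lambda>\<theta>. \<epsilon> * Q i (Suc i) \<theta> / \<epsilon>) has_integral 0 / \<epsilon>) {0..2*pi}"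
        by (intro has_integral_divide) simp
      moreover have "A 1 i = (\<lambda>\<theta>. \<epsilon> * Q i (Suc i) \<theta> / \<epsilon>)"
        using \<epsilon>1 by (auto simp: A_def Q_def G_def)
      ultimately show ?thesis by simp
    qed
    \<comment> \<open>Two identities of order one are subtracted and divided by the initial gap, a
      constant. What remains of the moving gap is the factor \<open>q\<close>, which is close to
      1.\<close>
    have int2: "((\<lambda>\<theta>. A 2 i \<theta> * q i (i + 2) \<theta>) has_integral 0) {0..2*pi}" if "i \<le> 1" for i
    proof -
      have "((\<lambda>\<theta>. (A 1 (Suc i) \<theta> - A 1 i \<theta>) / G i (i + 2) 0) has_integral (0 - 0) / G i (i + 2) 0) {0..2*pi}"
        using that by (intro has_integral_divide has_integral_diff int1) auto
      moreover have "(\<lambda>\<theta>. (A 1 (Suc i) \<theta> - A 1 i \<theta>) / G i (i + 2) 0) = (\<lambda>\<theta>. A 2 i \<theta> * q i (i + 2) \<theta>)"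
        using stepA[of i 1] that by (simp add: q_def G_def numeral_2_eq_2)
      ultimately show ?thesis by simp
    qed
    consider "n = 0" | "n = 1" | "n = 2" | "n = 3" using n by linarith
    then have "\<exists>B. \<bar>ddiff avg (\<lambda>k. W k 0) n 0\<bar> \<le> 2 * pi * (B * \<bar>\<epsilon>\<bar>) \<and> 2 * pi * B \<le> C"
    proof cases
      case 1
      have "((\<lambda>\<theta>. \<epsilon> * rhs a b \<epsilon> \<theta> (W 0 \<theta>)) has_integral W 0 (2*pi) - W 0 0) {0..2*pi}"
        by (rule fundamental_theorem_of_calculus)
           (use der[of 0] in \<open>auto simp: has_real_derivative_iff_has_vector_derivative[symmetric] intro: has_field_derivative_at_within\<close>)
      then have "((\<lambda>\<theta>. \<epsilon> * rhs a b \<epsilon> \<theta> (W 0 \<theta>) / \<epsilon>) has_integral 0 / \<epsilon>) {0..2*pi}"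
        by (intro has_integral_divide) (simp add: per)
      then have "(A 0 0 has_integral 0) {0..2*pi}" using \<epsilon>1 by (simp add: A_def[abs_def])
      then have "\<bar>ddiff avg (\<lambda>k. W k 0) n 0\<bar> \<le> 2 * pi * (M * D * \<bar>\<epsilon>\<bar>)"
        unfolding 1 using AZ[of 0] by (intro key) auto
      moreover have "2 * pi * (M * D) \<le> C" unfolding C_def using parts by (intro mult_left_mono) auto
      ultimately show ?thesis by blast
    next
      case 2
      have "\<bar>ddiff avg (\<lambda>k. W k 0) n 0\<bar> \<le> 2 * pi * (M * D * \<bar>\<epsilon>\<bar>)"
        unfolding 2 using AZ[of 1] by (intro key[OF _ int1[of 0]]) auto
      moreover have "2 * pi * (M * D) \<le> C" unfolding C_def using parts by (intro mult_left_mono) auto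
      ultimately show ?thesis by blast
    next
      case 3
      have "\<bar>ddiff avg (\<lambda>k. W k 0) n 0\<bar> \<le> 2 * pi * ((M * D + M * C1) * \<bar>\<epsilon>\<bar>)"
        unfolding 3
      proof (rule key[OF _ int2[of 0]])
        fix \<theta> assume \<theta>: "\<theta> \<in> {0..2*pi}"
        have "Z 2 \<theta> - A 2 0 \<theta> * q 0 (0 + 2) \<theta> = (Z 2 \<theta> - A 2 0 \<theta>) - A 2 0 \<theta> * (q 0 2 \<theta> - 1)"
          by (simp add: numeral_2_eq_2 algebra_simps)
        also have "\<bar>\<dots>\<bar> \<le> \<bar>Z 2 \<theta> - A 2 0 \<theta>\<bar> + \<bar>A 2 0 \<theta>\<bar> * \<bar>q 0 2 \<theta> - 1\<bar>"
          by (rule order_trans[OF abs_triangle_ineq4]) (simp add: abs_mult)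
        also have "\<dots> \<le> M * D * \<bar>\<epsilon>\<bar> + M * (C1 * \<bar>\<epsilon>\<bar>)"
          using M by (intro add_mono mult_mono AZ A_le q_le \<theta>) auto
        finally show "\<bar>Z 2 \<theta> - A 2 0 \<theta> * q 0 (0 + 2) \<theta>\<bar> \<le> (M * D + M * C1) * \<bar>\<epsilon>\<bar>"
          by (simp add: algebra_simps)
      qed auto
      moreover have "2 * pi * (M * D + M * C1) \<le> C" unfolding C_def using parts by (intro mult_left_mono) auto
      ultimately show ?thesis by blast
    next
      case 4
      \<comment> \<open>The initial gap between the outermost solutions is the divisor at order
        three and may be arbitrarily small.\<close>
      define E where "E = G 0 3 0"
      have E: "0 < E" "E \<le> \<beta> - \<alpha>"
        using Gpos[of 0 3 0] solutionD(2)[OF sol, of 0 0] solutionD(2)[OF sol, of 3 0] by (auto simp: E_def G_def)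
      \<comment> \<open>Both growth rates equal \<open>A 1 1\<close> up to a second-order divided
        difference times a gap between neighbours. Their difference is therefore of the order of the
        gaps, which is the extra factor needed against \<open>1 / E\<close>.\<close>
      have QQ: "Q 1 3 \<theta> - Q 0 2 \<theta> = A 2 1 \<theta> * G 2 3 \<theta> + A 2 0 \<theta> * G 0 1 \<theta>" for \<theta>
      proof -
        have r: "rhs a b \<epsilon> \<theta> (W 1 \<theta>) - rhs a b \<epsilon> \<theta> (W 0 \<theta>) = A 1 0 \<theta> * G 0 1 \<theta>"
          "rhs a b \<epsilon> \<theta> (W 2 \<theta>) - rhs a b \<epsilon> \<theta> (W 1 \<theta>) = A 1 1 \<theta> * G 1 2 \<theta>"
          "rhs a b \<epsilon> \<theta> (W 3 \<theta>) - rhs a b \<epsilon> \<theta> (W 2 \<theta>) = A 1 2 \<theta> * G 2 3 \<theta>"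
          using stepA[of 0 0 \<theta>] stepA[of 1 0 \<theta>] stepA[of 2 0 \<theta>]
          by (simp_all add: A_def G_def numeral_2_eq_2 numeral_3_eq_3)
        have s: "A 1 1 \<theta> - A 1 0 \<theta> = A 2 0 \<theta> * G 0 2 \<theta>" "A 1 2 \<theta> - A 1 1 \<theta> = A 2 1 \<theta> * G 1 3 \<theta>"
          using stepA[of 0 1 \<theta>] stepA[of 1 1 \<theta>] by (simp_all add: G_def numeral_2_eq_2 numeral_3_eq_3)
        have g: "G 0 2 \<theta> = G 0 1 \<theta> + G 1 2 \<theta>" "G 1 3 \<theta> = G 1 2 \<theta> + G 2 3 \<theta>" by (simp_all add: G_def)
        have "rhs a b \<epsilon> \<theta> (W 3 \<theta>) - rhs a b \<epsilon> \<theta> (W 1 \<theta>) = (A 1 1 \<theta> + A 2 1 \<theta> * G 2 3 \<theta>) * G 1 3 \<theta>"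
        proof -
          have "rhs a b \<epsilon> \<theta> (W 3 \<theta>) - rhs a b \<epsilon> \<theta> (W 1 \<theta>) = A 1 2 \<theta> * G 2 3 \<theta> + A 1 1 \<theta> * G 1 2 \<theta>"
            using r by linarith
          also have "A 1 2 \<theta> = A 1 1 \<theta> + A 2 1 \<theta> * G 1 3 \<theta>" using s(2) by linarith
          finally show ?thesis unfolding g by (simp add: algebra_simps)
        qed
        then have "Q 1 3 \<theta> = A 1 1 \<theta> + A 2 1 \<theta> * G 2 3 \<theta>"
          using Gpos[of 1 3 \<theta>] by (simp add: Q_def)
        moreover have "rhs a b \<epsilon> \<theta> (W 2 \<theta>) - rhs a b \<epsilon> \<theta> (W 0 \<theta>) = (A 1 1 \<theta> - A 2 0 \<theta> * G 0 1 \<theta>) * G 0 2 \<theta>"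
        proof -
          have "rhs a b \<epsilon> \<theta> (W 2 \<theta>) - rhs a b \<epsilon> \<theta> (W 0 \<theta>) = A 1 0 \<theta> * G 0 1 \<theta> + A 1 1 \<theta> * G 1 2 \<theta>"
            using r by linarith
          also have "A 1 0 \<theta> = A 1 1 \<theta> - A 2 0 \<theta> * G 0 2 \<theta>" using s(1) by linarith
          finally show ?thesis unfolding g by (simp add: algebra_simps)
        qed
        then have "Q 0 2 \<theta> = A 1 1 \<theta> - A 2 0 \<theta> * G 0 1 \<theta>"
          using Gpos[of 0 2 \<theta>] by (simp add: Q_def)
        ultimately show ?thesis by simp
      qed
      have G_le: "G j k \<theta> \<le> C2 * E" if "(j, k) \<in> {(2, 3), (0, 1)}" "\<theta> \<in> {0..2*pi}" for j k \<theta>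
      proof -
        have "G j k \<theta> \<le> G 0 3 \<theta>" using that(1) less[of 0 1 \<theta>] less[of 1 2 \<theta>] less[of 2 3 \<theta>] by (auto simp: G_def)
        also have "\<dots> = q 0 3 \<theta> * E" using E by (simp add: q_def E_def)
        also have "\<dots> \<le> C2 * E" using q_le(1)[of 0 3 \<theta>] that(2) E by (intro mult_right_mono) auto
        finally show ?thesis .
      qed
      \<comment> \<open>The logarithm of the ratio of the two gaps; by the preceding identity its
        derivative is O(\<epsilon>) times \<open>E\<close>.\<close>
      define ll where "ll \<theta> = ln (G 1 3 \<theta>) - ln (G 0 2 \<theta>)" for \<theta>
      have dll: "(ll has_real_derivative \<epsilon> * (Q 1 3 \<theta> - Q 0 2 \<theta>)) (at \<theta>)" for \<theta>
        using DERIV_diff[OF lnG[of 1 3 \<theta>] lnG[of 0 2 \<theta>]] unfolding ll_def[abs_def] by (simp add: right_diff_distrib)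
      have ll_le: "\<bar>ll \<theta> - ll 0\<bar> \<le> (4 * pi * M * C2) * (\<bar>\<epsilon>\<bar> * E)" if "\<theta> \<in> {0..2*pi}" for \<theta>
      proof -
        have "\<bar>\<epsilon> * (Q 1 3 t - Q 0 2 t)\<bar> \<le> \<bar>\<epsilon>\<bar> * (M * (C2 * E) + M * (C2 * E))" if t: "t \<in> {0..2*pi}" for t
        proof -
          have "\<bar>A 2 1 t * G 2 3 t + A 2 0 t * G 0 1 t\<bar> \<le> \<bar>A 2 1 t\<bar> * \<bar>G 2 3 t\<bar> + \<bar>A 2 0 t\<bar> * \<bar>G 0 1 t\<bar>"
            by (rule order_trans[OF abs_triangle_ineq]) (simp add: abs_mult)
          also have "\<dots> \<le> M * (C2 * E) + M * (C2 * E)"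
            using M G_le[of 2 3 t] G_le[of 0 1 t] Gpos[of 2 3 t] Gpos[of 0 1 t] t
            by (intro add_mono mult_mono A_le) auto
          finally show ?thesis unfolding QQ abs_mult by (intro mult_left_mono) auto
        qed
        from derivative_bound_period[OF dll this that] show ?thesis by (simp add: algebra_simps)
      qed
      \<comment> \<open>The factor \<open>E\<close> in this bound cancels the division by
        \<open>E\<close> in the identity of order three. Estimating the two quotients separately
        against 1 would give only O(\<epsilon>).\<close>
      have vdiff: "\<bar>q 1 3 \<theta> - q 0 2 \<theta>\<bar> \<le> C3 * \<bar>\<epsilon>\<bar> * E" if "\<theta> \<in> {0..2*pi}" for \<theta>
      proof -
        have "q 1 3 \<theta> = q 0 2 \<theta> * exp (ll \<theta> - ll 0)"
          by (simp add: q_exp ll_def exp_add[symmetric] algebra_simps)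
        then have "\<bar>q 1 3 \<theta> - q 0 2 \<theta>\<bar> = \<bar>q 0 2 \<theta>\<bar> * \<bar>exp (ll \<theta> - ll 0) - 1\<bar>"
          by (simp add: abs_mult[symmetric] algebra_simps)
        also have "\<dots> \<le> C2 * (((4 * pi * M * C2) * (\<bar>\<epsilon>\<bar> * E)) * exp (4 * pi * M * C2 * (\<beta> - \<alpha>)))"
        proof (rule mult_mono)
          show "\<bar>q 0 2 \<theta>\<bar> \<le> C2" using q_le that by simp
          have "(4 * pi * M * C2) * (\<bar>\<epsilon>\<bar> * E) \<le> (4 * pi * M * C2) * (1 * (\<beta> - \<alpha>))"
            using M C2 E \<epsilon>1 by (intro mult_left_mono mult_mono) auto
          then have "exp \<bar>ll \<theta> - ll 0\<bar> \<le> exp (4 * pi * M * C2 * (\<beta> - \<alpha>))"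
            unfolding exp_le_cancel_iff mult_1 by (rule order_trans[OF ll_le[OF that]])
          then show "\<bar>exp (ll \<theta> - ll 0) - 1\<bar> \<le> ((4 * pi * M * C2) * (\<bar>\<epsilon>\<bar> * E)) * exp (4 * pi * M * C2 * (\<beta> - \<alpha>))"
            using M C2 E by (intro order_trans[OF abs_exp_minus_one_le] mult_mono ll_le that) auto
        qed (use C2 in auto)
        finally show ?thesis by (simp add: C3_def mult_ac)
      qed
      \<comment> \<open>The two identities of order two are subtracted and divided by
        \<open>E\<close>. Inserting \<open>A 2 1 = A 2 0 + A 3 0 * (q 0 3 * E)\<close> produces the
        divided difference of order three and a remainder controlled by
        \<open>vdiff\<close>.\<close>
      have "((\<lambda>\<theta>. (A 2 1 \<theta> * q 1 (1 + 2) \<theta> - A 2 0 \<theta> * q 0 (0 + 2) \<theta>) / E) has_integral (0 - 0) / E) {0..2*pi}"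
        by (intro has_integral_divide has_integral_diff int2) auto
      moreover have "(A 2 1 \<theta> * q 1 (1 + 2) \<theta> - A 2 0 \<theta> * q 0 (0 + 2) \<theta>) / E
          = A 3 0 \<theta> * q 0 3 \<theta> * q 1 3 \<theta> + A 2 0 \<theta> * ((q 1 3 \<theta> - q 0 2 \<theta>) / E)" for \<theta>
      proof -
        have "A 2 1 \<theta> = A 2 0 \<theta> + A 3 0 \<theta> * (q 0 3 \<theta> * E)"
        proof -
          have "G 0 3 \<theta> = q 0 3 \<theta> * E" using E by (simp add: q_def E_def)
          moreover have "A 2 1 \<theta> = A 2 0 \<theta> + A 3 0 \<theta> * G 0 3 \<theta>"
            using stepA[of 0 2 \<theta>] by (simp add: G_def numeral_2_eq_2 numeral_3_eq_3)
          ultimately show ?thesis by simp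
        qed
        then show ?thesis using E by (simp add: numeral_3_eq_3 numeral_2_eq_2 field_simps)
      qed
      ultimately have int3: "((\<lambda>\<theta>. A 3 0 \<theta> * q 0 3 \<theta> * q 1 3 \<theta> + A 2 0 \<theta> * ((q 1 3 \<theta> - q 0 2 \<theta>) / E)) has_integral 0) {0..2*pi}"
        by simp
      have "\<bar>ddiff avg (\<lambda>k. W k 0) n 0\<bar> \<le> 2 * pi * ((M * D + M * (C1 * C2 + C1) + M * C3) * \<bar>\<epsilon>\<bar>)"
        unfolding 4
      proof (rule key[OF _ int3])
        fix \<theta> assume \<theta>: "\<theta> \<in> {0..2*pi}"
        have "Z 3 \<theta> - (A 3 0 \<theta> * q 0 3 \<theta> * q 1 3 \<theta> + A 2 0 \<theta> * ((q 1 3 \<theta> - q 0 2 \<theta>) / E))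
          = (Z 3 \<theta> - A 3 0 \<theta>) + (- A 3 0 \<theta>) * ((q 0 3 \<theta> - 1) * q 1 3 \<theta> + (q 1 3 \<theta> - 1)) + (- A 2 0 \<theta>) * ((q 1 3 \<theta> - q 0 2 \<theta>) / E)"
          by (simp add: algebra_simps diff_divide_distrib add_divide_distrib)
        also have "\<bar>\<dots>\<bar> \<le> \<bar>Z 3 \<theta> - A 3 0 \<theta>\<bar> + \<bar>A 3 0 \<theta>\<bar> * (\<bar>q 0 3 \<theta> - 1\<bar> * \<bar>q 1 3 \<theta>\<bar> + \<bar>q 1 3 \<theta> - 1\<bar>) + \<bar>A 2 0 \<theta>\<bar> * \<bar>(q 1 3 \<theta> - q 0 2 \<theta>) / E\<bar>"
        proof -
          have "\<bar>(q 0 3 \<theta> - 1) * q 1 3 \<theta> + (q 1 3 \<theta> - 1)\<bar> \<le> \<bar>q 0 3 \<theta> - 1\<bar> * \<bar>q 1 3 \<theta>\<bar> + \<bar>q 1 3 \<theta> - 1\<bar>"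
            by (rule order_trans[OF abs_triangle_ineq]) (simp add: abs_mult)
          then have "\<bar>(- A 3 0 \<theta>) * ((q 0 3 \<theta> - 1) * q 1 3 \<theta> + (q 1 3 \<theta> - 1))\<bar> \<le> \<bar>A 3 0 \<theta>\<bar> * (\<bar>q 0 3 \<theta> - 1\<bar> * \<bar>q 1 3 \<theta>\<bar> + \<bar>q 1 3 \<theta> - 1\<bar>)"
            unfolding abs_mult abs_minus_cancel by (intro mult_left_mono) auto
          moreover have "\<bar>(- A 2 0 \<theta>) * ((q 1 3 \<theta> - q 0 2 \<theta>) / E)\<bar> = \<bar>A 2 0 \<theta>\<bar> * \<bar>(q 1 3 \<theta> - q 0 2 \<theta>) / E\<bar>"
            unfolding abs_mult abs_minus_cancel ..
          moreover have "\<bar>x + y + z\<bar> \<le> \<bar>x\<bar> + Y + Z" if "\<bar>y\<bar> \<le> Y" "\<bar>z\<bar> = Z" for x y z Y Z :: real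
            using that by linarith
          ultimately show ?thesis by blast
        qed
        also have "\<dots> \<le> M * D * \<bar>\<epsilon>\<bar> + M * ((C1 * \<bar>\<epsilon>\<bar>) * C2 + C1 * \<bar>\<epsilon>\<bar>) + M * (C3 * \<bar>\<epsilon>\<bar>)"
        proof (intro add_mono mult_mono AZ A_le q_le \<theta>)
          show "\<bar>(q 1 3 \<theta> - q 0 2 \<theta>) / E\<bar> \<le> C3 * \<bar>\<epsilon>\<bar>"
            using vdiff[OF \<theta>] E by (simp add: abs_divide divide_le_eq)
        qed (use M C1 in auto)
        finally show "\<bar>Z 3 \<theta> - (A 3 0 \<theta> * q 0 3 \<theta> * q 1 3 \<theta> + A 2 0 \<theta> * ((q 1 3 \<theta> - q 0 2 \<theta>) / E))\<bar>
           \<le> (M * D + M * (C1 * C2 + C1) + M * C3) * \<bar>\<epsilon>\<bar>"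
          by (simp add: algebra_simps)
      qed auto
      moreover have "2 * pi * (M * D + M * (C1 * C2 + C1) + M * C3) \<le> C" unfolding C_def using parts by (intro mult_left_mono) auto
      ultimately show ?thesis by blast
    qed
    then obtain B where B: "\<bar>ddiff avg (\<lambda>k. W k 0) n 0\<bar> \<le> 2 * pi * (B * \<bar>\<epsilon>\<bar>)" "2 * pi * B \<le> C" by blast
    have "2 * pi * (B * \<bar>\<epsilon>\<bar>) = (2 * pi * B) * \<bar>\<epsilon>\<bar>" by simp
    also have "\<dots> \<le> C * \<bar>\<epsilon>\<bar>" using B(2) by (intro mult_right_mono) auto
    finally show "\<bar>ddiff avg (\<lambda>k. W k 0) n 0\<bar> \<le> C * \<bar>\<epsilon>\<bar>" using B(1) by simp
  qed
qed

text \<open>The Leibniz rule with \<open>weight\<close> carries the O(\<epsilon>) bounds over to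
  \<open>avgpoly\<close>, and Newton's formula evaluates them at \<open>z\<close>, which need not
  lie between \<alpha> and \<beta>. A nonzero value at \<open>z\<close> then keeps |\<epsilon>| away
  from 0.\<close>

lemma no_four_cycles:
  assumes z: "avgpoly a b z \<noteq> 0"
  obtains \<epsilon>0 where "0 < \<epsilon>0" "\<epsilon>0 \<le> e1" "\<And>\<epsilon> W. 0 < \<bar>\<epsilon>\<bar> \<Longrightarrow> \<bar>\<epsilon>\<bar> < \<epsilon>0 \<Longrightarrow> four_cycles \<epsilon> W \<Longrightarrow> False"
proof -
  obtain C where C: "0 < C" "\<And>\<epsilon> W n. 0 < \<bar>\<epsilon>\<bar> \<Longrightarrow> \<bar>\<epsilon>\<bar> \<le> e1 \<Longrightarrow> four_cycles \<epsilon> W \<Longrightarrow> n \<le> 3 \<Longrightarrow> \<bar>ddiff avg (\<lambda>k. W k 0) n 0\<bar> \<le> C * \<bar>\<epsilon>\<bar>"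
    using that by (rule four_cycles_ddiff_bound)
  obtain N where N: "N > 0" and NN: "\<And>p n i. p \<in> configs 3 \<Longrightarrow> n + i \<le> 3 \<Longrightarrow> \<bar>ddiff weight (nX p) n i\<bar> \<le> N"
    using tame_uniform_bound[OF weight_tame[of 3]] by blast
  \<comment> \<open>Bounds the distance from \<open>z\<close> to every node; being at least 1, its
    cube absorbs the lower powers.\<close>
  define Qz where "Qz = \<bar>z\<bar> + \<beta>"
  have Qz: "1 \<le> Qz" using \<alpha> \<alpha>\<beta> by (simp add: Qz_def)
  \<comment> \<open>16 is the product of at most four Leibniz terms and the four terms of Newton's
    formula.\<close>
  define P where "P = 16 * C * N * Qz ^ 3"
  have P: "P > 0" using C N Qz by (simp add: P_def)
  show ?thesis
  proof (rule that[of "min e1 (\<bar>avgpoly a b z\<bar> / P)"])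
    show "0 < min e1 (\<bar>avgpoly a b z\<bar> / P)" using e1 z P by simp
    fix \<epsilon> and W :: "nat \<Rightarrow> real \<Rightarrow> real"
    assume \<epsilon>: "0 < \<bar>\<epsilon>\<bar>" "\<bar>\<epsilon>\<bar> < min e1 (\<bar>avgpoly a b z\<bar> / P)" and four: "four_cycles \<epsilon> W"
    have cyc: "cycle \<epsilon> (W k)" if "k \<le> 3" for k using four that by (simp add: four_cycles_def)
    have less: "W j 0 < W k 0" if "j < k" "k \<le> 3" for j k using four that by (simp add: four_cycles_def)
    have \<epsilon>e: "\<bar>\<epsilon>\<bar> \<le> e1" using \<epsilon> by simp
    define y where "y k = W k 0" for k
    have y: "y k \<in> {\<alpha>..\<beta>}" if "k \<le> 3" for k
      using cyc[OF that] solutionD(2) by (auto simp: cycle_def y_def)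
    have inj: "inj_on y {..3}"
    proof (rule inj_onI)
      fix j k :: nat assume "j \<in> {..3}" "k \<in> {..3}" "y j = y k"
      then show "j = k" using less[of j k] less[of k j] unfolding y_def by (metis atMost_iff less_irrefl linorder_neqE_nat)
    qed
    have "(0, 0, 0, y, y) \<in> configs 3" using y inj e1 by (auto simp: configs_def)
    from NN[OF this] have wb: "\<bar>ddiff weight y n i\<bar> \<le> N" if "n + i \<le> 3" for n i using that by simp
    have ab: "\<bar>ddiff avg y n 0\<bar> \<le> C * \<bar>\<epsilon>\<bar>" if "n \<le> 3" for n
      using C(2)[OF \<epsilon>(1) \<epsilon>e four that] by (simp add: y_def[abs_def])
    have pb: "\<bar>ddiff (avgpoly a b) y n 0\<bar> \<le> 4 * (C * \<bar>\<epsilon>\<bar> * N)" if n: "n \<le> 3" for n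
    proof -
      have "ddiff (avgpoly a b) y n 0 = ddiff (\<lambda>t. avg t * weight t) y n 0"
      proof (rule ddiff_cong)
        fix k assume "k \<in> {0..0 + n}"
        then have "1 < y k" using y[of k] n \<alpha> by auto
        then show "avgpoly a b (y k) = avg (y k) * weight (y k)" by (simp add: avg_def weight_def)
      qed
      also have "\<dots> = (\<Sum>k\<le>n. ddiff avg y k 0 * ddiff weight y (n - k) (0 + k))"
        by (rule ddiff_mult, rule inj_on_subset[OF inj]) (use n in auto)
      also have "\<bar>\<dots>\<bar> \<le> (\<Sum>k\<le>n. C * \<bar>\<epsilon>\<bar> * N)"
        by (rule order_trans[OF sum_abs], rule sum_mono, unfold abs_mult, rule mult_mono)
           (use n ab wb C in auto)
      also have "\<dots> = real (n + 1) * (C * \<bar>\<epsilon>\<bar> * N)" by simp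
      also have "\<dots> \<le> 4 * (C * \<bar>\<epsilon>\<bar> * N)" using n C N by (intro mult_right_mono) auto
      finally show ?thesis .
    qed
    have zy: "\<bar>z - y k\<bar> \<le> Qz" if "k \<le> 3" for k using y[OF that] \<alpha> by (auto simp: Qz_def)
    define T where "T = 4 * (C * \<bar>\<epsilon>\<bar> * N)"
    have T: "0 \<le> T" using C N by (simp add: T_def)
    obtain c0 c1 c2 c3 where "\<And>t. avgpoly a b t = c0 + c1 * t + c2 * t^2 + c3 * t^3"
      using avgpoly_cubic by blast
    from newton_cubic[OF this inj, of z]
    have "\<bar>avgpoly a b z\<bar> \<le> \<bar>ddiff (avgpoly a b) y 0 0\<bar> + \<bar>ddiff (avgpoly a b) y 1 0\<bar> * \<bar>z - y 0\<bar>
       + \<bar>ddiff (avgpoly a b) y 2 0\<bar> * (\<bar>z - y 0\<bar> * \<bar>z - y 1\<bar>) + \<bar>ddiff (avgpoly a b) y 3 0\<bar> * (\<bar>z - y 0\<bar> * \<bar>z - y 1\<bar> * \<bar>z - y 2\<bar>)"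
      by (simp only: abs_mult[symmetric])
    also have "\<dots> \<le> T + T * Qz + T * (Qz * Qz) + T * (Qz * Qz * Qz)"
      using Qz T by (intro add_mono mult_mono zy pb[folded T_def]) auto
    also have "\<dots> \<le> 4 * (T * Qz ^ 3)"
    proof -
      have "1 \<le> Qz ^ 3" "Qz ^ 1 \<le> Qz ^ 3" "Qz ^ 2 \<le> Qz ^ 3" 
        by (rule one_le_power[OF Qz], (rule power_increasing; use Qz in simp)+)
      then have "T * 1 \<le> T * Qz ^ 3" "T * Qz ^ 1 \<le> T * Qz ^ 3" "T * Qz ^ 2 \<le> T * Qz ^ 3"
        by (intro mult_left_mono T; simp)+
      then show ?thesis by (simp add: power2_eq_square power3_eq_cube mult_ac)
    qed
    also have "\<dots> = P * \<bar>\<epsilon>\<bar>" by (simp add: T_def P_def)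
    also have "\<dots> < \<bar>avgpoly a b z\<bar>" using \<epsilon>(2) P by (simp add: field_simps)
    finally show False by simp
  qed simp
qed

end

section \<open>Periodic orbits and periodic solutions\<close>

lemma antiderivative_exists:
  fixes h :: "real \<Rightarrow> real"
  assumes "continuous_on UNIV h"
  obtains H where "\<And>t. (H has_real_derivative h t) (at t)" "H 0 = c"
proof -
  have "isCont h x" for x using assms by (simp add: continuous_on_eq_continuous_at)
  then obtain F where F: "\<And>x. (F has_vector_derivative h x) (at x)"
    using einterval_antiderivative[of "-\<infinity>" "\<infinity>" h] by auto
  show ?thesis
  proof (rule that[of "\<lambda>t. F t - F 0 + c"])
    show "((\<lambda>t. F t - F 0 + c) has_real_derivative h t) (at t)" for t
      using F[of t] by (auto intro!: derivative_eq_intros simp: has_real_derivative_iff_has_vector_derivative[symmetric])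
  qed simp
qed

text \<open>The positive lower bound on the derivative forces at least linear growth in both
  directions, hence surjectivity. It serves to exchange time and polar angle, once in each
  direction.\<close>

lemma increasing_inverse_exists:
  fixes G g :: "real \<Rightarrow> real"
  assumes der: "\<And>t. (G has_real_derivative g t) (at t)" and c: "0 < c" "\<And>t. c \<le> g t"
  obtains H where "\<And>t. H (G t) = t" "\<And>s. G (H s) = s" "\<And>s. (H has_real_derivative 1 / g (H s)) (at s)"
proof -
  have cont: "isCont G t" for t using der by (rule DERIV_isCont)
  have grow: "G s + c * (t - s) \<le> G t" if "s \<le> t" for s t
  proof -
    have "G s - c * s \<le> G t - c * t"
    proof (rule DERIV_nonneg_imp_nondecreasing[OF that])
      show "\<exists>y. ((\<lambda>t. G t - c * t) has_real_derivative y) (at x) \<and> 0 \<le> y" for x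
        by (intro exI[of _ "g x - c * 1"] conjI DERIV_diff der DERIV_cmult DERIV_ident) (use c in simp)
    qed
    then show ?thesis by (simp add: algebra_simps)
  qed
  have inj: "s = t" if "G s = G t" for s t
  proof -
    have "c * (t - s) \<le> 0" if "s \<le> t" "G s = G t" for s t using grow[OF that(1)] that by simp
    then show ?thesis using that c by (metis linorder_linear mult_le_0_iff eq_iff diff_le_0_iff_le not_less)
  qed
  have surj: "\<exists>t. G t = s" for s
  proof -
    define d where "d = \<bar>s - G 0\<bar> / c"
    have d: "0 \<le> d" "c * d = \<bar>s - G 0\<bar>" using c by (auto simp: d_def)
    have "G (- d) \<le> s" "s \<le> G d" using grow[of "- d" 0] grow[of 0 d] d by auto
    then show ?thesis using IVT[of G "- d" s d] d cont by auto
  qed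
  define H where "H = inv G"
  have HG: "H (G t) = t" for t unfolding H_def by (rule inv_f_f) (use inj in \<open>auto intro: injI\<close>)
  have GH: "G (H s) = s" for s unfolding H_def by (rule f_inv_into_f) (use surj[of s] in auto)
  have Hcont: "isCont H s" for s
  proof -
    have "isCont H (G (H s))"
      by (rule isCont_inverse_function2[of "H s - 1" _ "H s + 1"]) (use HG cont in auto)
    then show ?thesis by (simp add: GH)
  qed
  show ?thesis
  proof (rule that[OF HG GH])
    fix s
    have "g (H s) \<noteq> 0" using c(1) c(2)[of "H s"] by auto
    then have "(H has_real_derivative inverse (g (H s))) (at s)"
      by (intro DERIV_inverse_function[where f = G and g = H and a = "s - 1" and b = "s + 1"]) (use der GH Hcont in auto)
    then show "(H has_real_derivative 1 / g (H s)) (at s)" by (simp add: divide_inverse)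
  qed
qed

lemma periodic_int:
  fixes f :: "real \<Rightarrow> 'a"
  assumes "\<And>t. f (t + p) = f t"
  shows "f (t + p * of_int k) = f t"
proof -
  have nat: "f (t + p * real n) = f t" for n :: nat and t
  proof (induction n)
    case (Suc n)
    show ?case using assms[of "t + p * real n"] Suc by (simp add: algebra_simps)
  qed simp
  show ?thesis
  proof (cases "0 \<le> k")
    case True
    then show ?thesis using nat[of t "nat k"] by simp
  next
    case False
    then show ?thesis using nat[of "t + p * of_int k" "nat (- k)"] by (simp add: algebra_simps)
  qed
qed

lemma periodic_reduce:
  fixes f :: "real \<Rightarrow> 'a"
  assumes "\<And>t. f (t + 2 * pi) = f t"
  obtains s where "s \<in> {0..2*pi}" "f t = f s"
proof -
  define k where "k = \<lfloor>t / (2 * pi)\<rfloor>"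
  have "of_int k \<le> t / (2 * pi)" "t / (2 * pi) < of_int k + 1" unfolding k_def by linarith+
  then have "2 * pi * of_int k \<le> t" "t < 2 * pi * of_int k + 2 * pi"
    using pi_gt_zero by (simp_all add: field_simps)
  moreover have "f t = f (t - 2 * pi * of_int k)"
    using periodic_int[of f "2 * pi" "t - 2 * pi * of_int k" k] assms by simp
  ultimately show ?thesis using that[of "t - 2 * pi * of_int k"] by auto
qed

lemma polar_field:
  assumes "0 < r" "rad w = r"
  shows "perturbed_field a b \<epsilon> (r * cos \<theta>, r * sin \<theta>) =
    (\<epsilon> * radial a b \<theta> r * cos \<theta> - omega a b \<epsilon> \<theta> w * (r * sin \<theta>),
     \<epsilon> * radial a b \<theta> r * sin \<theta> + omega a b \<epsilon> \<theta> w * (r * cos \<theta>))"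
proof -
  define A B where "A = cubic a (r * cos \<theta>) (r * sin \<theta>)" and "B = cubic b (r * cos \<theta>) (r * sin \<theta>)"
  define c s where "c = cos \<theta>" and "s = sin \<theta>"
  have cs: "s * s = 1 - c * c" using sin_cos_squared_add[of \<theta>] by (simp add: c_def s_def power2_eq_square)
  have om: "omega a b \<epsilon> \<theta> w * r = (r\<^sup>2 * c\<^sup>2 + 1) * r + \<epsilon> * (c * B - s * A)"
    using assms by (simp add: omega_def angular_def A_def B_def c_def s_def distrib_right)
  have "omega a b \<epsilon> \<theta> w * (r * s) = (omega a b \<epsilon> \<theta> w * r) * s" "omega a b \<epsilon> \<theta> w * (r * c) = (omega a b \<epsilon> \<theta> w * r) * c"
    by simp_all
  then have *: "omega a b \<epsilon> \<theta> w * (r * s) = ((r\<^sup>2 * c\<^sup>2 + 1) * r + \<epsilon> * (c * B - s * A)) * s"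
     "omega a b \<epsilon> \<theta> w * (r * c) = ((r\<^sup>2 * c\<^sup>2 + 1) * r + \<epsilon> * (c * B - s * A)) * c"
    unfolding om by auto
  have "\<epsilon> * (c * A + s * B) * c - ((r\<^sup>2 * c\<^sup>2 + 1) * r + \<epsilon> * (c * B - s * A)) * s
      = - (r * s) * ((r * c)\<^sup>2 + 1) + \<epsilon> * A * (c * c + s * s)"
    by (simp add: algebra_simps power2_eq_square)
  moreover have "\<epsilon> * (c * A + s * B) * s + ((r\<^sup>2 * c\<^sup>2 + 1) * r + \<epsilon> * (c * B - s * A)) * c
      = r * c * ((r * c)\<^sup>2 + 1) + \<epsilon> * B * (c * c + s * s)"
    by (simp add: algebra_simps power2_eq_square)
  ultimately show ?thesis
    unfolding perturbed_field_def radial_def prod.case A_def[symmetric] B_def[symmetric]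
    unfolding c_def[symmetric] s_def[symmetric] *
    by (simp add: cs)
qed

definition curve :: "(real \<Rightarrow> real) \<Rightarrow> (real \<times> real) set" where
  "curve W = range (\<lambda>\<phi>. (rad (W \<phi>) * cos \<phi>, rad (W \<phi>) * sin \<phi>))"

lemma curve_point:
  assumes "1 < W \<phi>"
  shows "sqrt (1 + ((rad (W \<phi>) * cos \<phi>)\<^sup>2 + (rad (W \<phi>) * sin \<phi>)\<^sup>2)) = W \<phi>"
proof -
  have "(rad (W \<phi>) * cos \<phi>)\<^sup>2 + (rad (W \<phi>) * sin \<phi>)\<^sup>2 = (rad (W \<phi>))\<^sup>2 * ((cos \<phi>)\<^sup>2 + (sin \<phi>)\<^sup>2)"
    by (simp only: power_mult_distrib distrib_left)
  also have "\<dots> = (W \<phi>)\<^sup>2 - 1" using assms by (simp add: rad_sq)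
  finally show ?thesis using assms by simp
qed

lemma curves_meet:
  assumes "\<And>\<phi>. 1 < W \<phi>" "\<And>\<phi>. 1 < V \<phi>" "\<And>\<phi>. V (\<phi> + 2 * pi) = V \<phi>" "curve W \<inter> curve V \<noteq> {}"
  obtains \<phi> where "W \<phi> = V \<phi>"
proof -
  obtain \<phi> \<psi> where eq: "rad (W \<phi>) * cos \<phi> = rad (V \<psi>) * cos \<psi>" "rad (W \<phi>) * sin \<phi> = rad (V \<psi>) * sin \<psi>"
    using assms(4) by (auto simp: curve_def)
  have WV: "W \<phi> = V \<psi>"
    using curve_point[of W \<phi>] curve_point[of V \<psi>] assms(1,2) eq by metis
  then have "cos \<phi> = cos \<psi>" "sin \<phi> = sin \<psi>" using eq rad_pos[OF assms(2), of \<psi>] by auto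
  then obtain n :: int where "\<phi> = \<psi> + 2 * pi * n" using sin_cos_eq_iff by metis
  then have "V \<phi> = V \<psi>" using periodic_int[of V "2 * pi" \<psi> n] assms(3) by simp
  then show ?thesis by (intro that[of \<phi>]) (simp add: WV)
qed

section \<open>Correspondence between cycles of the polar equation and periodic orbits of the
  plane\<close>

context cubic_perturbation
begin

lemma cycle_gt1: "cycle \<epsilon> W \<Longrightarrow> 1 < W \<phi>"
  using solutionD(2)[of \<epsilon> W \<phi>] \<alpha> by (auto simp: cycle_def)

text \<open>A common point of the curves yields a common value at one angle, and uniqueness extends
  it to all angles.\<close>

lemma cycle_curve_inj:
  assumes "\<bar>\<epsilon>\<bar> \<le> e1" "cycle \<epsilon> W" "cycle \<epsilon> V" "curve W \<inter> curve V \<noteq> {}"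
  shows "W = V"
proof -
  obtain \<phi> where "W \<phi> = V \<phi>"
    using curves_meet[OF cycle_gt1[OF assms(2)] cycle_gt1[OF assms(3)] _ assms(4)] assms(3)
    unfolding cycle_def by blast
  then show ?thesis using solution_unique assms by (auto simp: cycle_def)
qed

text \<open>Time along the curve is the integral of the reciprocal angular velocity. Its inverse
  gives the angle as a function of time, and the period is the time of one turn.\<close>

lemma periodic_orbit_curve:
  assumes \<epsilon>: "\<bar>\<epsilon>\<bar> \<le> e1" and cyc: "cycle \<epsilon> W"
  shows "periodic_orbit (perturbed_field a b \<epsilon>) (curve W)"
proof -
  have sol: "solution \<epsilon> W" and per: "\<And>\<phi>. W (\<phi> + 2 * pi) = W \<phi>" using cyc by (auto simp: cycle_def)
  define om where "om \<phi> = omega a b \<epsilon> \<phi> (W \<phi>)" for \<phi>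
  have om_ge: "1 / 2 \<le> om \<phi>" for \<phi>
    unfolding om_def using solutionD(2)[OF sol, of \<phi>] by (intro omega_ge \<epsilon>) auto
  have om_per: "om (\<phi> + 2 * pi) = om \<phi>" for \<phi> by (simp add: om_def per omega_periodic)
  have om_cont: "continuous_on UNIV om"
    unfolding om_def using solutionD[OF sol] by (intro continuous_on_omega) auto
  \<comment> \<open>An upper bound for the angular velocity bounds \<open>1 / om\<close> below, so
    that \<open>\<tau>\<close> maps onto the whole line and the orbit exists for all times.\<close>
  obtain B where B: "0 < B" "\<And>\<phi>. om \<phi> \<le> B"
  proof -
    have "bounded (om ` {0..2*pi})"
      by (intro compact_imp_bounded compact_continuous_image continuous_on_subset[OF om_cont]) auto
    then obtain B where B: "0 < B" "\<And>\<phi>. \<phi> \<in> {0..2*pi} \<Longrightarrow> \<bar>om \<phi>\<bar> \<le> B"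
      unfolding bounded_pos by auto
    have "om \<phi> \<le> B" for \<phi>
    proof -
      obtain s where "s \<in> {0..2*pi}" "om \<phi> = om s" using periodic_reduce[of om \<phi>] om_per by blast
      then show ?thesis using B(2)[of s] by simp
    qed
    then show ?thesis using that B(1) by blast
  qed
  have inv_cont: "continuous_on UNIV (\<lambda>\<phi>. 1 / om \<phi>)"
    using om_ge by (intro continuous_on_divide continuous_on_const om_cont) (metis less_le_trans half_gt_zero zero_less_one less_irrefl)
  obtain \<tau> where \<tau>: "\<And>\<phi>. (\<tau> has_real_derivative 1 / om \<phi>) (at \<phi>)" "\<tau> 0 = 0"
    using antiderivative_exists[OF inv_cont] by metis
  have ge: "1 / B \<le> 1 / om \<phi>" for \<phi> using B(2)[of \<phi>] om_ge[of \<phi>] B(1) by (intro divide_left_mono) auto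
  obtain \<Phi> where \<Phi>: "\<And>t. \<Phi> (\<tau> t) = t" "\<And>s. \<tau> (\<Phi> s) = s" "\<And>s. (\<Phi> has_real_derivative 1 / (1 / om (\<Phi> s))) (at s)"
    using increasing_inverse_exists[OF \<tau>(1) _ ge] B(1) by (metis zero_less_divide_1_iff)
  define T where "T = \<tau> (2 * pi)"
  have \<tau>_per: "\<tau> (\<phi> + 2 * pi) = \<tau> \<phi> + T" for \<phi>
  proof -
    have "((\<lambda>\<phi>. \<tau> (\<phi> + 2 * pi) - \<tau> \<phi>) has_real_derivative 0) (at \<phi>)" for \<phi>
    proof -
      have "((\<lambda>\<phi>. \<tau> (\<phi> + 2 * pi) - \<tau> \<phi>) has_real_derivative 1 / om (\<phi> + 2 * pi) - 1 / om \<phi>) (at \<phi>)"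
        by (intro DERIV_diff DERIV_shift[THEN iffD1] \<tau>(1))
      then show ?thesis by (simp add: om_per)
    qed
    then have "\<tau> (\<phi> + 2 * pi) - \<tau> \<phi> = \<tau> (0 + 2 * pi) - \<tau> 0"
      using DERIV_isconst_all[of "\<lambda>\<phi>. \<tau> (\<phi> + 2 * pi) - \<tau> \<phi>"] by blast
    then show ?thesis by (simp add: T_def \<tau>(2))
  qed
  have Tpos: "0 < T"
  proof -
    have "\<tau> 0 < \<tau> (2 * pi)"
    proof (rule DERIV_pos_imp_increasing[of 0 "2 * pi" \<tau>])
      show "\<exists>y. (\<tau> has_real_derivative y) (at x) \<and> 0 < y" for x
        using \<tau>(1)[of x] om_ge[of x] by (intro exI[of _ "1 / om x"]) auto
    qed simp
    then show ?thesis by (simp add: T_def \<tau>(2))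
  qed
  have \<Phi>_per: "\<Phi> (t + T) = \<Phi> t + 2 * pi" for t
    using \<tau>_per[of "\<Phi> t"] \<Phi> by metis
  define R where "R \<phi> = rad (W \<phi>)" for \<phi>
  have Rpos: "R \<phi> > 0" for \<phi> using cycle_gt1[OF cyc] by (simp add: R_def rad_pos)
  have Rder: "(R has_real_derivative \<epsilon> * radial a b \<phi> (R \<phi>) / om \<phi>) (at \<phi>)" for \<phi>
  proof -
    have w: "1 < (W \<phi>)\<^sup>2" "0 < W \<phi>" using cycle_gt1[OF cyc, of \<phi>] by (simp_all add: one_less_power)
    have "(R has_real_derivative (\<epsilon> * rhs a b \<epsilon> \<phi> (W \<phi>) * (2 * W \<phi>)) / (2 * R \<phi>)) (at \<phi>)"
      unfolding R_def rad_def
      by (rule derivative_eq_intros solutionD(1)[OF sol] refl | use w in \<open>simp add: field_simps\<close>)+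
    also have "(\<epsilon> * rhs a b \<epsilon> \<phi> (W \<phi>) * (2 * W \<phi>)) / (2 * R \<phi>) = \<epsilon> * radial a b \<phi> (R \<phi>) / om \<phi>"
      using w Rpos[of \<phi>] om_ge[of \<phi>] by (simp add: rhs_def om_def R_def)
    finally show ?thesis .
  qed
  define u where "u t = (R (\<Phi> t) * cos (\<Phi> t), R (\<Phi> t) * sin (\<Phi> t))" for t
  have "global_solution (perturbed_field a b \<epsilon>) u"
    unfolding global_solution_def
  proof
    fix t
    define \<phi> where "\<phi> = \<Phi> t"
    have omnz: "om \<phi> \<noteq> 0" using om_ge[of \<phi>] by auto
    have d\<Phi>: "(\<Phi> has_real_derivative om \<phi>) (at t)" using \<Phi>(3)[of t] by (simp add: \<phi>_def)
    have dR: "((\<lambda>t. R (\<Phi> t)) has_real_derivative \<epsilon> * radial a b \<phi> (R \<phi>)) (at t)"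
      using DERIV_chain2[OF Rder[of "\<Phi> t"] d\<Phi>] omnz by (simp add: \<phi>_def)
    have dx: "((\<lambda>t. R (\<Phi> t) * cos (\<Phi> t)) has_real_derivative
        \<epsilon> * radial a b \<phi> (R \<phi>) * cos \<phi> - om \<phi> * (R \<phi> * sin \<phi>)) (at t)"
      by (rule derivative_eq_intros dR d\<Phi> refl)+ (simp add: \<phi>_def)
    have dy: "((\<lambda>t. R (\<Phi> t) * sin (\<Phi> t)) has_real_derivative
        \<epsilon> * radial a b \<phi> (R \<phi>) * sin \<phi> + om \<phi> * (R \<phi> * cos \<phi>)) (at t)"
      by (rule derivative_eq_intros dR d\<Phi> refl)+ (simp add: \<phi>_def)
    have "perturbed_field a b \<epsilon> (u t) = (\<epsilon> * radial a b \<phi> (R \<phi>) * cos \<phi> - om \<phi> * (R \<phi> * sin \<phi>),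
        \<epsilon> * radial a b \<phi> (R \<phi>) * sin \<phi> + om \<phi> * (R \<phi> * cos \<phi>))"
      unfolding u_def \<phi>_def[symmetric] om_def by (rule polar_field[OF Rpos]) (simp add: R_def)
    then show "(u has_vector_derivative perturbed_field a b \<epsilon> (u t)) (at t)"
      unfolding u_def[abs_def] using dx dy
      by (simp add: has_vector_derivative_Pair has_real_derivative_iff_has_vector_derivative)
  qed
  moreover have "u (t + T) = u t" for t by (simp add: u_def \<Phi>_per R_def per)
  \<comment> \<open>The points at the angles 0 and \<open>pi\<close> lie on opposite sides of the
    origin.\<close>
  moreover have "\<not> u constant_on UNIV"
  proof
    assume "u constant_on UNIV"
    then have "u (\<tau> 0) = u (\<tau> pi)" by (auto simp: constant_on_def)
    then have "R 0 = - R pi" by (simp add: u_def \<Phi>(1))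
    then show False using Rpos[of 0] Rpos[of pi] by simp
  qed
  moreover have "curve W = range u"
  proof -
    have "range \<Phi> = UNIV" using \<Phi>(1) by (metis surjI)
    have "range u = (\<lambda>\<phi>. (R \<phi> * cos \<phi>, R \<phi> * sin \<phi>)) ` range \<Phi>"
      unfolding image_image by (rule image_cong[OF refl u_def])
    then show ?thesis using \<open>range \<Phi> = UNIV\<close> by (simp add: curve_def R_def)
  qed
  ultimately show ?thesis unfolding periodic_orbit_def using Tpos by blast
qed

lemma solution_shift:
  assumes "solution \<epsilon> W"
  shows "solution \<epsilon> (\<lambda>\<phi>. W (\<phi> + 2 * pi))"
  unfolding solution_def
proof (intro conjI allI)
  fix \<phi>
  show "((\<lambda>\<phi>. W (\<phi> + 2 * pi)) has_real_derivative \<epsilon> * rhs a b \<epsilon> \<phi> (W (\<phi> + 2 * pi))) (at \<phi>)"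
    using solutionD(1)[OF assms, of "\<phi> + 2 * pi"] by (simp add: DERIV_shift rhs_periodic)
qed (use solutionD(2)[OF assms] in simp)

text \<open>In dimension one the Poincare map is increasing, so a subharmonic solution is harmonic.\<close>

lemma subharmonic_cycle:
  assumes \<epsilon>: "\<bar>\<epsilon>\<bar> \<le> e1" and sol: "solution \<epsilon> W" and k: "0 < k" and per: "W (2 * pi * real k) = W 0"
  shows "cycle \<epsilon> W"
proof -
  note sh = solution_shift[OF sol]
  have "W (0 + 2 * pi) = W 0"
  proof (rule ccontr)
    assume "W (0 + 2 * pi) \<noteq> W 0"
    then consider "W 0 < W (0 + 2 * pi)" | "W (0 + 2 * pi) < W 0" by linarith
    then show False
    proof cases
      case 1
      have "W 0 < W (2 * pi * real (Suc n))" for n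
      proof (induction n)
        case (Suc n)
        also have "W (2 * pi * real (Suc n)) < W (2 * pi * real (Suc n) + 2 * pi)"
          by (rule solution_less[OF \<epsilon> sol sh 1])
        finally show ?case by (simp add: algebra_simps)
      qed (use 1 in simp)
      from this[of "k - 1"] show False using k per by simp
    next
      case 2
      have "W (2 * pi * real (Suc n)) < W 0" for n
      proof (induction n)
        case (Suc n)
        have "W (2 * pi * real (Suc n) + 2 * pi) < W (2 * pi * real (Suc n))"
          by (rule solution_less[OF \<epsilon> sh sol 2])
        also note Suc
        finally show ?case by (simp add: algebra_simps)
      qed (use 2 in simp)
      from this[of "k - 1"] show False using k per by simp
    qed
  qed
  then have "W = (\<lambda>\<phi>. W (\<phi> + 2 * pi))"
    by (intro solution_unique[OF \<epsilon> sol sh, of 0]) simp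
  then show ?thesis using sol unfolding cycle_def by (metis)
qed

text \<open>Along an orbit in the closed annulus a continuous polar angle increases at rate at least
  1/2 and can replace time. After one period the angle has grown by \<open>2 * pi * k\<close> with
  positive \<open>k\<close>, so the resulting solution is at first only subharmonic;
  \<open>subharmonic_cycle\<close> reduces it to a cycle.\<close>

lemma periodic_orbit_imp_curve:
  assumes \<epsilon>: "\<bar>\<epsilon>\<bar> \<le> e1" and orb: "periodic_orbit (perturbed_field a b \<epsilon>) C"
    and sub: "\<And>x y. (x, y) \<in> C \<Longrightarrow> sqrt (1 + (x\<^sup>2 + y\<^sup>2)) \<in> {\<alpha>..\<beta>}"
  obtains W where "cycle \<epsilon> W" "C = curve W"
proof -
  obtain u T where gs: "global_solution (perturbed_field a b \<epsilon>) u" and T: "T > 0" and uper: "\<And>t. u (t + T) = u t"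
    and C: "C = range u"
    using orb unfolding periodic_orbit_def by blast
  define x where "x t = fst (u t)" for t
  define y where "y t = snd (u t)" for t
  have u_eq: "u t = (x t, y t)" for t by (simp add: x_def y_def)
  define X where "X t = fst (perturbed_field a b \<epsilon> (x t, y t))" for t
  define Y where "Y t = snd (perturbed_field a b \<epsilon> (x t, y t))" for t
  have du: "(u has_vector_derivative perturbed_field a b \<epsilon> (x t, y t)) (at t)" for t
    using gs unfolding global_solution_def u_eq by blast
  have dx: "(x has_real_derivative X t) (at t)" for t
    using bounded_linear.has_vector_derivative[OF bounded_linear_fst du[of t]]
    unfolding has_real_derivative_iff_has_vector_derivative x_def[abs_def] X_def .
  have dy: "(y has_real_derivative Y t) (at t)" for t
    using bounded_linear.has_vector_derivative[OF bounded_linear_snd du[of t]]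
    unfolding has_real_derivative_iff_has_vector_derivative y_def[abs_def] Y_def .
  have cx: "continuous_on UNIV x" and cy: "continuous_on UNIV y"
    using DERIV_isCont[OF dx] DERIV_isCont[OF dy] by (auto intro: continuous_at_imp_continuous_on)
  define w where "w t = sqrt (1 + ((x t)\<^sup>2 + (y t)\<^sup>2))" for t
  have w_in: "w t \<in> {\<alpha>..\<beta>}" for t unfolding w_def by (rule sub) (auto simp: C u_eq[symmetric])
  define q where "q t = (x t)\<^sup>2 + (y t)\<^sup>2" for t
  have qpos: "0 < q t" for t
  proof -
    have "1 < w t" using w_in[of t] \<alpha> by auto
    then show ?thesis by (simp add: w_def q_def)
  qed
  define r where "r t = sqrt (q t)" for t
  have rpos: "0 < r t" for t using qpos by (simp add: r_def)
  have r2: "(r t)\<^sup>2 = q t" for t using qpos[of t] by (simp add: r_def)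
  have rad_w: "rad (w t) = r t" for t
    unfolding rad_def w_def r_def q_def[symmetric] using qpos[of t] by simp
  \<comment> \<open>\<omega> is the angular velocity and \<mu> the logarithmic growth rate of the
    radius: the velocity is \<mu> times the position plus \<omega> times the position turned by a
    right angle.\<close>
  define \<omega> where "\<omega> t = (x t * Y t - y t * X t) / q t" for t
  define \<mu> where "\<mu> t = (x t * X t + y t * Y t) / q t" for t
  have X_eq: "X t = \<mu> t * x t - \<omega> t * y t" and Y_eq: "Y t = \<mu> t * y t + \<omega> t * x t" for t
  proof -
    have "\<mu> t * x t - \<omega> t * y t = X t * q t / q t" "\<mu> t * y t + \<omega> t * x t = Y t * q t / q t"
      unfolding \<mu>_def \<omega>_def times_divide_eq_left diff_divide_distrib[symmetric] add_divide_distrib[symmetric]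
      by (simp_all add: q_def algebra_simps power2_eq_square)
    then show "X t = \<mu> t * x t - \<omega> t * y t" "Y t = \<mu> t * y t + \<omega> t * x t" using qpos[of t] by simp_all
  qed
  have cX: "continuous_on UNIV X" "continuous_on UNIV Y"
    unfolding X_def Y_def perturbed_field_def prod.case fst_conv snd_conv cubic_def
    by (intro continuous_intros cx cy)+
  have c\<omega>: "continuous_on UNIV \<omega>"
    unfolding \<omega>_def q_def by (intro continuous_intros cx cy cX) (use qpos in \<open>auto simp: q_def less_le\<close>)
  obtain \<theta>0 where \<theta>0: "x 0 / r 0 = cos \<theta>0" "y 0 / r 0 = sin \<theta>0"
  proof -
    have "(x 0 / r 0)\<^sup>2 + (y 0 / r 0)\<^sup>2 = 1"
      using qpos[of 0] by (simp add: power_divide r2 add_divide_distrib[symmetric] q_def[symmetric])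
    then show ?thesis using sincos_total_2pi that by metis
  qed
  \<comment> \<open>Integrating the angular velocity from one initial angle gives a continuous lift
    of the polar angle with no choice of branches.\<close>
  obtain \<Theta> where \<Theta>: "\<And>t. (\<Theta> has_real_derivative \<omega> t) (at t)" "\<Theta> 0 = \<theta>0"
    using antiderivative_exists[OF c\<omega>] by metis
  have dr: "(r has_real_derivative \<mu> t * r t) (at t)" for t
  proof -
    have "(q has_real_derivative 2 * x t * X t + 2 * y t * Y t) (at t)"
      unfolding q_def by (rule derivative_eq_intros dx dy refl)+ simp
    from DERIV_chain2[OF DERIV_real_sqrt[OF qpos] this]
    have "(r has_real_derivative inverse (sqrt (q t)) / 2 * (2 * x t * X t + 2 * y t * Y t)) (at t)"
      unfolding r_def .
    also have "inverse (sqrt (q t)) / 2 * (2 * x t * X t + 2 * y t * Y t) = \<mu> t * r t"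
      unfolding \<mu>_def r2[symmetric] r_def[symmetric] using rpos[of t] by (simp add: field_simps power2_eq_square)
    finally show ?thesis .
  qed
  \<comment> \<open>The two quotients are the cosine and the sine of the true polar angle minus
    \<open>\<Theta>\<close>. They are constant and start at 1 and 0, so \<open>\<Theta>\<close> is a
    polar angle at all times.\<close>
  have dA: "((\<lambda>t. (x t * cos (\<Theta> t) + y t * sin (\<Theta> t)) / r t) has_real_derivative 0) (at t)"
    and dB: "((\<lambda>t. (y t * cos (\<Theta> t) - x t * sin (\<Theta> t)) / r t) has_real_derivative 0) (at t)" for t
  proof -
    have rnz: "r t \<noteq> 0" using rpos[of t] by simp
    have "((\<lambda>t. x t * cos (\<Theta> t) + y t * sin (\<Theta> t)) has_real_derivative \<mu> t * (x t * cos (\<Theta> t) + y t * sin (\<Theta> t))) (at t)"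
      by (rule derivative_eq_intros dx dy \<Theta>(1) refl)+ (simp add: X_eq Y_eq algebra_simps)
    from DERIV_divide[OF this dr rnz]
    show "((\<lambda>t. (x t * cos (\<Theta> t) + y t * sin (\<Theta> t)) / r t) has_real_derivative 0) (at t)" by simp
    have "((\<lambda>t. y t * cos (\<Theta> t) - x t * sin (\<Theta> t)) has_real_derivative \<mu> t * (y t * cos (\<Theta> t) - x t * sin (\<Theta> t))) (at t)"
      by (rule derivative_eq_intros dx dy \<Theta>(1) refl)+ (simp add: X_eq Y_eq algebra_simps)
    from DERIV_divide[OF this dr rnz]
    show "((\<lambda>t. (y t * cos (\<Theta> t) - x t * sin (\<Theta> t)) / r t) has_real_derivative 0) (at t)" by simp
  qed
  have pol: "x t = r t * cos (\<Theta> t)" "y t = r t * sin (\<Theta> t)" for t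
  proof -
    have "(x t * cos (\<Theta> t) + y t * sin (\<Theta> t)) / r t = (x 0 * cos (\<Theta> 0) + y 0 * sin (\<Theta> 0)) / r 0"
      using DERIV_isconst_all[of "\<lambda>t. (x t * cos (\<Theta> t) + y t * sin (\<Theta> t)) / r t"] dA by blast
    also have "\<dots> = (x 0 / r 0) * cos \<theta>0 + (y 0 / r 0) * sin \<theta>0" by (simp add: \<Theta>(2) add_divide_distrib)
    also have "\<dots> = 1" unfolding \<theta>0 by (simp add: power2_eq_square[symmetric])
    finally have 1: "x t * cos (\<Theta> t) + y t * sin (\<Theta> t) = r t" using rpos[of t] by simp
    have "(y t * cos (\<Theta> t) - x t * sin (\<Theta> t)) / r t = (y 0 * cos (\<Theta> 0) - x 0 * sin (\<Theta> 0)) / r 0"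
      using DERIV_isconst_all[of "\<lambda>t. (y t * cos (\<Theta> t) - x t * sin (\<Theta> t)) / r t"] dB by blast
    also have "\<dots> = (y 0 / r 0) * cos \<theta>0 - (x 0 / r 0) * sin \<theta>0" by (simp add: \<Theta>(2) diff_divide_distrib)
    also have "\<dots> = 0" unfolding \<theta>0 by simp
    finally have 2: "y t * cos (\<Theta> t) - x t * sin (\<Theta> t) = 0" using rpos[of t] by simp
    have cs: "(cos (\<Theta> t))\<^sup>2 + (sin (\<Theta> t))\<^sup>2 = 1" by simp
    have rot: "a * (c\<^sup>2 + s\<^sup>2) = (a * c + b * s) * c - (b * c - a * s) * s"
      "b * (c\<^sup>2 + s\<^sup>2) = (a * c + b * s) * s + (b * c - a * s) * c" for a b c s :: real
      by (simp_all add: algebra_simps power2_eq_square)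
    have "x t * ((cos (\<Theta> t))\<^sup>2 + (sin (\<Theta> t))\<^sup>2) = (x t * cos (\<Theta> t) + y t * sin (\<Theta> t)) * cos (\<Theta> t) - (y t * cos (\<Theta> t) - x t * sin (\<Theta> t)) * sin (\<Theta> t)"
      by (rule rot(1))
    then show "x t = r t * cos (\<Theta> t)" unfolding cs 1 2 by simp
    have "y t * ((cos (\<Theta> t))\<^sup>2 + (sin (\<Theta> t))\<^sup>2) = (x t * cos (\<Theta> t) + y t * sin (\<Theta> t)) * sin (\<Theta> t) + (y t * cos (\<Theta> t) - x t * sin (\<Theta> t)) * cos (\<Theta> t)"
      by (rule rot(2))
    then show "y t = r t * sin (\<Theta> t)" unfolding cs 1 2 by simp
  qed
  have field: "X t = \<epsilon> * radial a b (\<Theta> t) (r t) * cos (\<Theta> t) - omega a b \<epsilon> (\<Theta> t) (w t) * y t"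
    "Y t = \<epsilon> * radial a b (\<Theta> t) (r t) * sin (\<Theta> t) + omega a b \<epsilon> (\<Theta> t) (w t) * x t" for t
    using polar_field[OF rpos[of t] rad_w[of t], of a b \<epsilon> "\<Theta> t"]
    unfolding pol(1)[symmetric] pol(2)[symmetric] by (simp_all add: X_def Y_def)
  have trig: "x t * cos (\<Theta> t) + y t * sin (\<Theta> t) = r t" "x t * sin (\<Theta> t) = y t * cos (\<Theta> t)" for t
  proof -
    have "x t * cos (\<Theta> t) + y t * sin (\<Theta> t) = r t * ((cos (\<Theta> t))\<^sup>2 + (sin (\<Theta> t))\<^sup>2)"
      unfolding pol power2_eq_square distrib_left by simp
    then show "x t * cos (\<Theta> t) + y t * sin (\<Theta> t) = r t" by simp
    show "x t * sin (\<Theta> t) = y t * cos (\<Theta> t)" unfolding pol by simp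
  qed
  have \<omega>_eq: "\<omega> t = omega a b \<epsilon> (\<Theta> t) (w t)" for t
  proof -
    have "x t * Y t - y t * X t = \<epsilon> * radial a b (\<Theta> t) (r t) * (x t * sin (\<Theta> t) - y t * cos (\<Theta> t)) + omega a b \<epsilon> (\<Theta> t) (w t) * q t"
      unfolding field q_def by (simp add: algebra_simps power2_eq_square)
    then show ?thesis using qpos[of t] trig(2)[of t] by (simp add: \<omega>_def)
  qed
  have xXyY: "x t * X t + y t * Y t = \<epsilon> * radial a b (\<Theta> t) (r t) * r t" for t
  proof -
    have "x t * X t + y t * Y t = \<epsilon> * radial a b (\<Theta> t) (r t) * (x t * cos (\<Theta> t) + y t * sin (\<Theta> t))"
      unfolding field by (simp add: algebra_simps)
    then show ?thesis unfolding trig(1) .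
  qed
  have \<omega>_ge: "1 / 2 \<le> \<omega> t" for t unfolding \<omega>_eq using w_in[of t] by (intro omega_ge \<epsilon>) auto
  obtain \<tau> where \<tau>: "\<And>t. \<tau> (\<Theta> t) = t" "\<And>s. \<Theta> (\<tau> s) = s" "\<And>s. (\<tau> has_real_derivative 1 / \<omega> (\<tau> s)) (at s)"
    using increasing_inverse_exists[OF \<Theta>(1) _ \<omega>_ge] by (metis half_gt_zero zero_less_one)
  define W where "W \<phi> = w (\<tau> \<phi>)" for \<phi>
  have dw: "(w has_real_derivative \<epsilon> * radial a b (\<Theta> t) (r t) * r t / w t) (at t)" for t
  proof -
    have p: "0 < 1 + ((x t)\<^sup>2 + (y t)\<^sup>2)" using qpos[of t] by (simp add: q_def)
    have "((\<lambda>t. 1 + ((x t)\<^sup>2 + (y t)\<^sup>2)) has_real_derivative 2 * (x t * X t + y t * Y t)) (at t)"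
      by (rule derivative_eq_intros dx dy refl)+ simp
    then have "((\<lambda>t. sqrt (1 + ((x t)\<^sup>2 + (y t)\<^sup>2))) has_real_derivative inverse (w t) / 2 * (2 * (x t * X t + y t * Y t))) (at t)"
      unfolding w_def by (rule DERIV_chain2[where f = sqrt and g = "\<lambda>t. 1 + ((x t)\<^sup>2 + (y t)\<^sup>2)", OF DERIV_real_sqrt[OF p]])
    then have "(w has_real_derivative inverse (w t) / 2 * (2 * (x t * X t + y t * Y t))) (at t)"
      by (simp only: w_def[abs_def])
    moreover have "inverse (w t) / 2 * (2 * (x t * X t + y t * Y t)) = \<epsilon> * radial a b (\<Theta> t) (r t) * r t / w t"
    proof -
      have "inverse c / 2 * (2 * d) = d / c" for c d :: real by (simp add: field_simps)
      then show ?thesis unfolding xXyY .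
    qed
    ultimately show ?thesis by (rule subst[rotated])
  qed
  have sol: "solution \<epsilon> W"
    unfolding solution_def
  proof (intro conjI allI)
    fix \<phi>
    show "W \<phi> \<in> {\<alpha>..\<beta>}" unfolding W_def by (rule w_in)
    have "(W has_real_derivative \<epsilon> * radial a b (\<Theta> (\<tau> \<phi>)) (r (\<tau> \<phi>)) * r (\<tau> \<phi>) / w (\<tau> \<phi>) * (1 / \<omega> (\<tau> \<phi>))) (at \<phi>)"
      unfolding W_def by (rule DERIV_chain2[OF dw \<tau>(3)])
    then show "(W has_real_derivative \<epsilon> * rhs a b \<epsilon> \<phi> (W \<phi>)) (at \<phi>)"
      by (simp add: rhs_def W_def rad_w \<omega>_eq \<tau>(2) mult_ac)
  qed
  have xper: "x (t + T) = x t" "y (t + T) = y t" for t using uper by (simp_all add: x_def y_def)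
  define \<kappa> where "\<kappa> = \<Theta> T - \<Theta> 0"
  have \<Theta>_per: "\<Theta> (t + T) = \<Theta> t + \<kappa>" for t
  proof -
    have "((\<lambda>t. \<Theta> (t + T) - \<Theta> t) has_real_derivative 0) (at t)" for t
    proof -
      have "((\<lambda>t. \<Theta> (t + T) - \<Theta> t) has_real_derivative \<omega> (t + T) - \<omega> t) (at t)"
        by (intro DERIV_diff DERIV_shift[THEN iffD1] \<Theta>(1))
      then show ?thesis by (simp add: \<omega>_def q_def X_def Y_def xper)
    qed
    then have "\<Theta> (t + T) - \<Theta> t = \<Theta> (0 + T) - \<Theta> 0"
      using DERIV_isconst_all[of "\<lambda>t. \<Theta> (t + T) - \<Theta> t"] by blast
    then show ?thesis by (simp add: \<kappa>_def)
  qed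
  have "\<Theta> 0 < \<Theta> T"
  proof (rule DERIV_pos_imp_increasing[OF T, of \<Theta>])
    show "\<exists>d. (\<Theta> has_real_derivative d) (at t) \<and> 0 < d" for t
      using \<Theta>(1)[of t] \<omega>_ge[of t] by (intro exI[of _ "\<omega> t"]) auto
  qed
  have rT: "r T = r 0" using xper[of 0] by (simp add: r_def q_def)
  have "cos (\<Theta> T) = cos (\<Theta> 0)" "sin (\<Theta> T) = sin (\<Theta> 0)"
    using pol[of T] pol[of 0] xper[of 0] rT rpos[of 0] by auto
  then obtain n :: int where n: "\<Theta> T = \<Theta> 0 + 2 * pi * n" using sin_cos_eq_iff by metis
  then have "0 < 2 * pi * real_of_int n" using \<open>\<Theta> 0 < \<Theta> T\<close> by simp
  then have npos: "0 < n" by (simp add: zero_less_mult_iff)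
  define k where "k = nat n"
  have k: "0 < k" "\<kappa> = 2 * pi * real k" using npos n by (simp_all add: k_def \<kappa>_def)
  have "\<tau> (0 + \<kappa>) = \<tau> 0 + T" using \<Theta>_per[of "\<tau> 0"] \<tau> by metis
  then have "W (2 * pi * real k) = W 0" unfolding k(2)[symmetric] by (simp add: W_def w_def xper)
  from subharmonic_cycle[OF \<epsilon> sol k(1) this] have cyc: "cycle \<epsilon> W" .
  moreover have "C = curve W"
  proof -
    have "range \<Theta> = UNIV" using \<tau>(2) by (metis surjI)
    have "u t = (rad (W (\<Theta> t)) * cos (\<Theta> t), rad (W (\<Theta> t)) * sin (\<Theta> t))" for t
      by (simp add: u_eq W_def \<tau>(1) rad_w pol[symmetric])
    then have "range u = (\<lambda>\<phi>. (rad (W \<phi>) * cos \<phi>, rad (W \<phi>) * sin \<phi>)) ` range \<Theta>"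
      unfolding image_image by (rule image_cong[OF refl])
    then show ?thesis unfolding C curve_def \<open>range \<Theta> = UNIV\<close> .
  qed
  ultimately show ?thesis by (rule that)
qed

end

section \<open>Existence of periodic solutions\<close>

text \<open>The Lipschitz condition is imposed on the whole line, so that the fixed point argument
  needs no control of the range of the functions involved.\<close>

locale periodic_field =
  fixes h :: "real \<Rightarrow> real \<Rightarrow> real" and L :: real
  assumes cont: "\<And>W. continuous_on UNIV W \<Longrightarrow> continuous_on UNIV (\<lambda>t. h t (W t))"
    and periodic: "\<And>t v. h (t + 2 * pi) v = h t v"
    and lipschitz: "\<And>t v v'. \<bar>h t v - h t v'\<bar> \<le> L * \<bar>v - v'\<bar>"
    and L_pos: "0 < L"
begin

definition mean :: "(real \<Rightarrow> real) \<Rightarrow> real" where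
  "mean W = integral {0..2*pi} (\<lambda>t. h t (W t)) / (2 * pi)"

text \<open>Subtracting the mean keeps the right-hand side compatible with periodicity; the genuine
  periodic solutions are those with vanishing mean (Lyapunov-Schmidt reduction).\<close>

definition reduced :: "real \<Rightarrow> (real \<Rightarrow> real) \<Rightarrow> bool" where
  "reduced \<epsilon> W \<longleftrightarrow> (\<forall>t. (W has_real_derivative \<epsilon> * (h t (W t) - mean W)) (at t)) \<and> (\<forall>t. W (t + 2 * pi) = W t)"

lemma reducedD:
  assumes "reduced \<epsilon> W"
  shows "(W has_real_derivative \<epsilon> * (h t (W t) - mean W)) (at t)" "W (t + 2 * pi) = W t" "continuous_on UNIV W"
proof -
  show der: "(W has_real_derivative \<epsilon> * (h t (W t) - mean W)) (at t)" for t
    using assms by (simp add: reduced_def)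
  show "W (t + 2 * pi) = W t" using assms by (simp add: reduced_def)
  show "continuous_on UNIV W"
    by (rule continuous_at_imp_continuous_on) (use DERIV_isCont[OF der] in simp)
qed

lemma has_integral_mean:
  assumes "continuous_on UNIV W"
  shows "((\<lambda>t. h t (W t)) has_integral 2 * pi * mean W) {0..2*pi}"
proof -
  have "(\<lambda>t. h t (W t)) integrable_on {0..2*pi}"
    by (rule integrable_continuous_real, rule continuous_on_subset[OF cont[OF assms]]) simp
  then show ?thesis unfolding mean_def by (simp add: has_integral_integral)
qed

lemma mean_bound:
  assumes W: "continuous_on UNIV W" and g: "(g has_integral 2 * pi * c) {0..2*pi}"
    and B: "\<And>t. t \<in> {0..2*pi} \<Longrightarrow> \<bar>h t (W t) - g t\<bar> \<le> B"
  shows "\<bar>mean W - c\<bar> \<le> B"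
proof -
  have "((\<lambda>t. h t (W t) - g t) has_integral 2 * pi * mean W - 2 * pi * c) {0..2*pi}"
    by (rule has_integral_diff[OF has_integral_mean[OF W] g])
  moreover have "0 \<le> B" using B[of 0] by simp
  ultimately have "norm (2 * pi * mean W - 2 * pi * c) \<le> B * measure lborel {0..2*pi}"
    using B by (intro has_integral_bound_real[of B "{}"]) auto
  then have "2 * pi * \<bar>mean W - c\<bar> \<le> 2 * pi * B" by (simp add: right_diff_distrib[symmetric] abs_mult mult_ac)
  then show ?thesis by simp
qed

lemma mean_lipschitz:
  assumes "continuous_on UNIV W" "continuous_on UNIV V" "\<And>t. t \<in> {0..2*pi} \<Longrightarrow> \<bar>W t - V t\<bar> \<le> d"
  shows "\<bar>mean W - mean V\<bar> \<le> L * d"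
proof (rule mean_bound[OF assms(1) has_integral_mean[OF assms(2)]])
  fix t assume "t \<in> {0..2*pi}"
  then show "\<bar>h t (W t) - h t (V t)\<bar> \<le> L * d"
    using order_trans[OF lipschitz mult_left_mono[OF assms(3)]] L_pos by auto
qed

lemma centered_diff_bound:
  assumes "continuous_on UNIV W" "continuous_on UNIV V" "\<And>t. t \<in> {0..2*pi} \<Longrightarrow> \<bar>W t - V t\<bar> \<le> d" "t \<in> {0..2*pi}"
  shows "\<bar>\<epsilon> * (h t (W t) - mean W) - \<epsilon> * (h t (V t) - mean V)\<bar> \<le> \<bar>\<epsilon>\<bar> * (2 * L * d)"
proof -
  have "\<bar>h t (W t) - h t (V t)\<bar> \<le> L * d"
    using order_trans[OF lipschitz mult_left_mono[OF assms(3)]] L_pos assms(4) by auto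
  moreover note mean_lipschitz[OF assms(1-3)]
  ultimately have "\<bar>(h t (W t) - mean W) - (h t (V t) - mean V)\<bar> \<le> 2 * L * d" by linarith
  then have "\<bar>\<epsilon>\<bar> * \<bar>(h t (W t) - mean W) - (h t (V t) - mean V)\<bar> \<le> \<bar>\<epsilon>\<bar> * (2 * L * d)"
    by (intro mult_left_mono) auto
  then show ?thesis by (simp add: right_diff_distrib[symmetric] abs_mult)
qed

text \<open>The field and its mean each contribute \<open>L * d\<close>, integrated over at most one
  period; \<open>2 * pi * |\<epsilon>| * 2 * L * d <= d / 2\<close> is the origin of the constant
  8.\<close>

lemma contraction_estimate:
  assumes \<epsilon>: "8 * pi * L * \<bar>\<epsilon>\<bar> \<le> 1"
    and W: "continuous_on UNIV W" and V: "continuous_on UNIV V" and d: "\<And>t. t \<in> {0..2*pi} \<Longrightarrow> \<bar>W t - V t\<bar> \<le> d"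
    and P: "\<And>t. (P has_real_derivative \<epsilon> * (h t (W t) - mean W)) (at t)" "\<And>t. P (t + 2 * pi) = P t"
    and Q: "\<And>t. (Q has_real_derivative \<epsilon> * (h t (V t) - mean V)) (at t)" "\<And>t. Q (t + 2 * pi) = Q t"
  shows "\<bar>P t - Q t\<bar> \<le> \<bar>P 0 - Q 0\<bar> + d / 2"
proof -
  define D where "D t = P t - Q t" for t
  have "D (t + 2 * pi) = D t" for t by (simp add: D_def P(2) Q(2))
  then obtain s where s: "s \<in> {0..2*pi}" "D t = D s" using periodic_reduce[of D t] by blast
  have d0: "0 \<le> d" using d[of 0] by simp
  have "\<bar>D s - D 0\<bar> \<le> 2 * pi * (\<bar>\<epsilon>\<bar> * (2 * L * d))"
    by (rule derivative_bound_period[OF _ centered_diff_bound[OF W V d] s(1)])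
       (auto simp: D_def[abs_def] intro!: DERIV_diff P(1) Q(1))
  also have "\<dots> = (8 * pi * L * \<bar>\<epsilon>\<bar>) * (d / 2)" by simp
  also have "\<dots> \<le> 1 * (d / 2)" using \<epsilon> d0 by (intro mult_right_mono) auto
  finally have "\<bar>D t - D 0\<bar> \<le> d / 2" by (simp add: s(2))
  then show ?thesis unfolding D_def by linarith
qed

text \<open>Applied to the two solutions themselves, the estimate says that the supremum of their
  distance is at most the initial distance plus half that supremum. Periodicity lets the supremum be
  taken over one period, where it is attained.\<close>

lemma reduced_dist:
  assumes \<epsilon>: "8 * pi * L * \<bar>\<epsilon>\<bar> \<le> 1" and W: "reduced \<epsilon> W" and V: "reduced \<epsilon> V"
  shows "\<bar>W t - V t\<bar> \<le> 2 * \<bar>W 0 - V 0\<bar>"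
proof -
  have c: "continuous_on {0..2*pi} (\<lambda>t. \<bar>W t - V t\<bar>)"
    by (intro continuous_intros; rule continuous_on_subset[OF reducedD(3)]; use W V in blast)
  obtain s where s: "s \<in> {0..2*pi}" "\<And>t. t \<in> {0..2*pi} \<Longrightarrow> \<bar>W t - V t\<bar> \<le> \<bar>W s - V s\<bar>"
    using continuous_attains_sup[OF _ _ c] by auto
  have est: "\<bar>W t - V t\<bar> \<le> \<bar>W 0 - V 0\<bar> + \<bar>W s - V s\<bar> / 2" for t
    by (rule contraction_estimate[OF \<epsilon> reducedD(3)[OF W] reducedD(3)[OF V] s(2) reducedD(1,2)[OF W] reducedD(1,2)[OF V]])
  have "p \<le> 2 * A" if "x \<le> A + x / 2" "p \<le> A + x / 2" for p x A :: real using that by linarith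
  from this[OF est est] show ?thesis .
qed

definition periodic_space :: "(real \<Rightarrow>\<^sub>C real) set" where
  "periodic_space = {W :: real \<Rightarrow>\<^sub>C real. \<forall>t. W (t + 2 * pi) = W t}"

lemma complete_periodic_space: "complete periodic_space"
proof -
  have "closed periodic_space"
    unfolding closed_sequential_limits
  proof (intro allI impI)
    fix W :: "nat \<Rightarrow> real \<Rightarrow>\<^sub>C real" and l assume a: "(\<forall>n. W n \<in> periodic_space) \<and> W \<longlonglongrightarrow> l"
    have lim: "(\<lambda>n. W n t) \<longlonglongrightarrow> l t" for t
      by (rule metric_tendsto_imp_tendsto[of W l]) (use a in \<open>auto simp: dist_bounded\<close>)
    have "l (t + 2 * pi) = l t" for t
    proof (rule LIMSEQ_unique[OF lim])
      show "(\<lambda>n. W n (t + 2 * pi)) \<longlonglongrightarrow> l t"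
        using lim[of t] a by (simp add: periodic_space_def)
    qed
    then show "l \<in> periodic_space" by (simp add: periodic_space_def)
  qed
  then show ?thesis by (simp add: complete_eq_closed)
qed

text \<open>After the mean is subtracted the integral over one period vanishes, which is what a
  primitive of a periodic function needs in order to be periodic.\<close>

lemma periodic_primitive:
  assumes W: "continuous_on UNIV W" "\<And>t. W (t + 2 * pi) = W t"
  obtains P where "P 0 = \<rho>" "\<And>t. (P has_real_derivative \<epsilon> * (h t (W t) - mean W)) (at t)" "\<And>t. P (t + 2 * pi) = P t"
proof -
  define g where "g t = \<epsilon> * (h t (W t) - mean W)" for t
  have "continuous_on UNIV g" unfolding g_def by (intro continuous_intros cont W)
  then obtain P where P: "\<And>t. (P has_real_derivative g t) (at t)" "P 0 = \<rho>"
    using antiderivative_exists by metis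
  have i1: "(g has_integral P (2*pi) - P 0) {0..2*pi}"
    by (rule fundamental_theorem_of_calculus)
       (use P(1) in \<open>auto simp: has_real_derivative_iff_has_vector_derivative[symmetric] intro: has_field_derivative_at_within\<close>)
  have i2: "(g has_integral \<epsilon> * (2 * pi * mean W - (2 * pi - 0) * mean W)) {0..2*pi}"
    unfolding g_def
    by (intro has_integral_mult_right has_integral_diff has_integral_mean W)
       (use has_integral_const_real[of "mean W" 0 "2*pi"] in simp)
  from has_integral_unique[OF i1 i2] have P2: "P (2 * pi) = P 0" by simp
  have gper: "g (t + 2 * pi) = g t" for t by (simp add: g_def W(2) periodic)
  have "((\<lambda>t. P (t + 2 * pi) - P t) has_real_derivative 0) (at t)" for t
  proof -
    have "((\<lambda>t. P (t + 2 * pi) - P t) has_real_derivative g (t + 2 * pi) - g t) (at t)"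
      by (intro DERIV_diff DERIV_shift[THEN iffD1] P(1))
    then show ?thesis by (simp add: gper)
  qed
  then have "P (t + 2 * pi) - P t = P (0 + 2 * pi) - P 0" for t
    using DERIV_isconst_all[of "\<lambda>t. P (t + 2 * pi) - P t"] by blast
  then have "P (t + 2 * pi) = P t" for t by (simp add: P2)
  then show ?thesis using that[of P] P unfolding g_def by blast
qed

lemma periodic_bcontfun:
  fixes P :: "real \<Rightarrow> real"
  assumes "continuous_on UNIV P" "\<And>t. P (t + 2 * pi) = P t"
  shows "P \<in> bcontfun"
proof -
  have "range P \<subseteq> P ` {0..2*pi}" using periodic_reduce[of P] assms(2) by (metis image_eqI image_subsetI)
  moreover have "bounded (P ` {0..2*pi})"
    by (intro compact_imp_bounded compact_continuous_image continuous_on_subset[OF assms(1)]) auto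
  ultimately show ?thesis using assms(1) by (auto simp: bcontfun_def intro: bounded_subset)
qed

text \<open>Fixed point of the operator that sends \<open>W\<close> to the periodic primitive with
  value \<open>\<rho>\<close> at 0. All images agree at 0, so \<open>contraction_estimate\<close>
  leaves the contraction factor 1/2.\<close>

lemma reduced_exists:
  assumes \<epsilon>: "8 * pi * L * \<bar>\<epsilon>\<bar> \<le> 1"
  obtains W where "reduced \<epsilon> W" "W 0 = \<rho>"
proof -
  have "\<exists>P\<in>periodic_space. apply_bcontfun P 0 = \<rho> \<and> (\<forall>t. (apply_bcontfun P has_real_derivative \<epsilon> * (h t (W t) - mean W)) (at t))"
    if W: "W \<in> periodic_space" for W :: "real \<Rightarrow>\<^sub>C real"
  proof -
    obtain P where P: "P 0 = \<rho>" "\<And>t. (P has_real_derivative \<epsilon> * (h t (W t) - mean W)) (at t)" "\<And>t. P (t + 2 * pi) = P t"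
      using periodic_primitive[of W \<rho> \<epsilon>] W unfolding periodic_space_def by auto
    have "continuous_on UNIV P"
      by (rule continuous_at_imp_continuous_on) (use DERIV_isCont[OF P(2)] in simp)
    then have "P \<in> bcontfun" using P(3) by (rule periodic_bcontfun)
    then obtain P' where "P = apply_bcontfun P'" using bcontfunE by blast
    then show ?thesis using P by (intro bexI[of _ P']) (auto simp: periodic_space_def)
  qed
  then obtain T where T: "\<And>W. W \<in> periodic_space \<Longrightarrow> T W \<in> periodic_space" "\<And>W. W \<in> periodic_space \<Longrightarrow> apply_bcontfun (T W) 0 = \<rho>"
    "\<And>W t. W \<in> periodic_space \<Longrightarrow> (apply_bcontfun (T W) has_real_derivative \<epsilon> * (h t (W t) - mean W)) (at t)"
    by metis
  have "\<exists>!W\<in>periodic_space. T W = W"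
  proof (rule Banach_fix[OF complete_periodic_space, of "1/2"])
    have "const_bcontfun 0 \<in> periodic_space" by (simp add: periodic_space_def const_bcontfun.rep_eq)
    then show "periodic_space \<noteq> {}" by blast
    show "T ` periodic_space \<subseteq> periodic_space" using T(1) by blast
    fix W V assume WV: "W \<in> periodic_space" "V \<in> periodic_space"
    have "dist (T W) (T V) \<le> dist W V / 2"
    proof (rule dist_bound)
      fix t
      have "\<bar>T W t - T V t\<bar> \<le> \<bar>T W 0 - T V 0\<bar> + dist W V / 2"
      proof (rule contraction_estimate[OF \<epsilon> _ _ _ T(3)[OF WV(1)] _ T(3)[OF WV(2)]])
        show "\<bar>W t - V t\<bar> \<le> dist W V" for t using dist_bounded[of W t V] by (simp add: dist_real_def)
      qed (use T(1)[OF WV(1)] T(1)[OF WV(2)] in \<open>auto simp: periodic_space_def\<close>)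
      then show "dist (T W t) (T V t) \<le> dist W V / 2" using T(2) WV by (simp add: dist_real_def)
    qed
    then show "dist (T W) (T V) \<le> 1 / 2 * dist W V" by simp
  qed auto
  then obtain W where W: "W \<in> periodic_space" "T W = W" by blast
  have "reduced \<epsilon> W" using T(3)[OF W(1)] W by (auto simp: reduced_def periodic_space_def)
  then show ?thesis using that T(2)[OF W(1)] W(2) by simp
qed

text \<open>The remaining equation has one real unknown, the initial value. The mean depends on it
  Lipschitz continuously by \<open>reduced_dist\<close>, so the intermediate value theorem applies;
  the sign condition excludes the two end values.\<close>

lemma mean_zero_solution:
  assumes \<epsilon>: "8 * pi * L * \<bar>\<epsilon>\<bar> \<le> 1" and \<rho>: "\<rho>1 \<le> \<rho>2"
    and sgn: "\<And>W V. reduced \<epsilon> W \<Longrightarrow> W 0 = \<rho>1 \<Longrightarrow> reduced \<epsilon> V \<Longrightarrow> V 0 = \<rho>2 \<Longrightarrow> mean W * mean V < 0"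
  obtains W where "reduced \<epsilon> W" "mean W = 0" "\<rho>1 < W 0" "W 0 < \<rho>2"
proof -
  have "\<exists>W. reduced \<epsilon> W \<and> W 0 = \<rho>" for \<rho>
    by (rule reduced_exists[OF \<epsilon>, of \<rho>]) blast
  then have "\<forall>\<rho>. \<exists>W. reduced \<epsilon> W \<and> W 0 = \<rho>" by blast
  from choice[OF this] obtain w where w: "\<And>\<rho>. reduced \<epsilon> (w \<rho>)" "\<And>\<rho>. w \<rho> 0 = \<rho>" by blast
  have lip: "\<bar>mean (w \<rho>) - mean (w \<sigma>)\<bar> \<le> L * (2 * \<bar>\<rho> - \<sigma>\<bar>)" for \<rho> \<sigma>
    using reduced_dist[OF \<epsilon> w(1) w(1), of \<rho> _ \<sigma>] w(2)
    by (intro mean_lipschitz reducedD(3)[OF w(1)]) auto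
  have "isCont (\<lambda>\<rho>. mean (w \<rho>)) \<rho>" for \<rho>
    unfolding continuous_at_eps_delta
  proof (intro allI impI)
    fix e :: real assume e: "0 < e"
    show "\<exists>d>0. \<forall>\<sigma>. dist \<sigma> \<rho> < d \<longrightarrow> dist (mean (w \<sigma>)) (mean (w \<rho>)) < e"
    proof (intro exI[of _ "e / (2 * L)"] conjI allI impI)
      show "0 < e / (2 * L)" using e L_pos by simp
      fix \<sigma> assume "dist \<sigma> \<rho> < e / (2 * L)"
      then have "L * (2 * \<bar>\<sigma> - \<rho>\<bar>) < e" using L_pos by (simp add: dist_real_def field_simps)
      then show "dist (mean (w \<sigma>)) (mean (w \<rho>)) < e" using lip[of \<sigma> \<rho>] by (simp add: dist_real_def)
    qed
  qed
  then have cont: "\<forall>\<rho>. \<rho>1 \<le> \<rho> \<and> \<rho> \<le> \<rho>2 \<longrightarrow> isCont (\<lambda>\<rho>. mean (w \<rho>)) \<rho>" by blast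
  have s: "mean (w \<rho>1) * mean (w \<rho>2) < 0" by (rule sgn) (use w in auto)
  have "\<exists>\<rho>. \<rho>1 \<le> \<rho> \<and> \<rho> \<le> \<rho>2 \<and> mean (w \<rho>) = 0"
  proof (cases "mean (w \<rho>1) < 0")
    case True
    then have "0 < mean (w \<rho>2)" using s by (simp add: mult_less_0_iff)
    then show ?thesis using IVT[of "\<lambda>\<rho>. mean (w \<rho>)" \<rho>1 0 \<rho>2] True \<rho> cont by auto
  next
    case False
    then have "0 < mean (w \<rho>1)" "mean (w \<rho>2) < 0" using s by (auto simp: mult_less_0_iff)
    then show ?thesis using IVT2[of "\<lambda>\<rho>. mean (w \<rho>)" \<rho>2 0 \<rho>1] \<rho> cont by auto
  qed
  then obtain \<rho> where "\<rho>1 \<le> \<rho>" "\<rho> \<le> \<rho>2" "mean (w \<rho>) = 0" by blast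
  moreover have "\<rho> \<noteq> \<rho>1" "\<rho> \<noteq> \<rho>2" using calculation(3) s by auto
  ultimately show ?thesis using that[of "w \<rho>"] w by simp
qed

end

section \<open>Cycles from sign changes of the averaged cubic\<close>

context cubic_perturbation
begin

text \<open>Truncation makes the field globally Lipschitz. The solutions obtained from it remain
  strictly between \<alpha> and \<beta>, where it agrees with \<open>rhs\<close>.\<close>

definition clamp_field :: "real \<Rightarrow> real \<Rightarrow> real \<Rightarrow> real" where
  "clamp_field \<epsilon> t v = rhs a b \<epsilon> t (max \<alpha> (min \<beta> v))"

lemma clamp_in: "max \<alpha> (min \<beta> v) \<in> {\<alpha>..\<beta>}"
  using \<alpha>\<beta> by auto

text \<open>A reduced solution hardly moves, so its mean is close to the averaged field at its
  initial value. At \<open>\<rho>1\<close> and \<open>\<rho>2\<close> the mean therefore inherits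
  the opposite signs of \<open>avgpoly\<close>.\<close>

lemma cycle_between:
  assumes \<rho>: "\<alpha> < \<rho>1" "\<rho>1 < \<rho>2" "\<rho>2 < \<beta>" and sgn: "avgpoly a b \<rho>1 * avgpoly a b \<rho>2 < 0"
  obtains \<epsilon>0 where "0 < \<epsilon>0" "\<epsilon>0 \<le> e1"
    "\<And>\<epsilon>. \<bar>\<epsilon>\<bar> < \<epsilon>0 \<Longrightarrow> \<exists>W. cycle \<epsilon> W \<and> \<rho>1 < W 0 \<and> W 0 < \<rho>2 \<and> (\<forall>\<phi>. \<alpha> < W \<phi> \<and> W \<phi> < \<beta>)"
proof -
  obtain L where L: "0 < L" "\<And>\<epsilon> \<theta> w v. \<bar>\<epsilon>\<bar> \<le> e1 \<Longrightarrow> w \<in> {\<alpha>..\<beta>} \<Longrightarrow> v \<in> {\<alpha>..\<beta>} \<Longrightarrow>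
     \<bar>rhs a b \<epsilon> \<theta> w - rhs a b \<epsilon> \<theta> v\<bar> \<le> L * \<bar>w - v\<bar>"
    using that by (rule rhs_lipschitz)
  obtain M where M: "0 < M" "\<And>\<epsilon> \<theta> w. \<bar>\<epsilon>\<bar> \<le> e1 \<Longrightarrow> w \<in> {\<alpha>..\<beta>} \<Longrightarrow> \<bar>rhs a b \<epsilon> \<theta> w\<bar> \<le> M"
    "\<And>\<epsilon> \<theta> w v. \<bar>\<epsilon>\<bar> \<le> e1 \<Longrightarrow> w \<in> {\<alpha>..\<beta>} \<Longrightarrow> v \<in> {\<alpha>..\<beta>} \<Longrightarrow>
     \<bar>rhs a b \<epsilon> \<theta> w - rhs a b 0 \<theta> v\<bar> \<le> M * (\<bar>\<epsilon>\<bar> + \<bar>w - v\<bar>)"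
    using that by (rule rhs_close)
  have avg_eq: "avg \<rho> = (2 * pi * ((\<rho> - 1) / \<rho>\<^sup>2)) * avgpoly a b \<rho>" for \<rho> by (simp add: avg_def)
  have pos: "0 < 2 * pi * ((\<rho> - 1) / \<rho>\<^sup>2)" if "1 < \<rho>" for \<rho> :: real using that by simp
  have avg_sgn: "avg \<rho>1 * avg \<rho>2 < 0"
  proof -
    have eq: "avg \<rho>1 * avg \<rho>2 = (2 * pi * ((\<rho>1 - 1) / \<rho>1\<^sup>2) * (2 * pi * ((\<rho>2 - 1) / \<rho>2\<^sup>2))) * (avgpoly a b \<rho>1 * avgpoly a b \<rho>2)"
      unfolding avg_eq by (simp only: mult_ac)
    have "0 < 2 * pi * ((\<rho>1 - 1) / \<rho>1\<^sup>2) * (2 * pi * ((\<rho>2 - 1) / \<rho>2\<^sup>2))"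
      by (rule mult_pos_pos; rule pos; use \<rho> \<alpha> in simp)
    then show ?thesis unfolding eq using sgn by (rule mult_pos_neg)
  qed
  define K where "K = M * (1 + 4 * pi * M)"
  have K: "0 < K" using M(1) by (simp add: K_def add_pos_pos)
  define c where "c = min \<bar>avg \<rho>1\<bar> \<bar>avg \<rho>2\<bar> / (2 * pi)"
  have "avg \<rho>1 \<noteq> 0" "avg \<rho>2 \<noteq> 0" using avg_sgn by auto
  then have c: "0 < c" unfolding c_def by (intro divide_pos_pos) simp_all
  define gap where "gap = min (\<rho>1 - \<alpha>) (\<beta> - \<rho>2)"
  have gap: "0 < gap" using \<rho> by (simp add: gap_def)
  \<comment> \<open>In this order the bounds secure the estimates for \<open>rhs\<close>, the
    contraction, the sign of the mean at the two end values, and that solutions do not reach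
    \<alpha> or \<beta>.\<close>
  define \<epsilon>0 where "\<epsilon>0 = min (min e1 (1 / (8 * pi * L))) (min (c / K) (gap / (4 * pi * M)))"
  have \<epsilon>0: "0 < \<epsilon>0" unfolding \<epsilon>0_def using e1 L(1) c K gap M(1) by simp
  show ?thesis
  proof (rule that[OF \<epsilon>0])
    show "\<epsilon>0 \<le> e1" by (simp add: \<epsilon>0_def)
    fix \<epsilon> assume "\<bar>\<epsilon>\<bar> < \<epsilon>0"
    then have small: "\<bar>\<epsilon>\<bar> < e1" "\<bar>\<epsilon>\<bar> < 1 / (8 * pi * L)" "\<bar>\<epsilon>\<bar> < c / K" "\<bar>\<epsilon>\<bar> < gap / (4 * pi * M)"
      by (simp_all add: \<epsilon>0_def)
    have \<epsilon>L: "8 * pi * L * \<bar>\<epsilon>\<bar> \<le> 1" using small(2) L(1) by (simp add: field_simps)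
    have \<epsilon>K: "K * \<bar>\<epsilon>\<bar> < c" using small(3) K by (simp add: field_simps)
    have \<epsilon>g: "4 * pi * M * \<bar>\<epsilon>\<bar> < gap" using small(4) M(1) by (simp add: field_simps)
    have \<epsilon>e: "\<bar>\<epsilon>\<bar> \<le> e1" using small(1) by simp
    interpret periodic_field "clamp_field \<epsilon>" L
    proof
      fix W :: "real \<Rightarrow> real" assume "continuous_on UNIV W"
      then show "continuous_on UNIV (\<lambda>t. clamp_field \<epsilon> t (W t))"
        unfolding clamp_field_def
        by (intro continuous_on_rhs continuous_on_max continuous_on_min continuous_on_const clamp_in \<epsilon>e)
    next
      fix t v v'
      have "\<bar>clamp_field \<epsilon> t v - clamp_field \<epsilon> t v'\<bar> \<le> L * \<bar>max \<alpha> (min \<beta> v) - max \<alpha> (min \<beta> v')\<bar>"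
        unfolding clamp_field_def by (rule L(2)[OF \<epsilon>e clamp_in clamp_in])
      also have "\<dots> \<le> L * \<bar>v - v'\<bar>" using L(1) by (intro mult_left_mono) auto
      finally show "\<bar>clamp_field \<epsilon> t v - clamp_field \<epsilon> t v'\<bar> \<le> L * \<bar>v - v'\<bar>" .
    qed (use L(1) in \<open>auto simp: clamp_field_def rhs_periodic\<close>)
    have mean_le: "\<bar>mean W\<bar> \<le> M" if "continuous_on UNIV W" for W
    proof -
      have "\<bar>mean W - 0\<bar> \<le> M"
        by (rule mean_bound[OF that, of "\<lambda>_. 0"])
           (auto simp: clamp_field_def M(2)[OF \<epsilon>e clamp_in] has_integral_0)
      then show ?thesis by simp
    qed
    \<comment> \<open>The field and its mean are each at most \<open>M\<close>, so over a period of
      length \<open>2 * pi\<close> the drift is at most \<open>4 * pi * M * |\<epsilon>|\<close>;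
      this also explains the constant in \<open>K\<close>.\<close>
    have stay: "\<bar>W t - W 0\<bar> \<le> 4 * pi * M * \<bar>\<epsilon>\<bar>" if W: "reduced \<epsilon> W" for W t
    proof -
      obtain s where s: "s \<in> {0..2*pi}" "W t = W s" using periodic_reduce[of W t] reducedD(2)[OF W] by blast
      have "\<bar>W s - W 0\<bar> \<le> 2 * pi * (\<bar>\<epsilon>\<bar> * (2 * M))"
      proof (rule derivative_bound_period[OF reducedD(1)[OF W] _ s(1)])
        fix t
        have "\<bar>clamp_field \<epsilon> t (W t) - mean W\<bar> \<le> 2 * M"
          using M(2)[OF \<epsilon>e clamp_in, of t "W t"] mean_le[OF reducedD(3)[OF W]] unfolding clamp_field_def by linarith
        then show "\<bar>\<epsilon> * (clamp_field \<epsilon> t (W t) - mean W)\<bar> \<le> \<bar>\<epsilon>\<bar> * (2 * M)"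
          unfolding abs_mult by (intro mult_left_mono) auto
      qed
      then show ?thesis by (simp add: s(2) mult_ac)
    qed
    have near: "\<bar>mean W - avg (W 0) / (2 * pi)\<bar> < c" if W: "reduced \<epsilon> W" and W0: "W 0 \<in> {\<alpha>..\<beta>}" for W
    proof -
      have "\<bar>mean W - avg (W 0) / (2 * pi)\<bar> \<le> K * \<bar>\<epsilon>\<bar>"
      proof (rule mean_bound[OF reducedD(3)[OF W]])
        have "1 < W 0" using W0 \<alpha> by auto
        then show "((\<lambda>\<theta>. rhs a b 0 \<theta> (W 0)) has_integral 2 * pi * (avg (W 0) / (2 * pi))) {0..2*pi}"
          using rhs_integral[of "W 0" a b] by (simp add: avg_def mult.assoc)
        fix t
        have "\<bar>clamp_field \<epsilon> t (W t) - rhs a b 0 t (W 0)\<bar> \<le> M * (\<bar>\<epsilon>\<bar> + \<bar>max \<alpha> (min \<beta> (W t)) - W 0\<bar>)"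
          unfolding clamp_field_def by (rule M(3)[OF \<epsilon>e clamp_in W0])
        also have "\<bar>max \<alpha> (min \<beta> (W t)) - W 0\<bar> \<le> \<bar>W t - W 0\<bar>" using W0 by auto
        also have "\<dots> \<le> 4 * pi * M * \<bar>\<epsilon>\<bar>" by (rule stay[OF W])
        finally show "\<bar>clamp_field \<epsilon> t (W t) - rhs a b 0 t (W 0)\<bar> \<le> K * \<bar>\<epsilon>\<bar>"
          using M(1) by (simp add: K_def algebra_simps)
      qed
      then show ?thesis using \<epsilon>K by simp
    qed
    have sign_mean: "mean W * avg (W 0) > 0" if W: "reduced \<epsilon> W" and W0: "W 0 = \<rho>1 \<or> W 0 = \<rho>2" for W
    proof -
      have "c \<le> \<bar>avg (W 0) / (2 * pi)\<bar>" using W0 by (auto simp: c_def abs_divide divide_right_mono)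
      moreover have "\<bar>mean W - avg (W 0) / (2 * pi)\<bar> < c" by (rule near[OF W]) (use W0 \<rho> in auto)
      moreover have "0 < m * x" if "c \<le> \<bar>x\<bar>" "\<bar>m - x\<bar> < c" for m x :: real
      proof (cases "0 < x")
        case True
        then have "0 < m" using that by linarith
        then show ?thesis using True by simp
      next
        case False
        then have "x < 0" "m < 0" using that c by linarith+
        then show ?thesis by (rule mult_neg_neg[rotated])
      qed
      ultimately have "mean W * (avg (W 0) / (2 * pi)) > 0" by blast
      then show ?thesis by (simp add: zero_less_mult_iff zero_less_divide_iff divide_less_0_iff)
    qed
    obtain W where W: "reduced \<epsilon> W" "mean W = 0" "\<rho>1 < W 0" "W 0 < \<rho>2"
    proof (rule mean_zero_solution[OF \<epsilon>L])
      show "\<rho>1 \<le> \<rho>2" using \<rho> by simp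
      fix W V assume h: "reduced \<epsilon> W" "W 0 = \<rho>1" "reduced \<epsilon> V" "V 0 = \<rho>2"
      have "mean W * avg \<rho>1 > 0" "mean V * avg \<rho>2 > 0" using sign_mean[OF h(1)] sign_mean[OF h(3)] h by auto
      then show "mean W * mean V < 0" using avg_sgn by (auto simp: zero_less_mult_iff mult_less_0_iff)
    qed blast
    have inside: "\<alpha> < W \<phi>" "W \<phi> < \<beta>" for \<phi>
      using stay[OF W(1), of \<phi>] \<epsilon>g W(3,4) unfolding gap_def by linarith+
    have "solution \<epsilon> W"
      unfolding solution_def
    proof (intro conjI allI)
      fix \<phi>
      show "W \<phi> \<in> {\<alpha>..\<beta>}" using inside[of \<phi>] by simp
      have "max \<alpha> (min \<beta> (W \<phi>)) = W \<phi>" using inside[of \<phi>] by simp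
      then show "(W has_real_derivative \<epsilon> * rhs a b \<epsilon> \<phi> (W \<phi>)) (at \<phi>)"
        using reducedD(1)[OF W(1), of \<phi>] by (simp add: W(2) clamp_field_def)
    qed
    then show "\<exists>W. cycle \<epsilon> W \<and> \<rho>1 < W 0 \<and> W 0 < \<rho>2 \<and> (\<forall>\<phi>. \<alpha> < W \<phi> \<and> W \<phi> < \<beta>)"
      using W inside reducedD(2)[OF W(1)] by (auto simp: cycle_def)
  qed
qed

end

section \<open>Counting limit cycles\<close>

lemma annulus_iff:
  assumes "0 \<le> r1" "0 \<le> r2"
  shows "(x, y) \<in> annulus r1 r2 \<longleftrightarrow> sqrt (1 + (x\<^sup>2 + y\<^sup>2)) \<in> {sqrt (1 + r1\<^sup>2)..sqrt (1 + r2\<^sup>2)}"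
proof -
  have "r1 = sqrt (r1\<^sup>2)" "r2 = sqrt (r2\<^sup>2)" using assms by auto
  then have "r1 \<le> sqrt (x\<^sup>2 + y\<^sup>2) \<longleftrightarrow> r1\<^sup>2 \<le> x\<^sup>2 + y\<^sup>2" "sqrt (x\<^sup>2 + y\<^sup>2) \<le> r2 \<longleftrightarrow> x\<^sup>2 + y\<^sup>2 \<le> r2\<^sup>2"
    by (metis real_sqrt_le_iff)+
  then show ?thesis by (simp add: annulus_def)
qed

context cubic_perturbation
begin

definition ring :: "(real \<times> real) set" where
  "ring = {(x, y). sqrt (1 + (x\<^sup>2 + y\<^sup>2)) \<in> {\<alpha>..\<beta>}}"

lemma curve_subset_ring: "cycle \<epsilon> W \<Longrightarrow> curve W \<subseteq> ring"
  using solutionD(2)[of \<epsilon> W] cycle_gt1[of \<epsilon> W]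
  by (auto simp: curve_def ring_def curve_point cycle_def)

lemma periodic_orbits_in_ring:
  assumes "\<bar>\<epsilon>\<bar> \<le> e1"
  shows "periodic_orbit (perturbed_field a b \<epsilon>) C \<and> C \<subseteq> ring \<longleftrightarrow> C \<in> curve ` {W. cycle \<epsilon> W}"
proof
  assume "periodic_orbit (perturbed_field a b \<epsilon>) C \<and> C \<subseteq> ring"
  then obtain W where "cycle \<epsilon> W" "C = curve W"
    using periodic_orbit_imp_curve[OF assms, of C] unfolding ring_def by blast
  then show "C \<in> curve ` {W. cycle \<epsilon> W}" by blast
qed (use periodic_orbit_curve[OF assms] curve_subset_ring in blast)

lemma limit_cycles_in_ring_subset:
  assumes "\<bar>\<epsilon>\<bar> \<le> e1"
  shows "limit_cycles_in (perturbed_field a b \<epsilon>) ring \<subseteq> curve ` {W. cycle \<epsilon> W}"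
  using periodic_orbits_in_ring[OF assms] by (auto simp: limit_cycles_in_def limit_cycle_def)

lemma four_cycles_of_card:
  assumes \<epsilon>: "\<bar>\<epsilon>\<bar> \<le> e1" and S: "S \<subseteq> {W. cycle \<epsilon> W}" "finite S" "card S = 4"
  obtains W where "four_cycles \<epsilon> W"
proof -
  define V where "V = (\<lambda>W. W 0) ` S"
  have inj: "inj_on (\<lambda>W. W (0::real)) S"
  proof (rule inj_onI)
    fix W W' assume "W \<in> S" "W' \<in> S" "W 0 = W' 0"
    then show "W = W'" using S(1) solution_unique[OF \<epsilon>, of W W' 0] by (auto simp: cycle_def)
  qed
  have V: "finite V" "card V = 4" using S inj by (auto simp: V_def card_image)
  define l where "l = sorted_list_of_set V"
  have l: "length l = 4" "set l = V" using V by (simp_all add: l_def)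
  have "\<exists>W. cycle \<epsilon> W \<and> W 0 = l ! k" if "k \<le> 3" for k
  proof -
    have "l ! k \<in> V" using nth_mem[of k l] that by (simp add: l)
    then show ?thesis using S(1) by (auto simp: V_def)
  qed
  then obtain W where W: "\<And>k. k \<le> 3 \<Longrightarrow> cycle \<epsilon> (W k) \<and> W k 0 = l ! k" by metis
  have "W j 0 < W k 0" if "j < k" "k \<le> 3" for j k
  proof -
    have "l ! j < l ! k"
      by (rule sorted_wrt_nth_less[OF strict_sorted_list_of_set[of V, folded l_def]]) (use that l in auto)
    then show ?thesis using W[of j] W[of k] that by simp
  qed
  then show ?thesis using W that[of W] by (auto simp: four_cycles_def)
qed

lemma at_most_three_cycles:
  assumes "avgpoly a b z \<noteq> 0"
  obtains \<epsilon>0 where "0 < \<epsilon>0" "\<epsilon>0 \<le> e1"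
    "\<And>\<epsilon>. 0 < \<bar>\<epsilon>\<bar> \<Longrightarrow> \<bar>\<epsilon>\<bar> < \<epsilon>0 \<Longrightarrow> finite {W. cycle \<epsilon> W} \<and> card {W. cycle \<epsilon> W} \<le> 3"
proof -
  obtain \<epsilon>0 where \<epsilon>0: "0 < \<epsilon>0" "\<epsilon>0 \<le> e1" "\<And>\<epsilon> W. 0 < \<bar>\<epsilon>\<bar> \<Longrightarrow> \<bar>\<epsilon>\<bar> < \<epsilon>0 \<Longrightarrow> four_cycles \<epsilon> W \<Longrightarrow> False"
    using that by (rule no_four_cycles[OF assms])
  show ?thesis
  proof (rule that[OF \<epsilon>0(1,2)], rule ccontr)
    fix \<epsilon> assume \<epsilon>: "0 < \<bar>\<epsilon>\<bar>" "\<bar>\<epsilon>\<bar> < \<epsilon>0"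
      and neg: "\<not> (finite {W. cycle \<epsilon> W} \<and> card {W. cycle \<epsilon> W} \<le> 3)"
    have \<epsilon>e: "\<bar>\<epsilon>\<bar> \<le> e1" using \<epsilon> \<epsilon>0 by simp
    obtain S where "S \<subseteq> {W. cycle \<epsilon> W}" "finite S" "card S = 4"
    \<comment> \<open>Since \<open>card\<close> is 0 on infinite sets, infinitude has to be refuted
      separately; in both cases four cycles can be selected.\<close>
    proof (cases "finite {W. cycle \<epsilon> W}")
      case True
      then have "4 \<le> card {W. cycle \<epsilon> W}" using neg by simp
      then show ?thesis using obtain_subset_with_card_n[of 4 "{W. cycle \<epsilon> W}"] that by metis
    next
      case False
      then show ?thesis using infinite_arbitrarily_large[of "{W. cycle \<epsilon> W}" 4] that by metis
    qed
    then obtain W where "four_cycles \<epsilon> W" using four_cycles_of_card[OF \<epsilon>e] by metis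
    then show False using \<epsilon>0(3) \<epsilon> by metis
  qed
qed

lemma compact_curve:
  assumes "cycle \<epsilon> W"
  shows "compact (curve W)"
proof -
  define f where "f \<phi> = (rad (W \<phi>) * cos \<phi>, rad (W \<phi>) * sin \<phi>)" for \<phi>
  have "continuous_on UNIV W" using assms solutionD(3) by (auto simp: cycle_def)
  then have cont: "continuous_on UNIV f"
    unfolding f_def by (intro continuous_intros continuous_on_rad)
  have "f (\<phi> + 2 * pi) = f \<phi>" for \<phi> using assms by (simp add: f_def cycle_def)
  then have "range f = f ` {0..2*pi}" using periodic_reduce[of f] by (metis image_eqI image_subsetI subset_UNIV image_mono subset_antisym)
  moreover have "compact (f ` {0..2*pi})"
    by (intro compact_continuous_image continuous_on_subset[OF cont]) auto
  moreover have "curve W = range f" by (simp add: curve_def f_def[abs_def])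
  ultimately show ?thesis by simp
qed

text \<open>Finitely many disjoint compact orbits can be separated from each other. A neighbourhood
  for isolation must also exclude orbits that leave the annulus, about which nothing is known;
  cycles strictly inside have the open annulus \<open>I\<close> available for that.\<close>

lemma limit_cycles_of_interior_cycles:
  assumes \<epsilon>: "\<bar>\<epsilon>\<bar> \<le> e1" and fin: "finite {W. cycle \<epsilon> W}"
    and inside: "\<And>W \<phi>. cycle \<epsilon> W \<Longrightarrow> \<alpha> < W \<phi> \<and> W \<phi> < \<beta>"
  shows "limit_cycles_in (perturbed_field a b \<epsilon>) ring = curve ` {W. cycle \<epsilon> W}"
    and "card (curve ` {W. cycle \<epsilon> W}) = card {W. cycle \<epsilon> W}"
proof -
  have ne: "curve W \<noteq> {}" for W by (simp add: curve_def)
  show "card (curve ` {W. cycle \<epsilon> W}) = card {W. cycle \<epsilon> W}"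
  proof (rule card_image, rule inj_onI)
    fix W V assume "W \<in> {W. cycle \<epsilon> W}" "V \<in> {W. cycle \<epsilon> W}" "curve W = curve V"
    then show "W = V" using cycle_curve_inj[OF \<epsilon>, of W V] ne by auto
  qed
  have "curve W \<in> limit_cycles_in (perturbed_field a b \<epsilon>) ring" if W: "cycle \<epsilon> W" for W
  proof -
    define others where "others = \<Union> (curve ` ({V. cycle \<epsilon> V} - {W}))"
    define I where "I = {p :: real \<times> real. sqrt (1 + ((fst p)\<^sup>2 + (snd p)\<^sup>2)) \<in> {\<alpha><..<\<beta>}}"
    have "closed others"
      unfolding others_def using fin by (intro closed_Union) (auto intro: compact_imp_closed compact_curve)
    moreover have "open I"
    proof -
      have "continuous_on UNIV (\<lambda>p :: real \<times> real. sqrt (1 + ((fst p)\<^sup>2 + (snd p)\<^sup>2)))"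
        by (intro continuous_intros)
      from open_vimage[OF open_greaterThanLessThan this] show ?thesis by (simp add: I_def vimage_def)
    qed
    ultimately have "open (I - others)" by (rule open_Diff[rotated])
    moreover have "curve W \<subseteq> I - others"
    proof -
      have "curve W \<subseteq> I" using inside[OF W] cycle_gt1[OF W] by (auto simp: curve_def I_def curve_point)
      moreover have "curve W \<inter> curve V = {}" if "cycle \<epsilon> V" "V \<noteq> W" for V
        using cycle_curve_inj[OF \<epsilon> W that(1)] that(2) by blast
      ultimately show ?thesis by (auto simp: others_def)
    qed
    moreover have "C' = curve W" if C': "periodic_orbit (perturbed_field a b \<epsilon>) C'" "C' \<subseteq> I - others" for C'
    proof -
      have "C' \<subseteq> ring" using C'(2) by (force simp: I_def ring_def)
      then obtain V where V: "cycle \<epsilon> V" "C' = curve V"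
        using periodic_orbits_in_ring[OF \<epsilon>, of C'] C'(1) by blast
      have "V = W"
      proof (rule ccontr)
        assume "V \<noteq> W"
        then have "curve V \<subseteq> others" using V(1) by (auto simp: others_def)
        then show False using C'(2) V(2) ne[of V] by blast
      qed
      then show ?thesis using V(2) by simp
    qed
    ultimately have "limit_cycle (perturbed_field a b \<epsilon>) (curve W)"
      unfolding limit_cycle_def using periodic_orbit_curve[OF \<epsilon> W] by blast
    then show ?thesis using curve_subset_ring[OF W] by (simp add: limit_cycles_in_def)
  qed
  then show "limit_cycles_in (perturbed_field a b \<epsilon>) ring = curve ` {W. cycle \<epsilon> W}"
    using limit_cycles_in_ring_subset[OF \<epsilon>] by blast
qed

end

lemma annulus_perturbation:
  assumes "0 < r1" "r1 < r2"
  obtains e1 where "cubic_perturbation a b (sqrt (1 + r1\<^sup>2)) (sqrt (1 + r2\<^sup>2)) e1"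
    "cubic_perturbation.ring (sqrt (1 + r1\<^sup>2)) (sqrt (1 + r2\<^sup>2)) = annulus r1 r2"
proof -
  have \<alpha>: "1 < sqrt (1 + r1\<^sup>2)" "sqrt (1 + r1\<^sup>2) < sqrt (1 + r2\<^sup>2)"
    using assms by (auto simp: power_strict_mono)
  obtain e1 where "0 < e1" "e1 \<le> 1"
    "\<And>\<epsilon> \<theta> w. \<bar>\<epsilon>\<bar> \<le> e1 \<Longrightarrow> sqrt (1 + r1\<^sup>2) \<le> w \<Longrightarrow> w \<le> sqrt (1 + r2\<^sup>2) \<Longrightarrow> 1 / 2 \<le> omega a b \<epsilon> \<theta> w"
    using omega_bounded_below[OF \<alpha>, of a b] by metis
  then have cp: "cubic_perturbation a b (sqrt (1 + r1\<^sup>2)) (sqrt (1 + r2\<^sup>2)) e1"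
    using \<alpha> by unfold_locales auto
  have "cubic_perturbation.ring (sqrt (1 + r1\<^sup>2)) (sqrt (1 + r2\<^sup>2)) = annulus r1 r2"
    unfolding cubic_perturbation.ring_def[OF cp] using annulus_iff[of r1 r2] assms by auto
  with cp show ?thesis by (rule that)
qed

text \<open>Finiteness accompanies each count because \<open>card\<close> is 0 on infinite sets,
  which would make the upper bound alone too weak.\<close>

theorem corollary1p2:
  shows "(\<forall>a b r1 r2. (\<exists>r>0. average_function a b r \<noteq> 0) \<and> 0 < r1 \<and> r1 < r2 \<longrightarrow>
            (\<exists>\<epsilon>0>0. \<forall>\<epsilon>. 0 < \<bar>\<epsilon>\<bar> \<and> \<bar>\<epsilon>\<bar> < \<epsilon>0 \<longrightarrow>
               finite (limit_cycles_in (perturbed_field a b \<epsilon>) (annulus r1 r2)) \<and>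
               card (limit_cycles_in (perturbed_field a b \<epsilon>) (annulus r1 r2)) \<le> 3))
       \<and> (\<exists>a b r1 r2. (\<exists>r>0. average_function a b r \<noteq> 0) \<and> 0 < r1 \<and> r1 < r2 \<and>
            (\<exists>\<epsilon>0>0. \<forall>\<epsilon>. 0 < \<bar>\<epsilon>\<bar> \<and> \<bar>\<epsilon>\<bar> < \<epsilon>0 \<longrightarrow>
               finite (limit_cycles_in (perturbed_field a b \<epsilon>) (annulus r1 r2)) \<and>
               card (limit_cycles_in (perturbed_field a b \<epsilon>) (annulus r1 r2)) = 3))"
proof (intro conjI allI impI)
  fix a b :: "nat \<Rightarrow> nat \<Rightarrow> real" and r1 r2 :: real
  assume A: "(\<exists>r>0. average_function a b r \<noteq> 0) \<and> 0 < r1 \<and> r1 < r2"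
  then obtain r where r: "0 < r" "average_function a b r \<noteq> 0" by blast
  then have z: "avgpoly a b (sqrt (1 + r\<^sup>2)) \<noteq> 0" by (auto simp: average_function_eq)
  obtain e1 where cp: "cubic_perturbation a b (sqrt (1 + r1\<^sup>2)) (sqrt (1 + r2\<^sup>2)) e1"
    and ring: "cubic_perturbation.ring (sqrt (1 + r1\<^sup>2)) (sqrt (1 + r2\<^sup>2)) = annulus r1 r2"
    using annulus_perturbation A by metis
  interpret cubic_perturbation a b "sqrt (1 + r1\<^sup>2)" "sqrt (1 + r2\<^sup>2)" e1 by (rule cp)
  obtain \<epsilon>0 where \<epsilon>0: "0 < \<epsilon>0" "\<epsilon>0 \<le> e1"
    "\<And>\<epsilon>. 0 < \<bar>\<epsilon>\<bar> \<Longrightarrow> \<bar>\<epsilon>\<bar> < \<epsilon>0 \<Longrightarrow> finite {W. cycle \<epsilon> W} \<and> card {W. cycle \<epsilon> W} \<le> 3"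
    using that by (rule at_most_three_cycles[OF z])
  show "\<exists>\<epsilon>0>0. \<forall>\<epsilon>. 0 < \<bar>\<epsilon>\<bar> \<and> \<bar>\<epsilon>\<bar> < \<epsilon>0 \<longrightarrow>
      finite (limit_cycles_in (perturbed_field a b \<epsilon>) (annulus r1 r2)) \<and>
      card (limit_cycles_in (perturbed_field a b \<epsilon>) (annulus r1 r2)) \<le> 3"
  proof (intro exI[of _ \<epsilon>0] conjI allI impI \<epsilon>0(1))
    fix \<epsilon> assume \<epsilon>: "0 < \<bar>\<epsilon>\<bar> \<and> \<bar>\<epsilon>\<bar> < \<epsilon>0"
    have fin: "finite {W. cycle \<epsilon> W}" "card {W. cycle \<epsilon> W} \<le> 3" using \<epsilon>0(3)[of \<epsilon>] \<epsilon> by auto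
    have sub: "limit_cycles_in (perturbed_field a b \<epsilon>) (annulus r1 r2) \<subseteq> curve ` {W. cycle \<epsilon> W}"
      unfolding ring[symmetric] using \<epsilon> \<epsilon>0(2) by (intro limit_cycles_in_ring_subset) auto
    show "finite (limit_cycles_in (perturbed_field a b \<epsilon>) (annulus r1 r2))"
      using sub fin(1) by (rule finite_subset[OF _ finite_imageI])
    show "card (limit_cycles_in (perturbed_field a b \<epsilon>) (annulus r1 r2)) \<le> 3"
      using card_mono[OF finite_imageI[OF fin(1)] sub] card_image_le[OF fin(1), of curve] fin(2) by linarith
  qed
next
  \<comment> \<open>With \<open>a 3 0\<close> and \<open>b 2 1\<close> zero, comparing coefficients
    of \<open>avgpoly\<close> with those of \<open>(w - 2) * (w - 3) * (w - 4)\<close> determines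
    the four remaining values.\<close>
  define a b :: "nat \<Rightarrow> nat \<Rightarrow> real"
    where "a = (\<lambda>i j. if (i, j) = (1, 0) then - 24 else if (i, j) = (1, 2) then - 17 else 0)"
      and "b = (\<lambda>i j. if (i, j) = (0, 1) then 18 else if (i, j) = (0, 3) then 1 else 0)"
  \<comment> \<open>Both radii make \<open>sqrt (1 + r^2)\<close> rational, namely 5/4 and 101/20.
    These enclose the points 3/2, 5/2, 7/2, 9/2, which separate the roots 2, 3, 4 of the
    cubic.\<close>
  define r1 r2 :: real where "r1 = 3 / 4" and "r2 = 99 / 20"
  have p: "avgpoly a b w = (w - 2) * (w - 3) * (w - 4)" for w
    by (simp add: avgpoly_def a_def b_def field_simps)
  have r: "0 < r1" "r1 < r2" by (simp_all add: r1_def r2_def)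
  have s: "sqrt (1 + r1\<^sup>2) = 5 / 4" "sqrt (1 + r2\<^sup>2) = 101 / 20"
    by (rule real_sqrt_unique; simp add: r1_def r2_def power2_eq_square)+
  have nz: "\<exists>r>0. average_function a b r \<noteq> 0"
    by (intro exI[of _ r1]) (simp add: average_function_eq r s p, use r in simp)
  obtain e1 where cp: "cubic_perturbation a b (5 / 4) (101 / 20) e1"
    and ring: "cubic_perturbation.ring (5 / 4) (101 / 20) = annulus r1 r2"
    using annulus_perturbation[OF r, of a b] unfolding s by metis
  interpret cubic_perturbation a b "5 / 4" "101 / 20" e1 by (rule cp)
  have ex: "\<exists>\<epsilon>0>0. \<epsilon>0 \<le> e1 \<and> (\<forall>\<epsilon>. \<bar>\<epsilon>\<bar> < \<epsilon>0 \<longrightarrow> (\<exists>W. cycle \<epsilon> W \<and> u < W 0 \<and> W 0 < v \<and> (\<forall>\<phi>. 5 / 4 < W \<phi> \<and> W \<phi> < 101 / 20)))"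
    if "5 / 4 < u" "u < v" "v < 101 / 20" "avgpoly a b u * avgpoly a b v < 0" for u v
    using cycle_between[OF that] by metis
  obtain \<epsilon>1 where \<epsilon>1: "0 < \<epsilon>1" "\<epsilon>1 \<le> e1" "\<And>\<epsilon>. \<bar>\<epsilon>\<bar> < \<epsilon>1 \<Longrightarrow>
      \<exists>W. cycle \<epsilon> W \<and> 3 / 2 < W 0 \<and> W 0 < 5 / 2 \<and> (\<forall>\<phi>. 5 / 4 < W \<phi> \<and> W \<phi> < 101 / 20)"
    using ex[of "3/2" "5/2"] by (auto simp: p)
  obtain \<epsilon>2 where \<epsilon>2: "0 < \<epsilon>2" "\<epsilon>2 \<le> e1" "\<And>\<epsilon>. \<bar>\<epsilon>\<bar> < \<epsilon>2 \<Longrightarrow>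
      \<exists>W. cycle \<epsilon> W \<and> 5 / 2 < W 0 \<and> W 0 < 7 / 2 \<and> (\<forall>\<phi>. 5 / 4 < W \<phi> \<and> W \<phi> < 101 / 20)"
    using ex[of "5/2" "7/2"] by (auto simp: p)
  obtain \<epsilon>3 where \<epsilon>3: "0 < \<epsilon>3" "\<epsilon>3 \<le> e1" "\<And>\<epsilon>. \<bar>\<epsilon>\<bar> < \<epsilon>3 \<Longrightarrow>
      \<exists>W. cycle \<epsilon> W \<and> 7 / 2 < W 0 \<and> W 0 < 9 / 2 \<and> (\<forall>\<phi>. 5 / 4 < W \<phi> \<and> W \<phi> < 101 / 20)"
    using ex[of "7/2" "9/2"] by (auto simp: p)
  have z: "avgpoly a b 5 \<noteq> 0" by (simp add: p)
  obtain \<epsilon>4 where \<epsilon>4: "0 < \<epsilon>4" "\<epsilon>4 \<le> e1"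
    "\<And>\<epsilon>. 0 < \<bar>\<epsilon>\<bar> \<Longrightarrow> \<bar>\<epsilon>\<bar> < \<epsilon>4 \<Longrightarrow> finite {W. cycle \<epsilon> W} \<and> card {W. cycle \<epsilon> W} \<le> 3"
    using that by (rule at_most_three_cycles[OF z])
  define \<epsilon>0 where "\<epsilon>0 = min (min \<epsilon>1 \<epsilon>2) (min \<epsilon>3 \<epsilon>4)"
  have "finite (limit_cycles_in (perturbed_field a b \<epsilon>) (annulus r1 r2)) \<and>
      card (limit_cycles_in (perturbed_field a b \<epsilon>) (annulus r1 r2)) = 3"
    if \<epsilon>: "0 < \<bar>\<epsilon>\<bar>" "\<bar>\<epsilon>\<bar> < \<epsilon>0" for \<epsilon>
  proof -
    have lt: "\<bar>\<epsilon>\<bar> < \<epsilon>1" "\<bar>\<epsilon>\<bar> < \<epsilon>2" "\<bar>\<epsilon>\<bar> < \<epsilon>3" "\<bar>\<epsilon>\<bar> < \<epsilon>4" "\<bar>\<epsilon>\<bar> \<le> e1"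
      using \<epsilon>(2) \<epsilon>1(2) by (auto simp: \<epsilon>0_def)
    obtain W1 where W1: "cycle \<epsilon> W1" "3 / 2 < W1 0" "W1 0 < 5 / 2" "\<And>\<phi>. 5 / 4 < W1 \<phi> \<and> W1 \<phi> < 101 / 20"
      using \<epsilon>1(3)[OF lt(1)] by blast
    obtain W2 where W2: "cycle \<epsilon> W2" "5 / 2 < W2 0" "W2 0 < 7 / 2" "\<And>\<phi>. 5 / 4 < W2 \<phi> \<and> W2 \<phi> < 101 / 20"
      using \<epsilon>2(3)[OF lt(2)] by blast
    obtain W3 where W3: "cycle \<epsilon> W3" "7 / 2 < W3 0" "W3 0 < 9 / 2" "\<And>\<phi>. 5 / 4 < W3 \<phi> \<and> W3 \<phi> < 101 / 20"
      using \<epsilon>3(3)[OF lt(3)] by blast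
    have "W1 \<noteq> W2" "W2 \<noteq> W3" "W1 \<noteq> W3" using W1 W2 W3 by auto
    then have card: "card {W1, W2, W3} = 3" by simp
    have fin: "finite {W. cycle \<epsilon> W}" "card {W. cycle \<epsilon> W} \<le> 3" using \<epsilon>4(3)[OF \<epsilon>(1) lt(4)] by auto
    \<comment> \<open>Three cycles among at most three are all of them. In particular no cycle
      touches the boundary of the annulus, which is the condition for each orbit to be
      isolated.\<close>
    have all: "{W1, W2, W3} = {W. cycle \<epsilon> W}"
      by (rule card_seteq[OF fin(1)]) (use W1 W2 W3 card fin(2) in auto)
    have inside: "5 / 4 < W \<phi> \<and> W \<phi> < 101 / 20" if "cycle \<epsilon> W" for W \<phi>
    proof -
      have "W \<in> {W1, W2, W3}" unfolding all using that by simp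
      then show ?thesis using W1(4)[of \<phi>] W2(4)[of \<phi>] W3(4)[of \<phi>] by auto
    qed
    have "limit_cycles_in (perturbed_field a b \<epsilon>) (annulus r1 r2) = curve ` {W. cycle \<epsilon> W}"
      unfolding ring[symmetric] by (rule limit_cycles_of_interior_cycles(1)[OF lt(5) fin(1)]) (rule inside)
    moreover have "card (curve ` {W. cycle \<epsilon> W}) = card {W. cycle \<epsilon> W}"
      by (rule limit_cycles_of_interior_cycles(2)[OF lt(5) fin(1)]) (rule inside)
    ultimately show ?thesis using fin(1) card all by simp
  qed
  moreover have "0 < \<epsilon>0" using \<epsilon>1(1) \<epsilon>2(1) \<epsilon>3(1) \<epsilon>4(1) by (simp add: \<epsilon>0_def)
  ultimately show "\<exists>a b r1 r2. (\<exists>r>0. average_function a b r \<noteq> 0) \<and> 0 < r1 \<and> r1 < r2 \<and>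
      (\<exists>\<epsilon>0>0. \<forall>\<epsilon>. 0 < \<bar>\<epsilon>\<bar> \<and> \<bar>\<epsilon>\<bar> < \<epsilon>0 \<longrightarrow>
        finite (limit_cycles_in (perturbed_field a b \<epsilon>) (annulus r1 r2)) \<and>
        card (limit_cycles_in (perturbed_field a b \<epsilon>) (annulus r1 r2)) = 3)"
    using nz r by blast
qed

end
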